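(* Let $\Omega$ be a slice domain in $\mathbb{H}$ and let $f:\Omega\to\mathbb{H}$ be a nonconstant slice regular function. Fix $p\in\Omega$, let $df_p$ denote the real differential of $f$ at $p$, and set $h:=f-f(p)$. 1. If $p\in\mathbb{R}$, then $df_p$ is singular if, and only if, the Cullen derivative $f'_c(p)$ vanishes. This happens if, and only if, $m_h(p)\geq2$. 2. Suppose, instead, $p=x+yI$ with $x,y\in\mathbb{R}$, $y>0$, $I\in\mathbb{S}$, and let $C$ denote the connected component of $(x+y\mathbb{S})\cap\Omega$ including $p$. Let $2m$ denote the spherical multiplicity of $h$ at $C$ and let $n$ denote the isolated multiplicity of $h$ at $p$, relative to $C$. Then $df_p$ is singular if, and only if, $2m+n\geq2$. In particular, the spherical derivative $f'_s(p)$ vanishes if, and only if, $2m\geq2$, while the Cullen derivative $f'_c(p)$ vanishes if, and only if, $m_h^C(p)\geq2$.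
   Context: $\mathbb{H}$ is the real algebra of quaternions, $\mathbb{S}=\{J\in\mathbb{H}:J^2=-1\}$, $x+y\mathbb{S}=\{x+yJ:J\in\mathbb{S}\}$, $L_I=\mathbb{R}+I\mathbb{R}$ and $T_I=T\cap L_I$ for $I\in\mathbb{S}$, $T\subseteq\mathbb{H}$; $\mathbb{N}$ includes $0$. For $q=x+yI$ ($x,y\in\mathbb{R}$, $I\in\mathbb{S}$), $\operatorname{Re}(q)=x$ and $\operatorname{Im}(q)=yI$. A domain is a nonempty open connected set; a slice domain is a domain $\Omega\subseteq\mathbb{H}$ with $\Omega\cap\mathbb{R}\neq\emptyset$ such that $\Omega_I$ is a domain of $L_I$ for every $I\in\mathbb{S}$. A function $f:\Omega\to\mathbb{H}$ is slice regular if, for every $I\in\mathbb{S}$, the restriction $f_I$ of $f$ to $\Omega_I$ has continuous partial derivatives and $\frac12\left(\frac{\partial}{\partial x}+I\frac{\partial}{\partial y}\right)f_I(x+yI)\equiv0$. Slice regular functions on slice domains are real analytic. The Cullen derivative $f'_c:\Omega\to\mathbb{H}$ is the slice regular function with $f'_c(x+yI)=\frac12\left(\frac{\partial}{\partial x}-I\frac{\partial}{\partial y}\right)f_I(x+yI)$ on each $\Omega_I$. Spherical value and derivative: for a slice regular $f$ on a slice domain $\Omega$ and $p_0=x_0+y_0I_0\in\Omega\setminus\mathbb{R}$ ($y_0>0$, $I_0\in\mathbb{S}$), it is known that there exist a neighborhood $U\subseteq\Omega$ of $p_0$ in $x_0+y_0\mathbb{S}$ and unique quaternions $b(p_0),c(p_0)$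 (independent of $U$) with $f(x_0+y_0I)=b(p_0)+I\,c(p_0)$ for all $x_0+y_0I\in U$. Set $f^\circ_s(p_0)=b(p_0)$ and $f'_s(p_0)=y_0^{-1}c(p_0)$; for $p_0\in\Omega\cap\mathbb{R}$ set $f^\circ_s(p_0)=f(p_0)$. Operations: for $q\in\Omega\setminus\mathbb{R}$, $(f*g)(q)=f^\circ_s(q)g^\circ_s(q)+\operatorname{Im}(q)^2f'_s(q)g'_s(q)+\operatorname{Im}(q)\big(f^\circ_s(q)g'_s(q)+f'_s(q)g^\circ_s(q)\big)$ and $f^s(q)=|f^\circ_s(q)|^2-|\operatorname{Im}(q)f'_s(q)|^2+2\operatorname{Im}(q)\operatorname{Re}\big(f^\circ_s(q)\overline{f'_s(q)}\big)$; for $q\in\Omega\cap\mathbb{R}$, $(f*g)(q)=f(q)g(q)$, $f^s(q)=|f(q)|^2$. $(q-p)^{*k}$ is the $k$-th power of $q\mapsto q-p$ with respect to $*$. Divisibility: for a connected component $C$ of $(x+y\mathbb{S})\cap\Omega$ and a slice regular function $P$ on $\mathbb{H}$ (a polynomial), $P$ divides $f$ near $C$ if there exist a slice domain $\Lambda$ with $C\subseteq\Lambda\subseteq\Omega$ and a slice regular $g:\Lambda\to\mathbb{H}$ with $f=P*g$ in $\Lambda$. "Near $C$" means on some such $\Lambda$. Multiplicities, for a slice regular $h\not\equiv0$ on $\Omega$, a set $S=x+y\mathbb{S}$ meeting $\Omega$ and a connected component $C$ of $S\cap\Omega$: - for $p\in S$, the classical multiplicity $m_h^C(p)$ of $h$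 at $p$ relative to $C$ is the number $k\in\mathbb{N}$ such that $(q-p)^{*k}$ divides $h(q)$ near $C$ but $(q-p)^{*(k+1)}$ does not; if $S\cap\Omega$ is connected (e.g. $S=\{p\}$ with $p$ real) one writes $m_h(p)$; - if $y>0$, it is known that there exist unique $m,n\in\mathbb{N}$ and unique points $p_1,\dots,p_n\in S$ with $p_i\neq\overline{p_{i+1}}$ such that $h(q)=[(q-x)^2+y^2]^m(q-p_1)*\cdots*(q-p_n)*g(q)$ near $C$, where $[(q-x)^2+y^2]^{m}$ divides $h$ near $C$ but $[(q-x)^2+y^2]^{m+1}$ does not, and $g$ is slice regular with $g^s|_C\not\equiv0$. Then $2m$ is the spherical multiplicity of $h$ at $C$ and $n$ is the isolated multiplicity of $h$ at $p_1$, relative to $C$ (the isolated multiplicity relative to $C$ at the points of $S$ other than $p_1$ is $0$). *)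

theory Defs
  imports "HOL-Analysis.Analysis"
begin

section \<open>The quaternions\<close>

datatype quat = Quat (q_re: real) (q_i: real) (q_j: real) (q_k: real)

lemma quat_eq_iff:
  "p = q \<longleftrightarrow> q_re p = q_re q \<and> q_i p = q_i q \<and> q_j p = q_j q \<and> q_k p = q_k q"
  by (cases p; cases q) simp

instantiation quat :: ab_group_add
begin

definition "0 = Quat 0 0 0 0"
definition "p + q = Quat (q_re p + q_re q) (q_i p + q_i q) (q_j p + q_j q) (q_k p + q_k q)"
definition "- p = Quat (- q_re p) (- q_i p) (- q_j p) (- q_k p)" for p :: quat
definition "p - q = Quat (q_re p - q_re q) (q_i p - q_i q) (q_j p - q_j q) (q_k p - q_k q)"

instance
  by standard
    (simp_all add: quat_eq_iff zero_quat_def plus_quat_def uminus_quat_def minus_quat_def)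

end

lemma quat_zero_sel [simp]: "q_re 0 = 0" "q_i 0 = 0" "q_j 0 = 0" "q_k 0 = 0"
  by (simp_all add: zero_quat_def)

lemma quat_add_sel [simp]:
  "q_re (p + q) = q_re p + q_re q" "q_i (p + q) = q_i p + q_i q"
  "q_j (p + q) = q_j p + q_j q" "q_k (p + q) = q_k p + q_k q"
  by (simp_all add: plus_quat_def)

lemma quat_uminus_sel [simp]:
  "q_re (- p) = - q_re p" "q_i (- p) = - q_i p" "q_j (- p) = - q_j p" "q_k (- p) = - q_k p"
  by (simp_all add: uminus_quat_def)

lemma quat_diff_sel [simp]:
  "q_re (p - q) = q_re p - q_re q" "q_i (p - q) = q_i p - q_i q"
  "q_j (p - q) = q_j p - q_j q" "q_k (p - q) = q_k p - q_k q"
  by (simp_all add: minus_quat_def)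

instantiation quat :: ring_1
begin

definition "1 = Quat 1 0 0 0"
definition "p * q = Quat
  (q_re p * q_re q - q_i p * q_i q - q_j p * q_j q - q_k p * q_k q)
  (q_re p * q_i q + q_i p * q_re q + q_j p * q_k q - q_k p * q_j q)
  (q_re p * q_j q - q_i p * q_k q + q_j p * q_re q + q_k p * q_i q)
  (q_re p * q_k q + q_i p * q_j q - q_j p * q_i q + q_k p * q_re q)"

instance
  by standard (simp_all add: quat_eq_iff one_quat_def times_quat_def algebra_simps)

end

lemma quat_one_sel [simp]: "q_re 1 = 1" "q_i 1 = 0" "q_j 1 = 0" "q_k 1 = 0"
  by (simp_all add: one_quat_def)

lemma quat_mult_sel [simp]:
  "q_re (p * q) = q_re p * q_re q - q_i p * q_i q - q_j p * q_j q - q_k p * q_k q"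
  "q_i (p * q) = q_re p * q_i q + q_i p * q_re q + q_j p * q_k q - q_k p * q_j q"
  "q_j (p * q) = q_re p * q_j q - q_i p * q_k q + q_j p * q_re q + q_k p * q_i q"
  "q_k (p * q) = q_re p * q_k q + q_i p * q_j q - q_j p * q_i q + q_k p * q_re q"
  by (simp_all add: times_quat_def)

instantiation quat :: real_algebra_1
begin

definition "r *\<^sub>R p = Quat (r * q_re p) (r * q_i p) (r * q_j p) (r * q_k p)" for p :: quat

instance
  by standard (simp_all add: quat_eq_iff scaleR_quat_def algebra_simps)

end

lemma quat_scaleR_sel [simp]:
  "q_re (r *\<^sub>R p) = r * q_re p" "q_i (r *\<^sub>R p) = r * q_i p"
  "q_j (r *\<^sub>R p) = r * q_j p" "q_k (r *\<^sub>R p) = r * q_k p"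
  by (simp_all add: scaleR_quat_def)

lemma quat_of_real_sel [simp]:
  "q_re (of_real r) = r" "q_i (of_real r) = 0" "q_j (of_real r) = 0" "q_k (of_real r) = 0"
  by (simp_all add: of_real_def)

lemma quat_sum_squares_eq_0_iff:
  "(q_re p)\<^sup>2 + (q_i p)\<^sup>2 + (q_j p)\<^sup>2 + (q_k p)\<^sup>2 = 0 \<longleftrightarrow> p = 0"
  by (simp add: quat_eq_iff add_nonneg_eq_0_iff)

definition q_cnj :: "quat \<Rightarrow> quat" where
  "q_cnj p = Quat (q_re p) (- q_i p) (- q_j p) (- q_k p)"

lemma quat_cnj_sel [simp]:
  "q_re (q_cnj p) = q_re p" "q_i (q_cnj p) = - q_i p"
  "q_j (q_cnj p) = - q_j p" "q_k (q_cnj p) = - q_k p"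
  by (simp_all add: q_cnj_def)

lemma quat_mult_cnj:
  "p * q_cnj p = of_real ((q_re p)\<^sup>2 + (q_i p)\<^sup>2 + (q_j p)\<^sup>2 + (q_k p)\<^sup>2)"
  "q_cnj p * p = of_real ((q_re p)\<^sup>2 + (q_i p)\<^sup>2 + (q_j p)\<^sup>2 + (q_k p)\<^sup>2)"
  by (simp_all add: quat_eq_iff power2_eq_square)

instantiation quat :: real_div_algebra
begin

definition "inverse p = q_cnj p /\<^sub>R ((q_re p)\<^sup>2 + (q_i p)\<^sup>2 + (q_j p)\<^sup>2 + (q_k p)\<^sup>2)"
definition "p div q = p * inverse q" for p q :: quat

instance
proof
  fix p q :: quat
  show "p \<noteq> 0 \<Longrightarrow> inverse p * p = 1" "p \<noteq> 0 \<Longrightarrow> p * inverse p = 1"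
    using quat_sum_squares_eq_0_iff[of p]
    by (simp_all add: inverse_quat_def quat_mult_cnj of_real_def)
  show "p div q = p * inverse q"
    by (fact divide_quat_def)
  show "inverse 0 = (0 :: quat)"
    by (simp add: inverse_quat_def quat_eq_iff)
qed

end

instantiation quat :: real_inner
begin

definition "inner p q = q_re p * q_re q + q_i p * q_i q + q_j p * q_j q + q_k p * q_k q"
definition "norm p = sqrt ((q_re p)\<^sup>2 + (q_i p)\<^sup>2 + (q_j p)\<^sup>2 + (q_k p)\<^sup>2)"
definition "sgn p = p /\<^sub>R norm p" for p :: quat
definition "dist p q = norm (p - q)" for p q :: quat
definition [code del]:
  "(uniformity :: (quat \<times> quat) filter) = (INF e\<in>{0 <..}. principal {(p, q). dist p q < e})"
definition [code del]:
  "open (U :: quat set) \<longleftrightarrow> (\<forall>p\<in>U. eventually (\<lambda>(p', q). p' = p \<longrightarrow> q \<in> U) uniformity)"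

instance
proof
  fix p q s :: quat and r :: real and U :: "quat set"
  show "inner p q = inner q p"
    by (simp add: inner_quat_def mult.commute)
  show "inner (p + q) s = inner p s + inner q s"
    by (simp add: inner_quat_def algebra_simps)
  show "inner (r *\<^sub>R p) q = r * inner p q"
    by (simp add: inner_quat_def algebra_simps)
  show "0 \<le> inner p p"
    by (simp add: inner_quat_def)
  show "inner p p = 0 \<longleftrightarrow> p = 0"
    using quat_sum_squares_eq_0_iff[of p] by (simp add: inner_quat_def power2_eq_square)
  show "norm p = sqrt (inner p p)"
    by (simp add: inner_quat_def norm_quat_def power2_eq_square)
qed (rule sgn_quat_def dist_quat_def uniformity_quat_def open_quat_def)+

end

instance quat :: real_normed_div_algebra
proof
  fix p q :: quat
  have "(q_re (p * q))\<^sup>2 + (q_i (p * q))\<^sup>2 + (q_j (p * q))\<^sup>2 + (q_k (p * q))\<^sup>2 =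
      ((q_re p)\<^sup>2 + (q_i p)\<^sup>2 + (q_j p)\<^sup>2 + (q_k p)\<^sup>2) *
      ((q_re q)\<^sup>2 + (q_i q)\<^sup>2 + (q_j q)\<^sup>2 + (q_k q)\<^sup>2)"
    unfolding quat_mult_sel by algebra
  then show "norm (p * q) = norm p * norm q"
    by (simp only: norm_quat_def real_sqrt_mult)
qed

instantiation quat :: euclidean_space
begin

definition "Basis = {Quat 1 0 0 0, Quat 0 1 0 0, Quat 0 0 1 0, Quat 0 0 0 1}"

instance
proof
  fix p u v :: quat
  show "(Basis :: quat set) \<noteq> {}" "finite (Basis :: quat set)"
    by (simp_all add: Basis_quat_def)
  show "u \<in> Basis \<Longrightarrow> v \<in> Basis \<Longrightarrow> inner u v = (if u = v then 1 else 0)"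
    unfolding Basis_quat_def inner_quat_def by (elim insertE emptyE; simp)
  show "(\<forall>u\<in>Basis. inner p u = 0) \<longleftrightarrow> p = 0"
    by (cases p) (simp add: Basis_quat_def inner_quat_def zero_quat_def)
qed

end

definition q_im :: "quat \<Rightarrow> quat" where
  "q_im q = q - of_real (q_re q)"

definition imag_units :: "quat set" where
  "imag_units = {J. J\<^sup>2 = - 1}"

text \<open>The set \<open>x + y\<S>\<close>; for \<open>y = 0\<close> it is a single real point.\<close>

definition qsphere :: "real \<Rightarrow> real \<Rightarrow> quat set" where
  "qsphere x y = {of_real x + of_real y * J | J. J \<in> imag_units}"

definition slice :: "quat \<Rightarrow> quat set" where
  "slice I = {of_real x + of_real y * I | x y. True}"


section \<open>Slice regular functions\<close>

definition slice_domain :: "quat set \<Rightarrow> bool" where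
  "slice_domain \<Omega> \<longleftrightarrow>
     open \<Omega> \<and> connected \<Omega> \<and> \<Omega> \<noteq> {} \<and> \<Omega> \<inter> \<real> \<noteq> {} \<and>
     (\<forall>I\<in>imag_units. \<Omega> \<inter> slice I \<noteq> {} \<and> connected (\<Omega> \<inter> slice I) \<and>
        openin (top_of_set (slice I)) (\<Omega> \<inter> slice I))"

text \<open>
  A function on \<open>\<Omega>\<close> is a total function of which only the values on \<open>\<Omega>\<close> matter.
  For open \<open>\<Omega>\<close> the partial derivatives below depend only on these values.
\<close>

definition slice_dx :: "(quat \<Rightarrow> quat) \<Rightarrow> quat \<Rightarrow> real \<Rightarrow> real \<Rightarrow> quat" where
  "slice_dx f I x y = vector_derivative (\<lambda>t. f (of_real t + of_real y * I)) (at x)"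

definition slice_dy :: "(quat \<Rightarrow> quat) \<Rightarrow> quat \<Rightarrow> real \<Rightarrow> real \<Rightarrow> quat" where
  "slice_dy f I x y = vector_derivative (\<lambda>t. f (of_real x + of_real t * I)) (at y)"

definition slice_regular_on :: "quat set \<Rightarrow> (quat \<Rightarrow> quat) \<Rightarrow> bool" where
  "slice_regular_on \<Omega> f \<longleftrightarrow>
     (\<forall>I\<in>imag_units.
        (\<forall>x y. of_real x + of_real y * I \<in> \<Omega> \<longrightarrow>
           (\<lambda>t. f (of_real t + of_real y * I)) differentiable (at x) \<and>
           (\<lambda>t. f (of_real x + of_real t * I)) differentiable (at y) \<and>
           (1/2) *\<^sub>R (slice_dx f I x y + I * slice_dy f I x y) = 0) \<and>
        continuous_on {(x, y). of_real x + of_real y * I \<in> \<Omega>} (\<lambda>(x, y). slice_dx f I x y) \<and>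
        continuous_on {(x, y). of_real x + of_real y * I \<in> \<Omega>} (\<lambda>(x, y). slice_dy f I x y))"

text \<open>
  The value at \<open>q\<close> is the same for all representations \<open>q = x + yI\<close>: if \<open>q\<close> is not real these are
  \<open>x + yI\<close> and \<open>x + (-y)(-I)\<close>; if \<open>q\<close> is real, every \<open>I\<close> gives \<open>\<partial>f/\<partial>x\<close> when \<open>f\<close> is slice regular.
\<close>

definition cullen_derivative :: "(quat \<Rightarrow> quat) \<Rightarrow> quat \<Rightarrow> quat" where
  "cullen_derivative f q =
     (THE d. \<forall>I\<in>imag_units. \<forall>x y. q = of_real x + of_real y * I \<longrightarrow>
        d = (1/2) *\<^sub>R (slice_dx f I x y - I * slice_dy f I x y))"


section \<open>Spherical value, spherical derivative and the induced operations\<close>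

text \<open>For non-real \<open>p\<close>: with \<open>x\<^sub>0 = Re p\<close> and \<open>y\<^sub>0 = |Im p|\<close>, the relation \<open>f(x\<^sub>0 + y\<^sub>0J) = b + Jc\<close>
  holds near \<open>p\<close> in \<open>x\<^sub>0 + y\<^sub>0\<S>\<close>.\<close>

definition spherical_rep :: "quat set \<Rightarrow> (quat \<Rightarrow> quat) \<Rightarrow> quat \<Rightarrow> quat \<Rightarrow> quat \<Rightarrow> bool" where
  "spherical_rep \<Omega> f p b c \<longleftrightarrow>
     (\<exists>U. openin (top_of_set (qsphere (q_re p) (norm (q_im p)))) U \<and> p \<in> U \<and> U \<subseteq> \<Omega> \<and>
        (\<forall>J\<in>imag_units. of_real (q_re p) + of_real (norm (q_im p)) * J \<in> U \<longrightarrow>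
           f (of_real (q_re p) + of_real (norm (q_im p)) * J) = b + J * c))"

definition spherical_value :: "quat set \<Rightarrow> (quat \<Rightarrow> quat) \<Rightarrow> quat \<Rightarrow> quat" where
  "spherical_value \<Omega> f p =
     (if p \<in> \<real> then f p else (THE b. \<exists>c. spherical_rep \<Omega> f p b c))"

text \<open>Meaningful only at non-real points.\<close>

definition spherical_derivative :: "quat set \<Rightarrow> (quat \<Rightarrow> quat) \<Rightarrow> quat \<Rightarrow> quat" where
  "spherical_derivative \<Omega> f p = (THE c. \<exists>b. spherical_rep \<Omega> f p b c) /\<^sub>R norm (q_im p)"

definition star :: "quat set \<Rightarrow> (quat \<Rightarrow> quat) \<Rightarrow> (quat \<Rightarrow> quat) \<Rightarrow> quat \<Rightarrow> quat" where
  "star \<Omega> f g q =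
     (if q \<in> \<real> then f q * g q
      else spherical_value \<Omega> f q * spherical_value \<Omega> g q
         + (q_im q)\<^sup>2 * spherical_derivative \<Omega> f q * spherical_derivative \<Omega> g q
         + q_im q * (spherical_value \<Omega> f q * spherical_derivative \<Omega> g q
                   + spherical_derivative \<Omega> f q * spherical_value \<Omega> g q))"

definition normal_fun :: "quat set \<Rightarrow> (quat \<Rightarrow> quat) \<Rightarrow> quat \<Rightarrow> quat" where
  "normal_fun \<Omega> f q =
     (if q \<in> \<real> then of_real ((norm (f q))\<^sup>2)
      else of_real ((norm (spherical_value \<Omega> f q))\<^sup>2
                  - (norm (q_im q * spherical_derivative \<Omega> f q))\<^sup>2)
         + 2 * q_im q * of_real (q_re (spherical_value \<Omega> f q * q_cnj (spherical_derivative \<Omega> f q))))"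

fun linear_star_power :: "quat \<Rightarrow> nat \<Rightarrow> quat \<Rightarrow> quat" where
  "linear_star_power p 0 = (\<lambda>q. 1)"
| "linear_star_power p (Suc k) = star UNIV (\<lambda>q. q - p) (linear_star_power p k)"


section \<open>Divisibility and multiplicities\<close>

definition divides_near ::
  "quat set \<Rightarrow> quat set \<Rightarrow> (quat \<Rightarrow> quat) \<Rightarrow> (quat \<Rightarrow> quat) \<Rightarrow> bool" where
  "divides_near \<Omega> C P f \<longleftrightarrow>
     (\<exists>\<Lambda> g. slice_domain \<Lambda> \<and> C \<subseteq> \<Lambda> \<and> \<Lambda> \<subseteq> \<Omega> \<and> slice_regular_on \<Lambda> g \<and>
        (\<forall>q\<in>\<Lambda>. f q = star \<Lambda> P g q))"

definition classical_multiplicity ::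
  "quat set \<Rightarrow> (quat \<Rightarrow> quat) \<Rightarrow> quat set \<Rightarrow> quat \<Rightarrow> nat" where
  "classical_multiplicity \<Omega> h C p =
     (THE k. divides_near \<Omega> C (linear_star_power p k) h \<and>
           \<not> divides_near \<Omega> C (linear_star_power p (Suc k)) h)"

text \<open>
  The polynomial \<open>[(q - x)\<^sup>2 + y\<^sup>2]\<^sup>m\<close> has real coefficients, so its \<open>*\<close>-powers are the pointwise powers
  and its \<open>*\<close>-product with any function is the pointwise product.
\<close>

definition sphere_poly_power :: "real \<Rightarrow> real \<Rightarrow> nat \<Rightarrow> quat \<Rightarrow> quat" where
  "sphere_poly_power x y m q = ((q - of_real x)\<^sup>2 + (of_real y)\<^sup>2) ^ m"

text \<open>
  The list \<open>ps = [p\<^sub>1, \<dots>, p\<^sub>n]\<close> carries the points of the factorization; \<open>foldr\<close> produces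
  \<open>(q - p\<^sub>1) * (\<dots> * ((q - p\<^sub>n) * g))\<close>.
\<close>

definition sphere_factorization ::
  "quat set \<Rightarrow> (quat \<Rightarrow> quat) \<Rightarrow> real \<Rightarrow> real \<Rightarrow> quat set \<Rightarrow> nat \<Rightarrow> quat list \<Rightarrow> bool" where
  "sphere_factorization \<Omega> h x y C m ps \<longleftrightarrow>
     set ps \<subseteq> qsphere x y \<and>
     (\<forall>i. Suc i < length ps \<longrightarrow> ps ! i \<noteq> q_cnj (ps ! Suc i)) \<and>
     divides_near \<Omega> C (sphere_poly_power x y m) h \<and>
     \<not> divides_near \<Omega> C (sphere_poly_power x y (Suc m)) h \<and>
     (\<exists>\<Lambda> g. slice_domain \<Lambda> \<and> C \<subseteq> \<Lambda> \<and> \<Lambda> \<subseteq> \<Omega> \<and> slice_regular_on \<Lambda> g \<and>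
        (\<exists>q\<in>C. normal_fun \<Lambda> g q \<noteq> 0) \<and>
        (\<forall>q\<in>\<Lambda>. h q =
           sphere_poly_power x y m q * foldr (\<lambda>a F. star \<Lambda> (\<lambda>q. q - a) F) ps g q))"

definition spherical_multiplicity ::
  "quat set \<Rightarrow> (quat \<Rightarrow> quat) \<Rightarrow> real \<Rightarrow> real \<Rightarrow> quat set \<Rightarrow> nat" where
  "spherical_multiplicity \<Omega> h x y C =
     2 * (THE m. \<exists>ps. sphere_factorization \<Omega> h x y C m ps)"

definition isolated_multiplicity ::
  "quat set \<Rightarrow> (quat \<Rightarrow> quat) \<Rightarrow> real \<Rightarrow> real \<Rightarrow> quat set \<Rightarrow> quat \<Rightarrow> nat" where
  "isolated_multiplicity \<Omega> h x y C p =
     (let ps = (THE ps. \<exists>m. sphere_factorization \<Omega> h x y C m ps)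
      in if ps \<noteq> [] \<and> hd ps = p then length ps else 0)"

end

theory Submission
  imports Defs "HOL-Complex_Analysis.Complex_Analysis"
begin

text \<open>Near a point \<open>x + yI\<close> a slice regular function is \<open>f(x + yJ) = b(x + \<i>y) + J c(x + \<i>y)\<close> for all
  units \<open>J\<close> near \<open>I\<close>, where the stem \<open>b + \<i>c\<close> is holomorphic with values in \<open>\<H> \<otimes> \<C>\<close>. Under
  \<open>f \<mapsto> b + \<i>c\<close> the star product becomes the product of \<open>\<H> \<otimes> \<C>\<close>, the normal function the
  multiplicative norm form of \<open>\<H> \<otimes> \<C>\<close>, and divisibility near the component \<open>C\<close> becomes divisibility of
  germs at one point of \<open>C\<close>; the multiplicities are then bounded by the order of the norm of the stem.

  With \<open>b + \<i>c\<close> the value at \<open>p\<close> of the stem of the quotient of \<open>f - f(p)\<close> by \<open>q - p\<close>, one has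
  \<open>f'\<^sub>c(p) = b + Ic\<close> and \<open>f'\<^sub>s(p) = b - Ic\<close>. The differential at \<open>p\<close> is \<open>v\<^sub>1 + v\<^sub>2 \<mapsto> v\<^sub>1 f'\<^sub>c(p) + v\<^sub>2 f'\<^sub>s(p)\<close>
  for \<open>v\<^sub>1 \<in> \<real> + I\<real>\<close> and \<open>v\<^sub>2\<close> orthogonal to it. Hence it is singular iff \<open>f'\<^sub>s(p) = 0\<close> or
  \<open>|b|\<^sup>2 - |c|\<^sup>2 + 2\<i>\<langle>b, c\<rangle> = 0\<close>, the latter being the condition for a second linear factor.\<close>

section \<open>Imaginary units and slices\<close>

text \<open>The obstacle is that \<Omega> need not be symmetric under a change of the unit:
  \<open>x + yJ\<close> may leave \<Omega>, and different components of one sphere in \<Omega> may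
  carry different stems. So a stem exists only locally in \<open>J\<close>; it is obtained by
  following a path inside one slice to the real axis, where all slices agree. For the same reason
  the other components of the sphere are removed from \<Omega>: what is left is a slice domain on
  which a division has to be justified along \<open>C\<close> only. The complexified quaternions
  have zero divisors, and these account for the isolated zeros. A nonzero element of norm zero is
  annihilated by evaluation at exactly one unit \<open>K\<close>, and this \<open>K\<close> is the
  direction of the first linear factor. Multiplication by the conjugate factor replaces a linear
  factor by the central polynomial \<open>quad\<close>, so that every cancellation is one of a
  scalar holomorphic factor. A linear factor has norm \<open>quad\<close> and a spherical one the
  square of \<open>quad\<close>; since the norm of the stem of \<open>h\<close> is not identically
  zero, both kinds are bounded in number.\<close>

abbreviation imag_sphere :: "quat set" ("\<S>") where
  "\<S> \<equiv> imag_units"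

lemma imag_units_iff:
  "J \<in> \<S> \<longleftrightarrow> q_re J = 0 \<and> (q_i J)\<^sup>2 + (q_j J)\<^sup>2 + (q_k J)\<^sup>2 = 1"
proof -
  have sq: "J\<^sup>2 = - 1 \<longleftrightarrow> q_re J * q_re J - q_i J * q_i J - q_j J * q_j J - q_k J * q_k J = - 1
      \<and> q_re J * q_i J = 0 \<and> q_re J * q_j J = 0 \<and> q_re J * q_k J = 0"
    by (simp add: power2_eq_square quat_eq_iff algebra_simps)
  show ?thesis
  proof (cases "q_re J = 0")
    case True
    then show ?thesis
      unfolding imag_units_def mem_Collect_eq sq unfolding power2_eq_square by simp argo
  next
    case False
    have "\<not> q_re J * q_re J = - 1"
      using zero_le_square[of "q_re J"] by linarith
    with False show ?thesis
      unfolding imag_units_def mem_Collect_eq sq by auto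
  qed
qed

lemma imag_units_mult_self: "J \<in> \<S> \<Longrightarrow> J * J = - 1"
  by (simp add: imag_units_def power2_eq_square)

lemma imag_units_mult_left: "J \<in> \<S> \<Longrightarrow> J * (J * X) = - X"
  by (simp add: imag_units_mult_self mult.assoc[symmetric])

lemma imag_units_uminus: "J \<in> \<S> \<Longrightarrow> - J \<in> \<S>"
  by (simp add: imag_units_def)

lemma norm_quat_square: "(norm q)\<^sup>2 = (q_re q)\<^sup>2 + (q_i q)\<^sup>2 + (q_j q)\<^sup>2 + (q_k q)\<^sup>2"
  by (simp add: norm_quat_def)

lemma inner_quat_mult_right: "(a * s) \<bullet> (b * s) = (norm s)\<^sup>2 * (a \<bullet> b)" for a b s :: quat
  unfolding norm_quat_square by (simp add: inner_quat_def) algebra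

lemma inner_quat_mult_left: "(s * a) \<bullet> (s * b) = (norm s)\<^sup>2 * (a \<bullet> b)" for a b s :: quat
  unfolding norm_quat_square by (simp add: inner_quat_def) algebra

lemma norm_imag_units: "J \<in> \<S> \<Longrightarrow> norm J = 1"
  by (simp add: imag_units_iff norm_quat_def)

lemma imag_units_nonzero: "J \<in> \<S> \<Longrightarrow> J \<noteq> 0"
  using norm_imag_units by fastforce

lemma quat_in_Reals_iff: "q \<in> \<real> \<longleftrightarrow> q_i q = 0 \<and> q_j q = 0 \<and> q_k q = 0"
proof
  assume "q_i q = 0 \<and> q_j q = 0 \<and> q_k q = 0"
  then have "q = of_real (q_re q)" by (simp add: quat_eq_iff)
  then show "q \<in> \<real>" by (metis Reals_of_real)
qed (auto elim: Reals_cases)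

lemma bounded_linear_quat_sel:
  "bounded_linear q_re" "bounded_linear q_i" "bounded_linear q_j" "bounded_linear q_k"
  by (auto intro!: linearI simp: linear_conv_bounded_linear[symmetric])

lemmas quat_sel_has_derivative [derivative_intros] =
  bounded_linear_quat_sel[THEN bounded_linear.has_derivative]

lemmas quat_sel_continuous [continuous_intros] =
  bounded_linear_quat_sel[THEN bounded_linear.continuous_on]

lemma Quat_eq_scaleR:
  "Quat a b c d = a *\<^sub>R Quat 1 0 0 0 + b *\<^sub>R Quat 0 1 0 0 + c *\<^sub>R Quat 0 0 1 0 + d *\<^sub>R Quat 0 0 0 1"
  by (simp add: quat_eq_iff)

text \<open>For a unit \<open>J\<close> this identifies the complex plane with
  \<open>slice J\<close> as algebras. It is defined for every quaternion \<open>J\<close>, so that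
  it is jointly continuous in \<open>J\<close> and \<open>z\<close> on the whole space.\<close>

definition slice_pt :: "quat \<Rightarrow> complex \<Rightarrow> quat" where
  "slice_pt J z = of_real (Re z) + of_real (Im z) * J"

lemma slice_pt_Complex: "slice_pt J (Complex x y) = of_real x + of_real y * J"
  by (simp add: slice_pt_def)

lemma slice_pt_sel [simp]:
  "q_re (slice_pt J z) = Re z + Im z * q_re J" "q_i (slice_pt J z) = Im z * q_i J"
  "q_j (slice_pt J z) = Im z * q_j J" "q_k (slice_pt J z) = Im z * q_k J"
  by (simp_all add: slice_pt_def)

lemma slice_pt_of_real [simp]: "slice_pt J (of_real x) = of_real x"
  by (simp add: slice_pt_def)

lemma slice_pt_uminus_cnj: "slice_pt (- J) (cnj z) = slice_pt J z"
  by (simp add: slice_pt_def)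

lemma slice_pt_add: "slice_pt J (z + w) = slice_pt J z + slice_pt J w"
  by (simp add: slice_pt_def algebra_simps)

lemma slice_pt_diff: "slice_pt J (z - w) = slice_pt J z - slice_pt J w"
  by (simp add: slice_pt_def algebra_simps)

lemma slice_pt_mult:
  assumes "J \<in> \<S>" shows "slice_pt J (z * w) = slice_pt J z * slice_pt J w"
proof -
  have J: "q_re J = 0" "(q_i J)\<^sup>2 + (q_j J)\<^sup>2 + (q_k J)\<^sup>2 = 1"
    using assms by (simp_all add: imag_units_iff)
  have "Im z * Im w = Im z * Im w * ((q_i J)\<^sup>2 + (q_j J)\<^sup>2 + (q_k J)\<^sup>2)"
    by (simp add: J)
  then show ?thesis
    by (simp add: quat_eq_iff J(1) algebra_simps power2_eq_square)
qed

lemma norm_slice_pt: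
  assumes "J \<in> \<S>" shows "norm (slice_pt J z) = cmod z"
proof -
  have "q_re J = 0" "(q_i J)\<^sup>2 + (q_j J)\<^sup>2 + (q_k J)\<^sup>2 = 1"
    using assms by (simp_all add: imag_units_iff)
  then have "(Re z)\<^sup>2 + (Im z * q_i J)\<^sup>2 + (Im z * q_j J)\<^sup>2 + (Im z * q_k J)\<^sup>2 = (Re z)\<^sup>2 + (Im z)\<^sup>2"
    by algebra
  with \<open>q_re J = 0\<close> show ?thesis
    by (simp add: norm_quat_def cmod_def)
qed

lemma slice_pt_eq_0_iff: "J \<in> \<S> \<Longrightarrow> slice_pt J z = 0 \<longleftrightarrow> z = 0"
  by (metis norm_eq_zero norm_slice_pt)

lemma slice_pt_in_Reals_iff:
  "J \<in> \<S> \<Longrightarrow> slice_pt J z \<in> \<real> \<longleftrightarrow> Im z = 0"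
  by (auto simp: quat_in_Reals_iff imag_units_iff)

lemma continuous_on_slice_pt [continuous_intros]:
  assumes "continuous_on S f" "continuous_on S g"
  shows "continuous_on S (\<lambda>x. slice_pt (f x) (g x))"
  unfolding slice_pt_def by (intro continuous_intros assms)

lemma slice_pt_normalize:
  assumes "q_im q \<noteq> 0"
  shows "q_im q /\<^sub>R norm (q_im q) \<in> \<S>"
    "q = slice_pt (q_im q /\<^sub>R norm (q_im q)) (Complex (q_re q) (norm (q_im q)))"
proof -
  define u where "u = q_im q /\<^sub>R norm (q_im q)"
  have "norm u = 1" "q_re u = 0" using assms by (simp_all add: u_def q_im_def)
  then show "q_im q /\<^sub>R norm (q_im q) \<in> \<S>"
    unfolding u_def[symmetric] using norm_quat_square[of u] by (simp add: imag_units_iff)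
  show "q = slice_pt (q_im q /\<^sub>R norm (q_im q)) (Complex (q_re q) (norm (q_im q)))"
    using assms by (simp add: slice_pt_def of_real_def) (simp add: q_im_def of_real_def)
qed

lemma slice_pt_cover:
  obtains J z where "J \<in> \<S>" "Im z \<ge> 0" "q = slice_pt J z"
proof (cases "q_im q = 0")
  case True
  then have "q = slice_pt (Quat 0 1 0 0) (of_real (q_re q))" by (simp add: q_im_def)
  then show ?thesis using that[of "Quat 0 1 0 0" "of_real (q_re q)"] by (simp add: imag_units_iff)
next
  case False
  then show ?thesis using slice_pt_normalize that by (metis complex.sel(2) norm_ge_zero)
qed

lemma slice_pt_q_im:
  "J \<in> \<S> \<Longrightarrow> q_im (slice_pt J z) = of_real (Im z) * J"
  by (simp add: q_im_def quat_eq_iff imag_units_iff)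

lemma slice_pt_norm_q_im:
  "J \<in> \<S> \<Longrightarrow> norm (q_im (slice_pt J z)) = \<bar>Im z\<bar>"
  by (simp add: slice_pt_q_im norm_mult norm_imag_units)

lemma slice_pt_q_re: "J \<in> \<S> \<Longrightarrow> q_re (slice_pt J z) = Re z"
  by (simp add: imag_units_iff)

lemma imag_units_not_central:
  assumes "I \<in> \<S>" obtains v where "v * I \<noteq> I * v"
proof -
  have "Quat 0 1 0 0 * I \<noteq> I * Quat 0 1 0 0 \<or> Quat 0 0 1 0 * I \<noteq> I * Quat 0 0 1 0"
    using assms by (auto simp: quat_eq_iff imag_units_iff)
  then show ?thesis using that by blast
qed

lemma slice_pt_near_mem:
  assumes "open \<Omega>" "slice_pt I z \<in> \<Omega>"
  obtains d where "d > 0" "\<And>J. dist J I < d \<Longrightarrow> slice_pt J z \<in> \<Omega>"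
proof -
  have "continuous_on UNIV (\<lambda>J. slice_pt J z)" by (intro continuous_intros)
  then have "open ((\<lambda>J. slice_pt J z) -` \<Omega>)"
    using assms(1) by (simp add: continuous_on_open_vimage)
  then obtain d where "d > 0" "ball I d \<subseteq> (\<lambda>J. slice_pt J z) -` \<Omega>"
    using assms(2) by (metis open_contains_ball vimage_eq)
  then show ?thesis by (intro that[of d]) (auto simp: subset_iff dist_commute)
qed

text \<open>A unit that does not commute with \<open>v\<close> is moved by conjugation with \<open>1 + tv\<close>, which tends to
  the identity as \<open>t\<close> tends to \<open>0\<close>.\<close>

lemma imag_units_not_isolated:
  assumes "I \<in> \<S>" "e > 0"
  obtains J where "J \<in> \<S>" "dist J I < e" "J \<noteq> I"
proof -
  obtain v where v: "v * I \<noteq> I * v" using imag_units_not_central[OF assms(1)] by blast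
  define F where "F t = (1 + t *\<^sub>R v) * I * inverse (1 + t *\<^sub>R v)" for t :: real
  have "((\<lambda>t. F t) \<longlongrightarrow> (1 + 0 *\<^sub>R v) * I * inverse (1 + 0 *\<^sub>R v)) (at_right 0)"
    unfolding F_def by (intro tendsto_intros) auto
  then have "(F \<longlongrightarrow> I) (at_right 0)" by simp
  then have "\<forall>\<^sub>F t in at_right 0. dist (F t) I < e"
    using \<open>e > 0\<close> by (rule tendstoD)
  moreover have "((\<lambda>t. 1 + t *\<^sub>R v) \<longlongrightarrow> 1 + 0 *\<^sub>R v) (at_right 0)"
    by (intro tendsto_intros)
  then have "\<forall>\<^sub>F t in at_right 0. 1 + t *\<^sub>R v \<noteq> 0"
    by (rule tendsto_imp_eventually_ne) simp
  moreover have "\<forall>\<^sub>F t :: real in at_right 0. t > 0"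
    by (simp add: eventually_at_right_less)
  ultimately have "\<forall>\<^sub>F t in at_right 0. dist (F t) I < e \<and> 1 + t *\<^sub>R v \<noteq> 0 \<and> t > 0"
    by eventually_elim auto
  then obtain t where t: "dist (F t) I < e" "1 + t *\<^sub>R v \<noteq> 0" "t > 0"
    using eventually_happens[of _ "at_right (0 :: real)"] by (auto simp: trivial_limit_at_right_real)
  define u where "u = 1 + t *\<^sub>R v"
  have u: "u \<noteq> 0" "inverse u * u = 1" "u * inverse u = 1" using t(2) by (simp_all add: u_def)
  have "F t * F t = u * I * (inverse u * u) * I * inverse u"
    by (simp add: F_def u_def mult.assoc)
  also have "\<dots> = u * (I * I) * inverse u" by (simp add: u mult.assoc)
  also have "\<dots> = - 1" by (simp add: imag_units_mult_self[OF assms(1)] u)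
  finally have "F t \<in> \<S>" by (simp add: imag_units_def power2_eq_square)
  moreover have "F t \<noteq> I"
  proof
    assume "F t = I"
    then have "F t * u = I * u" by simp
    then have "u * I = I * u" by (simp add: F_def u_def[symmetric] mult.assoc u)
    then have "t *\<^sub>R (v * I) = t *\<^sub>R (I * v)" by (simp add: u_def algebra_simps)
    then show False using v t(3) by simp
  qed
  ultimately show ?thesis using t(1) that by blast
qed

section \<open>The complexified quaternions\<close>

text \<open>The algebra of 2 by 2 complex matrices, written in the basis 1, i, j, k. Its central
  imaginary unit is \<open>cq_cplx \<i>\<close>, to be distinguished from the quaternion i.\<close>

datatype cquat = CQuat (cq_re: complex) (cq_i: complex) (cq_j: complex) (cq_k: complex)

lemma cquat_eq_iff:
  "A = B \<longleftrightarrow> cq_re A = cq_re B \<and> cq_i A = cq_i B \<and> cq_j A = cq_j B \<and> cq_k A = cq_k B"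
  by (cases A; cases B) simp

instantiation cquat :: ring_1
begin

definition "0 = CQuat 0 0 0 0"
definition "1 = CQuat 1 0 0 0"
definition "A + B = CQuat (cq_re A + cq_re B) (cq_i A + cq_i B) (cq_j A + cq_j B) (cq_k A + cq_k B)"
definition "- A = CQuat (- cq_re A) (- cq_i A) (- cq_j A) (- cq_k A)" for A :: cquat
definition "A - B = CQuat (cq_re A - cq_re B) (cq_i A - cq_i B) (cq_j A - cq_j B) (cq_k A - cq_k B)"
definition "A * B = CQuat
  (cq_re A * cq_re B - cq_i A * cq_i B - cq_j A * cq_j B - cq_k A * cq_k B)
  (cq_re A * cq_i B + cq_i A * cq_re B + cq_j A * cq_k B - cq_k A * cq_j B)
  (cq_re A * cq_j B - cq_i A * cq_k B + cq_j A * cq_re B + cq_k A * cq_i B)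
  (cq_re A * cq_k B + cq_i A * cq_j B - cq_j A * cq_i B + cq_k A * cq_re B)"

instance
  by standard (simp_all add: cquat_eq_iff zero_cquat_def one_cquat_def plus_cquat_def
      uminus_cquat_def minus_cquat_def times_cquat_def algebra_simps)

end

lemma cquat_sel [simp]:
  "cq_re 0 = 0" "cq_i 0 = 0" "cq_j 0 = 0" "cq_k 0 = 0"
  "cq_re 1 = 1" "cq_i 1 = 0" "cq_j 1 = 0" "cq_k 1 = 0"
  "cq_re (A + B) = cq_re A + cq_re B" "cq_i (A + B) = cq_i A + cq_i B"
  "cq_j (A + B) = cq_j A + cq_j B" "cq_k (A + B) = cq_k A + cq_k B"
  "cq_re (- A) = - cq_re A" "cq_i (- A) = - cq_i A" "cq_j (- A) = - cq_j A" "cq_k (- A) = - cq_k A"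
  "cq_re (A - B) = cq_re A - cq_re B" "cq_i (A - B) = cq_i A - cq_i B"
  "cq_j (A - B) = cq_j A - cq_j B" "cq_k (A - B) = cq_k A - cq_k B"
  "cq_re (A * B) = cq_re A * cq_re B - cq_i A * cq_i B - cq_j A * cq_j B - cq_k A * cq_k B"
  "cq_i (A * B) = cq_re A * cq_i B + cq_i A * cq_re B + cq_j A * cq_k B - cq_k A * cq_j B"
  "cq_j (A * B) = cq_re A * cq_j B - cq_i A * cq_k B + cq_j A * cq_re B + cq_k A * cq_i B"
  "cq_k (A * B) = cq_re A * cq_k B + cq_i A * cq_j B - cq_j A * cq_i B + cq_k A * cq_re B"
  by (simp_all add: zero_cquat_def one_cquat_def plus_cquat_def uminus_cquat_def minus_cquat_def
      times_cquat_def)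

definition cq_cplx :: "complex \<Rightarrow> cquat" where
  "cq_cplx z = CQuat z 0 0 0"

definition cq_quat :: "quat \<Rightarrow> cquat" where
  "cq_quat q = CQuat (of_real (q_re q)) (of_real (q_i q)) (of_real (q_j q)) (of_real (q_k q))"

definition cq_Re :: "cquat \<Rightarrow> quat" where
  "cq_Re A = Quat (Re (cq_re A)) (Re (cq_i A)) (Re (cq_j A)) (Re (cq_k A))"

definition cq_Im :: "cquat \<Rightarrow> quat" where
  "cq_Im A = Quat (Im (cq_re A)) (Im (cq_i A)) (Im (cq_j A)) (Im (cq_k A))"

text \<open>Replaces the central imaginary unit by left multiplication with \<open>J\<close>. For a
  unit \<open>J\<close> this turns complex scalars on the left into points of
  \<open>slice J\<close>, but it does not respect products of arbitrary elements.\<close>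

definition cq_eval :: "quat \<Rightarrow> cquat \<Rightarrow> quat" where
  "cq_eval J A = cq_Re A + J * cq_Im A"

text \<open>The determinant, when elements are read as 2 by 2 complex matrices; hence it is
  multiplicative and vanishes exactly at the non-invertible elements.\<close>

definition cq_nrm :: "cquat \<Rightarrow> complex" where
  "cq_nrm A = (cq_re A)\<^sup>2 + (cq_i A)\<^sup>2 + (cq_j A)\<^sup>2 + (cq_k A)\<^sup>2"

lemma cq_cplx_sel [simp]:
  "cq_re (cq_cplx z) = z" "cq_i (cq_cplx z) = 0" "cq_j (cq_cplx z) = 0" "cq_k (cq_cplx z) = 0"
  by (simp_all add: cq_cplx_def)

lemma cq_quat_sel [simp]:
  "cq_re (cq_quat q) = of_real (q_re q)" "cq_i (cq_quat q) = of_real (q_i q)"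
  "cq_j (cq_quat q) = of_real (q_j q)" "cq_k (cq_quat q) = of_real (q_k q)"
  by (simp_all add: cq_quat_def)

lemma cq_Re_Im_sel [simp]:
  "q_re (cq_Re A) = Re (cq_re A)" "q_i (cq_Re A) = Re (cq_i A)"
  "q_j (cq_Re A) = Re (cq_j A)" "q_k (cq_Re A) = Re (cq_k A)"
  "q_re (cq_Im A) = Im (cq_re A)" "q_i (cq_Im A) = Im (cq_i A)"
  "q_j (cq_Im A) = Im (cq_j A)" "q_k (cq_Im A) = Im (cq_k A)"
  by (simp_all add: cq_Re_def cq_Im_def)

lemma cquat_eq_iff_Re_Im: "A = B \<longleftrightarrow> cq_Re A = cq_Re B \<and> cq_Im A = cq_Im B"
  by (auto simp: cquat_eq_iff quat_eq_iff complex_eq_iff)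

lemma cq_Re_Im_quat [simp]: "cq_Re (cq_quat q) = q" "cq_Im (cq_quat q) = 0"
  by (simp_all add: quat_eq_iff)

lemma cq_Re_Im_arith [simp]:
  "cq_Re 0 = 0" "cq_Im 0 = 0" "cq_Re 1 = 1" "cq_Im 1 = 0"
  "cq_Re (A + B) = cq_Re A + cq_Re B" "cq_Im (A + B) = cq_Im A + cq_Im B"
  "cq_Re (A - B) = cq_Re A - cq_Re B" "cq_Im (A - B) = cq_Im A - cq_Im B"
  by (simp_all add: quat_eq_iff)

lemma cq_Re_Im_mult:
  "cq_Re (A * B) = cq_Re A * cq_Re B - cq_Im A * cq_Im B"
  "cq_Im (A * B) = cq_Re A * cq_Im B + cq_Im A * cq_Re B"
  by (simp_all add: quat_eq_iff algebra_simps)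

lemma cq_cplx_arith:
  "cq_cplx 0 = 0" "cq_cplx 1 = 1" "cq_cplx (z + w) = cq_cplx z + cq_cplx w"
  "cq_cplx (z - w) = cq_cplx z - cq_cplx w" "cq_cplx (z * w) = cq_cplx z * cq_cplx w"
  by (simp_all add: cquat_eq_iff)

lemma cq_quat_arith:
  "cq_quat 0 = 0" "cq_quat 1 = 1" "cq_quat (p + q) = cq_quat p + cq_quat q"
  "cq_quat (p - q) = cq_quat p - cq_quat q" "cq_quat (p * q) = cq_quat p * cq_quat q"
  by (simp_all add: cquat_eq_iff)

lemma cq_cplx_commute: "cq_cplx z * A = A * cq_cplx z"
  by (simp add: cquat_eq_iff)

lemma cq_cplx_left_commute: "A * (cq_cplx z * B) = cq_cplx z * (A * B)"
  by (metis cq_cplx_commute mult.assoc)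

lemma cq_cplx_mult_cancel: "z \<noteq> 0 \<Longrightarrow> cq_cplx z * A = cq_cplx z * B \<longleftrightarrow> A = B"
  by (auto simp: cquat_eq_iff)

lemma cq_nrm_mult: "cq_nrm (A * B) = cq_nrm A * cq_nrm B"
  unfolding cq_nrm_def cquat_sel by algebra

lemma cq_nrm_cplx: "cq_nrm (cq_cplx z) = z\<^sup>2"
  by (simp add: cq_nrm_def)

lemma cq_nrm_cplx_mult: "cq_nrm (cq_cplx z * A) = z\<^sup>2 * cq_nrm A"
  by (simp add: cq_nrm_mult cq_nrm_cplx)

lemma cq_nrm_eq_Complex:
  "cq_nrm A = Complex ((norm (cq_Re A))\<^sup>2 - (norm (cq_Im A))\<^sup>2) (2 * (cq_Re A \<bullet> cq_Im A))"
  unfolding norm_quat_square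
  by (simp add: complex_eq_iff cq_nrm_def inner_quat_def power2_eq_square)

lemma cq_nrm_quat_eq_0: "cq_nrm (cq_quat q) = 0 \<longleftrightarrow> q = 0"
  unfolding cq_nrm_eq_Complex by (simp add: complex_eq_iff)

lemma cq_eval_arith:
  "cq_eval J 0 = 0" "cq_eval J 1 = 1" "cq_eval J (A + B) = cq_eval J A + cq_eval J B"
  "cq_eval J (A - B) = cq_eval J A - cq_eval J B" "cq_eval J (cq_quat q) = q"
  by (simp_all add: cq_eval_def algebra_simps)

lemma cq_eval_cplx: "cq_eval J (cq_cplx z) = slice_pt J z"
  by (auto simp: cq_eval_def quat_eq_iff)

lemma cq_eval_cplx_mult:
  assumes "J \<in> \<S>" shows "cq_eval J (cq_cplx z * A) = slice_pt J z * cq_eval J A"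
proof -
  have "J * (J * X) = - X" for X
    by (rule imag_units_mult_left[OF assms])
  moreover have "cq_Re (cq_cplx z) = of_real (Re z)" "cq_Im (cq_cplx z) = of_real (Im z)"
    by (simp_all add: quat_eq_iff)
  ultimately show ?thesis
    by (simp add: cq_eval_def slice_pt_def cq_Re_Im_mult algebra_simps of_real_def)
qed

text \<open>The values of an element at \<open>J\<close> and \<open>K\<close> differ by
  \<open>J - K\<close> times its imaginary part, and \<open>J - K\<close> is invertible. In
  particular a nonzero element is annihilated by at most one evaluation.\<close>

lemma cq_eval_eq_imp_eq:
  assumes "cq_eval J A = cq_eval J B" "cq_eval K A = cq_eval K B" "J \<noteq> K"
  shows "A = B"
proof -
  have "(J - K) * (cq_Im A - cq_Im B)
      = (cq_eval J A - cq_eval J B) - (cq_eval K A - cq_eval K B)"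
    by (simp add: cq_eval_def algebra_simps)
  then have "(J - K) * (cq_Im A - cq_Im B) = 0"
    using assms(1,2) by simp
  with assms(3) have "cq_Im A = cq_Im B" by simp
  with assms(1) show ?thesis by (simp add: cquat_eq_iff_Re_Im cq_eval_def)
qed

text \<open>Left multiplication by the idempotent \<open>(1 - \<i>J)/2\<close> realizes \<open>\<H>\<close>, as a left vector space over
  \<open>\<real> + J\<real>\<close>, inside \<open>\<H> \<otimes> \<C>\<close>.\<close>

definition cq_lift :: "quat \<Rightarrow> quat \<Rightarrow> cquat" where
  "cq_lift J q = cq_quat ((1/2) *\<^sub>R q) - cq_cplx \<i> * cq_quat ((1/2) *\<^sub>R (J * q))"

lemma cq_eval_lift:
  assumes "J \<in> \<S>" shows "cq_eval J (cq_lift J q) = q"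
proof -
  have "J * (J * q) = - q"
    by (rule imag_units_mult_left[OF assms])
  moreover have "slice_pt J \<i> = J" by (simp add: slice_pt_def)
  ultimately show ?thesis
    by (simp add: cq_lift_def cq_eval_arith cq_eval_cplx_mult assms scaleR_half_double flip: scaleR_left_distrib)
qed

lemma cq_lift_diff: "cq_lift J (p - q) = cq_lift J p - cq_lift J q"
  by (auto simp: cq_lift_def cquat_eq_iff algebra_simps)

lemma cq_lift_eq_mult: "cq_lift J q = cq_lift J 1 * cq_quat q"
  by (auto simp: cq_lift_def cquat_eq_iff algebra_simps)

lemma cq_lift_slice_pt_mult:
  assumes "J \<in> \<S>"
  shows "cq_lift J (slice_pt J z * q) = cq_cplx z * cq_lift J q"
proof -
  have "J * slice_pt J z = slice_pt J (\<i> * z)"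
    by (simp add: slice_pt_mult assms) (simp add: slice_pt_def)
  then have *: "J * (slice_pt J z * q) = slice_pt J (\<i> * z) * q"
    by (simp add: mult.assoc[symmetric])
  show ?thesis
    unfolding cq_lift_def *
    using assms unfolding imag_units_iff by (auto simp: cquat_eq_iff complex_eq_iff algebra_simps)
qed

text \<open>Left multiplication by the idempotent \<open>cq_lift J 1\<close> forgets exactly what
  evaluation at \<open>J\<close> forgets, so identities between evaluations can be tested on
  holomorphic lifts.\<close>

lemma cq_lift_eval:
  assumes "J \<in> \<S>" shows "cq_lift J (cq_eval J A) = cq_lift J 1 * A"
proof -
  have A: "A = cq_quat (cq_Re A) + cq_cplx \<i> * cq_quat (cq_Im A)"
    by (simp add: cquat_eq_iff complex_eq_iff)
  have "cq_eval J A = cq_Re A + slice_pt J \<i> * cq_Im A"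
    by (simp add: cq_eval_def slice_pt_def)
  then have "cq_lift J (cq_eval J A) = cq_lift J (cq_Re A) + cq_cplx \<i> * cq_lift J (cq_Im A)"
    using cq_lift_slice_pt_mult[OF assms, of \<i> "cq_Im A"]
    by (simp add: cq_lift_def cquat_eq_iff algebra_simps)
  also have "\<dots> = cq_lift J 1 * A"
    by (subst A) (simp add: cq_lift_eq_mult[of J "cq_Re A"] cq_lift_eq_mult[of J "cq_Im A"]
      ring_distribs cq_cplx_left_commute)
  finally show ?thesis .
qed

lemma cq_lift_eq_0_iff:
  assumes "J \<in> \<S>" shows "cq_lift J q = 0 \<longleftrightarrow> q = 0"
proof
  assume "cq_lift J q = 0"
  then show "q = 0" using cq_eval_lift[OF assms, of q] by (simp add: cq_eval_arith)
qed (simp add: cq_lift_def cq_quat_arith)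

section \<open>Linear factors and zero divisors\<close>

definition cq_linear :: "quat \<Rightarrow> complex \<Rightarrow> cquat" where
  "cq_linear a z = cq_cplx z - cq_quat a"

text \<open>As \<open>z\<close> is central, \<open>cq_linear (q_cnj a) z\<close> is the conjugate of
  \<open>cq_linear a z\<close>. The product is a scalar; this is how a linear factor is traded for a
  central one.\<close>

lemma cq_linear_mult_cnj:
  "cq_linear a z * cq_linear (q_cnj a) z = cq_cplx (cq_nrm (cq_linear a z))"
  "cq_linear (q_cnj a) z * cq_linear a z = cq_cplx (cq_nrm (cq_linear a z))"
  by (simp_all add: cq_linear_def cq_nrm_def cquat_eq_iff power2_eq_square algebra_simps)

lemma cq_nrm_linear:
  assumes "K \<in> \<S>"
  shows "cq_nrm (cq_linear (slice_pt K w) z) = (z - of_real (Re w))\<^sup>2 + (of_real (Im w))\<^sup>2"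
proof -
  have K: "q_re K = 0" "(q_i K)\<^sup>2 + (q_j K)\<^sup>2 + (q_k K)\<^sup>2 = 1"
    using assms by (simp_all add: imag_units_iff)
  have "(complex_of_real (Im w * q_i K))\<^sup>2 + ((of_real (Im w * q_j K))\<^sup>2 + (of_real (Im w * q_k K))\<^sup>2)
      = of_real ((Im w)\<^sup>2 * ((q_i K)\<^sup>2 + (q_j K)\<^sup>2 + (q_k K)\<^sup>2))"
    by (simp add: power_mult_distrib distrib_left)
  also have "\<dots> = (of_real (Im w))\<^sup>2" by (simp only: K mult_1_right of_real_power)
  finally show ?thesis by (simp add: cq_linear_def cq_nrm_def K(1) add.assoc)
qed

text \<open>\<open>K\<close> commutes with \<open>slice_pt K w\<close>, so under evaluation at
  \<open>K\<close> the scalar \<open>w\<close> and the constant \<open>slice_pt K w\<close> both act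
  as left multiplication by that point and cancel.\<close>

lemma cq_eval_linear_mult:
  assumes "K \<in> \<S>"
  shows "cq_eval K (cq_linear (slice_pt K w) w * A) = 0"
proof -
  have *: "K * (K * X) = - X" for X
    by (rule imag_units_mult_left[OF assms])
  have "cq_Re (cq_linear (slice_pt K w) w) = - (Im w *\<^sub>R K)"
    "cq_Im (cq_linear (slice_pt K w) w) = Im w *\<^sub>R 1"
    using assms by (simp_all add: cq_linear_def quat_eq_iff imag_units_iff)
  then show ?thesis
    by (simp add: cq_eval_def cq_Re_Im_mult algebra_simps *)
qed

text \<open>Both parts of the product are nonzero multiples of \<open>cq_eval K A\<close>. So
  multiplication by the conjugate factor turns a condition at the single unit \<open>K\<close> into
  vanishing at all units.\<close>

lemma cq_linear_cnj_mult_eq_0_iff: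
  assumes "K \<in> \<S>" "Im w \<noteq> 0"
  shows "cq_linear (q_cnj (slice_pt K w)) w * A = 0 \<longleftrightarrow> cq_eval K A = 0"
proof -
  have *: "K * (K * X) = - X" for X
    by (rule imag_units_mult_left[OF assms(1)])
  define L where "L = cq_linear (q_cnj (slice_pt K w)) w"
  have L: "cq_Re L = Im w *\<^sub>R K" "cq_Im L = Im w *\<^sub>R 1"
    using assms by (simp_all add: L_def cq_linear_def quat_eq_iff imag_units_iff)
  have "cq_Im (L * A) = Im w *\<^sub>R cq_eval K A" "cq_Re (L * A) = Im w *\<^sub>R (K * cq_eval K A)"
    by (simp_all add: cq_Re_Im_mult L cq_eval_def algebra_simps *)
  then show ?thesis
    unfolding L_def[symmetric] using assms(2) by (auto simp: cquat_eq_iff_Re_Im)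
qed

lemma cq_nrm_eq_0_iff:
  "cq_nrm A = 0 \<longleftrightarrow> (\<exists>K\<in>\<S>. cq_eval K A = 0)"
proof
  assume "\<exists>K\<in>\<S>. cq_eval K A = 0"
  then obtain K where K: "K \<in> \<S>" "cq_eval K A = 0" by blast
  then have re: "cq_Re A = - (K * cq_Im A)"
    by (simp add: cq_eval_def eq_neg_iff_add_eq_0)
  have "norm (cq_Re A) = norm (cq_Im A)"
    by (simp add: re norm_mult norm_imag_units K)
  moreover have "cq_Re A \<bullet> cq_Im A = 0"
    unfolding re using K(1) by (simp add: inner_quat_def imag_units_iff algebra_simps)
  ultimately show "cq_nrm A = 0"
    by (simp add: cq_nrm_eq_Complex complex_eq_iff)
next
  assume "cq_nrm A = 0"
  then have n: "(norm (cq_Re A))\<^sup>2 = (norm (cq_Im A))\<^sup>2" and i: "cq_Re A \<bullet> cq_Im A = 0"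
    by (simp_all add: cq_nrm_eq_Complex complex_eq_iff)
  show "\<exists>K\<in>\<S>. cq_eval K A = 0"
  proof (cases "cq_Im A = 0")
    case True
    then have "A = 0" using n by (simp add: cquat_eq_iff_Re_Im)
    moreover have "Quat 0 1 0 0 \<in> \<S>" by (simp add: imag_units_iff)
    ultimately show ?thesis by (auto simp: cq_eval_arith)
  next
    case False
    \<comment> \<open>Forced by \<open>cq_Re A + K * cq_Im A = 0\<close>. Orthogonality of the two
      parts makes \<open>K\<close> purely imaginary, equality of their norms makes it a
      unit.\<close>
    define K where "K = - (cq_Re A * inverse (cq_Im A))"
    have "cq_eval K A = 0"
      using False by (simp add: cq_eval_def K_def mult.assoc)
    have "q_re K = - (cq_Re A \<bullet> cq_Im A) / (norm (cq_Im A))\<^sup>2"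
      by (simp add: K_def inverse_quat_def norm_quat_square inner_quat_def divide_inverse algebra_simps)
    then have "q_re K = 0" using i by simp
    moreover have "norm K = 1"
      using False n by (simp add: K_def norm_mult norm_inverse)
    then have "(norm K)\<^sup>2 = 1" by simp
    ultimately have "K \<in> \<S>"
      unfolding norm_quat_square by (simp add: imag_units_iff)
    with \<open>cq_eval K A = 0\<close> show ?thesis by blast
  qed
qed

section \<open>Holomorphic functions with values in the complexified quaternions\<close>

text \<open>Componentwise, because \<open>cquat\<close> carries no topology here and scalar complex
  analysis applies to each component.\<close>

definition cq_hol_on :: "(complex \<Rightarrow> cquat) \<Rightarrow> complex set \<Rightarrow> bool"
    (infix "cq'_hol'_on" 50) where
  "F cq_hol_on U \<longleftrightarrow>
     (\<lambda>z. cq_re (F z)) holomorphic_on U \<and> (\<lambda>z. cq_i (F z)) holomorphic_on U \<and>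
     (\<lambda>z. cq_j (F z)) holomorphic_on U \<and> (\<lambda>z. cq_k (F z)) holomorphic_on U"

definition cq_deriv :: "(complex \<Rightarrow> cquat) \<Rightarrow> complex \<Rightarrow> cquat" where
  "cq_deriv F z = CQuat (deriv (\<lambda>z. cq_re (F z)) z) (deriv (\<lambda>z. cq_i (F z)) z)
     (deriv (\<lambda>z. cq_j (F z)) z) (deriv (\<lambda>z. cq_k (F z)) z)"

lemma cq_deriv_sel [simp]:
  "cq_re (cq_deriv F z) = deriv (\<lambda>z. cq_re (F z)) z" "cq_i (cq_deriv F z) = deriv (\<lambda>z. cq_i (F z)) z"
  "cq_j (cq_deriv F z) = deriv (\<lambda>z. cq_j (F z)) z" "cq_k (cq_deriv F z) = deriv (\<lambda>z. cq_k (F z)) z"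
  by (simp_all add: cq_deriv_def)

lemma cq_hol_on_subset: "F cq_hol_on U \<Longrightarrow> V \<subseteq> U \<Longrightarrow> F cq_hol_on V"
  unfolding cq_hol_on_def by (meson holomorphic_on_subset)

lemma cq_hol_cong: "(\<And>z. z \<in> U \<Longrightarrow> F z = G z) \<Longrightarrow> F cq_hol_on U \<longleftrightarrow> G cq_hol_on U"
  unfolding cq_hol_on_def by (simp cong: holomorphic_cong)

lemma cq_hol_const: "(\<lambda>z. A) cq_hol_on U"
  unfolding cq_hol_on_def by (auto intro!: holomorphic_intros)

lemma cq_hol_diff:
  "F cq_hol_on U \<Longrightarrow> G cq_hol_on U \<Longrightarrow> (\<lambda>z. F z - G z) cq_hol_on U"
  unfolding cq_hol_on_def by (auto intro!: holomorphic_intros)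

lemma cq_hol_mult:
  "F cq_hol_on U \<Longrightarrow> G cq_hol_on U \<Longrightarrow> (\<lambda>z. F z * G z) cq_hol_on U"
  unfolding cq_hol_on_def by (auto intro!: holomorphic_intros)

lemma cq_hol_cplx: "f holomorphic_on U \<Longrightarrow> (\<lambda>z. cq_cplx (f z)) cq_hol_on U"
  unfolding cq_hol_on_def by (auto intro!: holomorphic_intros)

lemma cq_hol_linear: "cq_linear a cq_hol_on U"
  unfolding cq_linear_def[abs_def]
  by (intro cq_hol_diff cq_hol_const cq_hol_cplx holomorphic_intros)

lemma cq_nrm_holomorphic: "F cq_hol_on U \<Longrightarrow> (\<lambda>z. cq_nrm (F z)) holomorphic_on U"
  unfolding cq_hol_on_def cq_nrm_def by (auto intro!: holomorphic_intros)

lemma cq_hol_deriv: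
  "F cq_hol_on U \<Longrightarrow> open U \<Longrightarrow> cq_deriv F cq_hol_on U"
  unfolding cq_hol_on_def by (auto intro!: holomorphic_intros holomorphic_deriv)

lemma has_derivative_Quat:
  assumes "(a has_derivative a') F" "(b has_derivative b') F" "(c has_derivative c') F"
    "(d has_derivative d') F"
  shows "((\<lambda>x. Quat (a x) (b x) (c x) (d x)) has_derivative (\<lambda>h. Quat (a' h) (b' h) (c' h) (d' h))) F"
  unfolding Quat_eq_scaleR[of "a _"] Quat_eq_scaleR[of "a' _"]
  by (intro has_derivative_add has_derivative_scaleR_left assms)

lemma continuous_on_Quat [continuous_intros]:
  assumes "continuous_on S a" "continuous_on S b" "continuous_on S c" "continuous_on S d"
  shows "continuous_on S (\<lambda>x. Quat (a x) (b x) (c x) (d x))"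
  unfolding Quat_eq_scaleR[of "a _"] by (intro continuous_intros assms)

lemma cq_hol_has_derivative:
  assumes "F cq_hol_on U" "open U" "z \<in> U"
  shows "((\<lambda>z. cq_Re (F z)) has_derivative (\<lambda>w. cq_Re (cq_cplx w * cq_deriv F z))) (at z)"
    "((\<lambda>z. cq_Im (F z)) has_derivative (\<lambda>w. cq_Im (cq_cplx w * cq_deriv F z))) (at z)"
proof -
  have *: "((\<lambda>z. Re (c z)) has_derivative (\<lambda>w. Re (w * deriv c z))) (at z)"
      "((\<lambda>z. Im (c z)) has_derivative (\<lambda>w. Im (w * deriv c z))) (at z)"
    if "c holomorphic_on U" for c
  proof -
    have "(c has_field_derivative deriv c z) (at z)"
      using that assms(2,3) holomorphic_derivI by blast
    moreover have "(*) (deriv c z) = (\<lambda>w. w * deriv c z)" by auto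
    ultimately have "(c has_derivative (\<lambda>w. w * deriv c z)) (at z)"
      by (simp add: has_field_derivative_def)
    then show "((\<lambda>z. Re (c z)) has_derivative (\<lambda>w. Re (w * deriv c z))) (at z)"
      "((\<lambda>z. Im (c z)) has_derivative (\<lambda>w. Im (w * deriv c z))) (at z)"
      by (rule bounded_linear.has_derivative[OF bounded_linear_Re]
          bounded_linear.has_derivative[OF bounded_linear_Im])+
  qed
  note h = assms(1)[unfolded cq_hol_on_def]
  show "((\<lambda>z. cq_Re (F z)) has_derivative (\<lambda>w. cq_Re (cq_cplx w * cq_deriv F z))) (at z)"
    "((\<lambda>z. cq_Im (F z)) has_derivative (\<lambda>w. cq_Im (cq_cplx w * cq_deriv F z))) (at z)"
    unfolding cq_Re_def cq_Im_def cquat_sel cq_cplx_sel cq_deriv_sel mult_zero_left diff_zero add_0_right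
    by (intro has_derivative_Quat *; use h in simp)+
qed

text \<open>Complex linearity of the derivative of \<open>F\<close> becomes, after evaluation, left
  linearity over \<open>slice J\<close>; this is the Cauchy-Riemann equation of slice
  regularity.\<close>

lemma cq_hol_eval_has_derivative:
  assumes "F cq_hol_on U" "open U" "z \<in> U" "J \<in> \<S>"
  shows "((\<lambda>z. cq_eval J (F z)) has_derivative (\<lambda>w. slice_pt J w * cq_eval J (cq_deriv F z))) (at z)"
proof -
  have "((\<lambda>z. cq_eval J (F z)) has_derivative (\<lambda>w. cq_eval J (cq_cplx w * cq_deriv F z))) (at z)"
    unfolding cq_eval_def
    by (intro has_derivative_add has_derivative_mult_right cq_hol_has_derivative[OF assms(1-3)])
  then show ?thesis by (simp add: cq_eval_cplx_mult assms(4))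
qed

lemma cq_hol_continuous:
  assumes "F cq_hol_on U"
  shows "continuous_on U (\<lambda>z. cq_Re (F z))" "continuous_on U (\<lambda>z. cq_Im (F z))"
  using assms unfolding cq_Re_def cq_Im_def cq_hol_on_def
  by (auto intro!: continuous_intros holomorphic_on_imp_continuous_on)

lemma cq_hol_eval_continuous:
  "F cq_hol_on U \<Longrightarrow> continuous_on U (\<lambda>z. cq_eval J (F z))"
  unfolding cq_eval_def by (intro continuous_intros cq_hol_continuous)

lemma cq_hol_identity:
  assumes "F cq_hol_on U" "open U" "connected U"
    and "V \<subseteq> U" "z0 \<in> U" "z0 islimpt V" "\<And>z. z \<in> V \<Longrightarrow> F z = 0" "z \<in> U"
  shows "F z = 0"
proof -
  note h = assms(1)[unfolded cq_hol_on_def]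
  have *: "c z = 0" if "c holomorphic_on U" "\<And>z. z \<in> V \<Longrightarrow> c z = 0" for c
    using analytic_continuation[OF that(1) assms(2,3,4,5,6) that(2) assms(8)] by blast
  then show ?thesis
    using h assms(7) *[of "\<lambda>z. cq_re (F z)"] *[of "\<lambda>z. cq_i (F z)"]
      *[of "\<lambda>z. cq_j (F z)"] *[of "\<lambda>z. cq_k (F z)"] by (simp add: cquat_eq_iff)
qed

lemma cq_hol_eqI:
  assumes "F cq_hol_on U" "G cq_hol_on U" "open U" "z0 \<in> U"
    and "\<And>z. z \<in> U \<Longrightarrow> z \<noteq> z0 \<Longrightarrow> F z = G z"
  shows "F z0 = G z0"
proof -
  have "continuous_on U (\<lambda>z. cq_Re (F z) - cq_Re (G z))" "continuous_on U (\<lambda>z. cq_Im (F z) - cq_Im (G z))"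
    by (intro continuous_intros cq_hol_continuous assms)+
  then have "isCont (\<lambda>z. cq_Re (F z) - cq_Re (G z)) z0" "isCont (\<lambda>z. cq_Im (F z) - cq_Im (G z)) z0"
    using assms(3,4) by (simp_all add: continuous_on_eq_continuous_at)
  moreover have "\<forall>\<^sub>F z in at z0. F z = G z"
    using assms(3-5) by (auto simp: eventually_at_topological)
  then have "\<forall>\<^sub>F z in at z0. cq_Re (F z) - cq_Re (G z) = 0"
     "\<forall>\<^sub>F z in at z0. cq_Im (F z) - cq_Im (G z) = 0"
    by (eventually_elim, simp)+
  note this[THEN tendsto_eventually]
  ultimately have "cq_Re (F z0) - cq_Re (G z0) = 0" "cq_Im (F z0) - cq_Im (G z0) = 0"
    unfolding isCont_def by (meson LIM_unique)+
  then show ?thesis by (simp add: cquat_eq_iff_Re_Im)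
qed

section \<open>Slice regularity through holomorphy\<close>

definition slice_dom :: "quat set \<Rightarrow> quat \<Rightarrow> complex set" where
  "slice_dom \<Omega> J = {z. slice_pt J z \<in> \<Omega>}"

lemma mem_slice_dom [simp]: "z \<in> slice_dom \<Omega> J \<longleftrightarrow> slice_pt J z \<in> \<Omega>"
  by (simp add: slice_dom_def)

lemma open_slice_dom: "open \<Omega> \<Longrightarrow> open (slice_dom \<Omega> J)"
proof -
  assume "open \<Omega>"
  moreover have "slice_dom \<Omega> J = slice_pt J -` \<Omega>" by auto
  moreover have "continuous_on UNIV (slice_pt J)" by (intro continuous_intros)
  ultimately show ?thesis by (simp add: continuous_on_open_vimage)
qed

lemma slice_partials:
  assumes G: "G cq_hol_on U" and U: "open U" "z \<in> U" and I: "I \<in> \<S>"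
    and f: "\<And>z. z \<in> U \<Longrightarrow> f (slice_pt I z) = cq_eval I (G z)"
  shows "((\<lambda>t. f (of_real t + of_real (Im z) * I)) has_vector_derivative cq_eval I (cq_deriv G z)) (at (Re z))"
    "((\<lambda>t. f (of_real (Re z) + of_real t * I)) has_vector_derivative I * cq_eval I (cq_deriv G z)) (at (Im z))"
proof -
  have D: "((\<lambda>z. f (slice_pt I z)) has_derivative (\<lambda>w. slice_pt I w * cq_eval I (cq_deriv G z))) (at z)"
    by (rule has_derivative_transform_within_open[OF cq_hol_eval_has_derivative[OF G U I] U])
      (simp add: f)
  have 1: "((\<lambda>t. Complex t (Im z)) has_derivative (\<lambda>h. of_real h)) (at (Re z))"
    unfolding Complex_eq by (auto intro!: derivative_eq_intros)
  have "((\<lambda>t. f (slice_pt I (Complex t (Im z)))) has_derivative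
      (\<lambda>h. slice_pt I (of_real h) * cq_eval I (cq_deriv G z))) (at (Re z))"
    using D has_derivative_compose[OF 1, of "\<lambda>z. f (slice_pt I z)"
        "\<lambda>w. slice_pt I w * cq_eval I (cq_deriv G z)"] by simp
  then show "((\<lambda>t. f (of_real t + of_real (Im z) * I)) has_vector_derivative cq_eval I (cq_deriv G z)) (at (Re z))"
    by (simp add: has_vector_derivative_def slice_pt_Complex) (simp add: of_real_def)
  have 2: "((\<lambda>t. Complex (Re z) t) has_derivative (\<lambda>h. \<i> * of_real h)) (at (Im z))"
    unfolding Complex_eq by (auto intro!: derivative_eq_intros)
  have "((\<lambda>t. f (slice_pt I (Complex (Re z) t))) has_derivative
      (\<lambda>h. slice_pt I (\<i> * of_real h) * cq_eval I (cq_deriv G z))) (at (Im z))"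
    using D has_derivative_compose[OF 2, of "\<lambda>z. f (slice_pt I z)"
        "\<lambda>w. slice_pt I w * cq_eval I (cq_deriv G z)"] by simp
  moreover have "slice_pt I (\<i> * of_real h) = h *\<^sub>R I" for h
    by (simp add: slice_pt_def of_real_def)
  ultimately show "((\<lambda>t. f (of_real (Re z) + of_real t * I)) has_vector_derivative I * cq_eval I (cq_deriv G z)) (at (Im z))"
    by (simp add: has_vector_derivative_def slice_pt_Complex)
qed

lemma slice_dx_dy_eq:
  assumes "G cq_hol_on U" "open U" "z \<in> U" "I \<in> \<S>"
    and "\<And>z. z \<in> U \<Longrightarrow> f (slice_pt I z) = cq_eval I (G z)"
  shows "slice_dx f I (Re z) (Im z) = cq_eval I (cq_deriv G z)"
    "slice_dy f I (Re z) (Im z) = I * cq_eval I (cq_deriv G z)"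
  unfolding slice_dx_def slice_dy_def
  using slice_partials[OF assms] by (simp_all add: vector_derivative_at)

text \<open>Slice regularity is a condition on each slice separately, so \<open>G\<close> may be
  chosen anew for each \<open>I\<close>. This allows quotients to be constructed slice by
  slice.\<close>

lemma slice_regular_onI:
  assumes "open \<Omega>"
    and "\<And>I. I \<in> \<S> \<Longrightarrow> \<exists>G. G cq_hol_on slice_dom \<Omega> I \<and>
          (\<forall>z. slice_pt I z \<in> \<Omega> \<longrightarrow> f (slice_pt I z) = cq_eval I (G z))"
  shows "slice_regular_on \<Omega> f"
  unfolding slice_regular_on_def
proof (intro ballI)
  fix I assume I: "I \<in> \<S>"
  define U where "U = slice_dom \<Omega> I"
  have "open U" using assms(1) by (simp add: U_def open_slice_dom)
  from assms(2)[OF I] obtain G where G: "G cq_hol_on U"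
    and f: "\<And>z. z \<in> U \<Longrightarrow> f (slice_pt I z) = cq_eval I (G z)" by (auto simp: U_def)
  have cont: "continuous_on {(x, y). of_real x + of_real y * I \<in> \<Omega>}
      (\<lambda>p. cq_eval I (cq_deriv G (Complex (fst p) (snd p))))"
  proof (rule continuous_on_compose2[of U "\<lambda>z. cq_eval I (cq_deriv G z)"])
    show "continuous_on U (\<lambda>z. cq_eval I (cq_deriv G z))"
      by (intro cq_hol_eval_continuous cq_hol_deriv G \<open>open U\<close>)
    show "continuous_on {(x, y). of_real x + of_real y * I \<in> \<Omega>} (\<lambda>p. Complex (fst p) (snd p))"
      unfolding Complex_eq by (intro continuous_intros)
    show "(\<lambda>p. Complex (fst p) (snd p)) ` {(x, y). of_real x + of_real y * I \<in> \<Omega>} \<subseteq> U"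
      by (auto simp: U_def slice_pt_Complex)
  qed
  have dx: "slice_dx f I x y = cq_eval I (cq_deriv G (Complex x y))"
    and dy: "slice_dy f I x y = I * cq_eval I (cq_deriv G (Complex x y))"
    and diff: "(\<lambda>t. f (of_real t + of_real y * I)) differentiable (at x)"
      "(\<lambda>t. f (of_real x + of_real t * I)) differentiable (at y)"
    if "of_real x + of_real y * I \<in> \<Omega>" for x y
  proof -
    have z: "Complex x y \<in> U" using that by (simp add: U_def slice_pt_Complex)
    show "slice_dx f I x y = cq_eval I (cq_deriv G (Complex x y))"
        "slice_dy f I x y = I * cq_eval I (cq_deriv G (Complex x y))"
      using slice_dx_dy_eq[OF G \<open>open U\<close> z I f] by simp_all
    show "(\<lambda>t. f (of_real t + of_real y * I)) differentiable (at x)"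
        "(\<lambda>t. f (of_real x + of_real t * I)) differentiable (at y)"
      using slice_partials[OF G \<open>open U\<close> z I f] by (auto intro: differentiableI_vector)
  qed
  have II: "I * (I * X) = - X" for X
    by (rule imag_units_mult_left[OF I])
  show "(\<forall>x y. of_real x + of_real y * I \<in> \<Omega> \<longrightarrow>
           (\<lambda>t. f (of_real t + of_real y * I)) differentiable (at x) \<and>
           (\<lambda>t. f (of_real x + of_real t * I)) differentiable (at y) \<and>
           (1/2) *\<^sub>R (slice_dx f I x y + I * slice_dy f I x y) = 0) \<and>
        continuous_on {(x, y). of_real x + of_real y * I \<in> \<Omega>} (\<lambda>(x, y). slice_dx f I x y) \<and>
        continuous_on {(x, y). of_real x + of_real y * I \<in> \<Omega>} (\<lambda>(x, y). slice_dy f I x y)"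
  proof (intro conjI allI impI)
    show "continuous_on {(x, y). of_real x + of_real y * I \<in> \<Omega>} (\<lambda>(x, y). slice_dx f I x y)"
      by (rule continuous_on_eq[OF cont]) (auto simp: dx)
    show "continuous_on {(x, y). of_real x + of_real y * I \<in> \<Omega>} (\<lambda>(x, y). slice_dy f I x y)"
      by (rule continuous_on_eq[OF continuous_on_mult_left[OF cont, of I]]) (auto simp: dy)
  qed (simp_all add: diff dx dy II)
qed

text \<open>Continuity of the partial derivatives gives total differentiability along the slice, and
  the Cauchy-Riemann equation turns the differential into a left multiplication of one
  vector.\<close>

lemma slice_regular_on_has_derivative:
  assumes f: "slice_regular_on \<Omega> f" and \<Omega>: "open \<Omega>" and I: "I \<in> \<S>"
    and z: "slice_pt I z \<in> \<Omega>"
  shows "((\<lambda>z. f (slice_pt I z)) has_derivative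
            (\<lambda>w. slice_pt I w * slice_dx f I (Re z) (Im z))) (at z)"
proof -
  define W where "W = {(x, y). of_real x + of_real y * I \<in> \<Omega>}"
  have "W = (\<lambda>p. of_real (fst p) + of_real (snd p) * I) -` \<Omega>" by (auto simp: W_def)
  moreover have "continuous_on UNIV (\<lambda>p. of_real (fst p) + of_real (snd p) * I)"
    by (intro continuous_intros)
  ultimately have "open W" using \<Omega> by (simp add: continuous_on_open_vimage)
  define x y where "x = Re z" and "y = Im z"
  have xy: "(x, y) \<in> W" using z by (simp add: W_def x_def y_def slice_pt_def)
  then obtain A B where AB: "open A" "open B" "x \<in> A" "y \<in> B" "A \<times> B \<subseteq> W"
    using \<open>open W\<close> by (metis open_prod_elim mem_Sigma_iff)
  obtain e where e: "e > 0" "ball x e \<subseteq> A" using AB(1,3) by (meson open_contains_ball)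
  obtain e' where e': "e' > 0" "ball y e' \<subseteq> B" using AB(2,4) by (meson open_contains_ball)
  define X Y where "X = ball x e" and "Y = ball y e'"
  have XY: "X \<times> Y \<subseteq> W" using AB(5) e(2) e'(2) by (auto simp: X_def Y_def)
  have "open (X \<times> Y)" by (simp add: X_def Y_def open_Times)
  have xyXY: "(x, y) \<in> X \<times> Y" using e e' by (simp add: X_def Y_def)
  define g where "g x y = f (of_real x + of_real y * I)" for x y
  have reg: "(\<lambda>t. g t y) differentiable (at x)" "(\<lambda>t. g x t) differentiable (at y)"
    "slice_dx f I x y + I * slice_dy f I x y = 0" if "(x, y) \<in> W" for x y
    using f I that unfolding slice_regular_on_def W_def g_def by auto
  have vx: "((\<lambda>t. g t y) has_derivative (\<lambda>h. h *\<^sub>R slice_dx f I x y)) (at x)"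
    using reg(1)[OF xy] unfolding g_def slice_dx_def
    by (simp add: vector_derivative_works has_vector_derivative_def)
  have vy: "((\<lambda>t. g x t) has_derivative (\<lambda>h. h *\<^sub>R slice_dy f I x y)) (at y)" if "(x, y) \<in> W" for x y
    using reg(2)[OF that] unfolding g_def slice_dy_def
    by (simp add: vector_derivative_works has_vector_derivative_def)
  have "continuous_on W (\<lambda>(x, y). slice_dy f I x y)"
    using f I unfolding slice_regular_on_def W_def by blast
  then have "continuous_on W (\<lambda>p. blinfun_scaleR_left (case p of (x, y) \<Rightarrow> slice_dy f I x y))"
    by (intro continuous_intros) 
  then have "continuous_on W (\<lambda>(x, y). blinfun_scaleR_left (slice_dy f I x y))"
    by (simp add: case_prod_beta)
  then have "continuous (at (x, y)) (\<lambda>(x, y). blinfun_scaleR_left (slice_dy f I x y))"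
    using xy \<open>open W\<close> by (simp add: continuous_on_eq_continuous_at)
  then have "continuous (at (x, y) within X \<times> Y) (\<lambda>(x, y). blinfun_scaleR_left (slice_dy f I x y))"
    by (rule continuous_at_imp_continuous_within)
  then have "((\<lambda>(x, y). g x y) has_derivative
      (\<lambda>(tx, ty). tx *\<^sub>R slice_dx f I x y + blinfun_apply (blinfun_scaleR_left (slice_dy f I x y)) ty))
      (at (x, y) within X \<times> Y)"
  proof (rule has_derivative_partialsI[rotated 2])
    show "((\<lambda>x. g x y) has_derivative (\<lambda>h. h *\<^sub>R slice_dx f I x y)) (at x within X)"
      using vx by (rule has_derivative_at_withinI)
    show "((\<lambda>y. g x y) has_derivative blinfun_apply (blinfun_scaleR_left (slice_dy f I x y))) (at y within Y)"
      if "x \<in> X" "y \<in> Y" for x y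
    proof -
      have "(x, y) \<in> W" using that XY by blast
      moreover have "blinfun_apply (blinfun_scaleR_left c) = (\<lambda>h. h *\<^sub>R c)" for c :: quat
        by (auto simp: blinfun_scaleR_left.rep_eq)
      ultimately show ?thesis using vy by (auto intro: has_derivative_at_withinI)
    qed
    show "y \<in> Y" "convex Y" using e' by (simp_all add: Y_def)
  qed
  then have D: "((\<lambda>p. g (fst p) (snd p)) has_derivative
      (\<lambda>p. fst p *\<^sub>R slice_dx f I x y + snd p *\<^sub>R slice_dy f I x y)) (at (x, y))"
    unfolding at_within_open[OF xyXY \<open>open (X \<times> Y)\<close>] by (simp add: case_prod_unfold)
  have "((\<lambda>z. (Re z, Im z)) has_derivative (\<lambda>w. (Re w, Im w))) (at z)"
    by (auto intro!: derivative_eq_intros)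
  from has_derivative_compose[OF this, of "\<lambda>p. g (fst p) (snd p)"
      "\<lambda>p. fst p *\<^sub>R slice_dx f I x y + snd p *\<^sub>R slice_dy f I x y"] D
  have "((\<lambda>z. g (Re z) (Im z)) has_derivative
     (\<lambda>w. Re w *\<^sub>R slice_dx f I x y + Im w *\<^sub>R slice_dy f I x y)) (at z)"
    by (simp add: x_def y_def)
  moreover have "slice_dy f I x y = I * slice_dx f I x y"
  proof -
    have "I * (slice_dx f I x y + I * slice_dy f I x y) = 0" using reg(3)[OF xy] by simp
    moreover have "I * (I * X) = - X" for X
      by (rule imag_units_mult_left[OF I])
    ultimately show ?thesis by (simp add: distrib_left)
  qed
  ultimately show ?thesis
    by (simp add: g_def slice_pt_def x_def y_def distrib_right of_real_def)
qed

text \<open>The lift turns left multiplication by \<open>slice_pt I w\<close> into multiplication by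
  the scalar \<open>w\<close>, so the differential of each component is complex linear.\<close>

lemma slice_regular_on_lift_holomorphic:
  assumes f: "slice_regular_on \<Omega> f" and \<Omega>: "open \<Omega>" and I: "I \<in> \<S>"
  shows "(\<lambda>z. cq_lift I (f (slice_pt I z))) cq_hol_on slice_dom \<Omega> I"
proof -
  have *: "(\<lambda>z. L (cq_lift I (f (slice_pt I z)))) holomorphic_on slice_dom \<Omega> I"
    if "bounded_linear (\<lambda>q. L (cq_lift I q))" "\<And>c A. L (cq_cplx c * A) = c * L A"
    for L :: "cquat \<Rightarrow> complex"
  proof (rule holomorphic_onI)
    fix z assume "z \<in> slice_dom \<Omega> I"
    then have "slice_pt I z \<in> \<Omega>" by simp
    from bounded_linear.has_derivative[OF that(1) slice_regular_on_has_derivative[OF f \<Omega> I this]]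
    have "((\<lambda>z. L (cq_lift I (f (slice_pt I z)))) has_derivative
        (\<lambda>w. w * L (cq_lift I (slice_dx f I (Re z) (Im z))))) (at z)"
      by (simp add: cq_lift_slice_pt_mult[OF I] that(2))
    moreover have "(\<lambda>w. w * c) = (*) c" for c :: complex by auto
    ultimately have "((\<lambda>z. L (cq_lift I (f (slice_pt I z)))) has_field_derivative
        L (cq_lift I (slice_dx f I (Re z) (Im z)))) (at z)"
      by (simp add: has_field_derivative_def)
    then show "(\<lambda>z. L (cq_lift I (f (slice_pt I z)))) field_differentiable (at z within slice_dom \<Omega> I)"
      using field_differentiable_at_within field_differentiable_def by blast
  qed
  have lin: "bounded_linear (\<lambda>q. L (cq_lift I q))"
    if "\<And>A B. L (A + B) = L A + L B" "\<And>r A. L (cq_cplx (of_real r) * A) = of_real r * L A"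
    for L :: "cquat \<Rightarrow> complex"
  proof -
    have "cq_lift I (p + q) = cq_lift I p + cq_lift I q" 
      "cq_lift I (r *\<^sub>R q) = cq_cplx (of_real r) * cq_lift I q" for p q r
      by (simp_all add: cq_lift_def cquat_eq_iff algebra_simps)
    then have "linear (\<lambda>q. L (cq_lift I q))"
      using that by (intro linearI) (simp_all add: scaleR_conv_of_real)
    then show ?thesis by (simp add: linear_conv_bounded_linear)
  qed
  show ?thesis
    unfolding cq_hol_on_def by (intro conjI *; (rule lin)?; simp)
qed

lemma cullen_derivative_eq:
  assumes f: "slice_regular_on \<Omega> f" and \<Omega>: "open \<Omega>" and I: "I \<in> \<S>"
    and z: "slice_pt I z \<in> \<Omega>"
  shows "cullen_derivative f (slice_pt I z) = slice_dx f I (Re z) (Im z)"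
proof -
  have half: "(1/2) *\<^sub>R (slice_dx f J x y - J * slice_dy f J x y) = slice_dx f J x y"
    if "J \<in> \<S>" "of_real x + of_real y * J \<in> \<Omega>" for J x y
  proof -
    have "(1/2) *\<^sub>R (slice_dx f J x y + J * slice_dy f J x y) = 0"
      using f that unfolding slice_regular_on_def by blast
    then have "J * slice_dy f J x y = - slice_dx f J x y"
      by (simp add: eq_neg_iff_add_eq_0 add.commute)
    then show ?thesis by (simp add: scaleR_2[symmetric])
  qed
  have same: "slice_dx f J x y = slice_dx f I (Re z) (Im z)"
    if J: "J \<in> \<S>" and q: "slice_pt I z = of_real x + of_real y * J" for J x y
  proof -
    have q': "slice_pt I z = slice_pt J (Complex x y)" using q by (simp add: slice_pt_Complex)
    have x: "x = Re z" 
      using slice_pt_q_re[OF I, of z] slice_pt_q_re[OF J, of "Complex x y"] q' by simp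
    \<comment> \<open>\<open>slice_dx\<close> depends on \<open>y\<close> and \<open>J\<close> only
      through their product. This covers the pair \<open>-y\<close>, \<open>-J\<close> as well as a
      real point, where \<open>J\<close> is arbitrary.\<close>
    have "of_real y * J = of_real (Im z) * I" using q by (simp add: slice_pt_def x)
    then show ?thesis by (simp add: slice_dx_def x)
  qed
  show ?thesis
    unfolding cullen_derivative_def
  proof (rule the_equality)
    show "\<forall>J\<in>\<S>. \<forall>x y. slice_pt I z = of_real x + of_real y * J \<longrightarrow>
        slice_dx f I (Re z) (Im z) = (1/2) *\<^sub>R (slice_dx f J x y - J * slice_dy f J x y)"
      using half same z by metis
    fix d
    assume "\<forall>J\<in>\<S>. \<forall>x y. slice_pt I z = of_real x + of_real y * J \<longrightarrow>
        d = (1/2) *\<^sub>R (slice_dx f J x y - J * slice_dy f J x y)"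
    then have "d = (1/2) *\<^sub>R (slice_dx f I (Re z) (Im z) - I * slice_dy f I (Re z) (Im z))"
      using I by (simp add: slice_pt_def)
    then show "d = slice_dx f I (Re z) (Im z)"
      using half I z by (simp add: slice_pt_def)
  qed
qed

section \<open>Stems\<close>

text \<open>The stem of \<open>f\<close> at \<open>x + yI\<close> is the element \<open>b + \<i>c\<close> of \<open>\<H> \<otimes> \<C>\<close> such that
  \<open>f(x + yJ) = b + Jc\<close> for all units \<open>J\<close> near \<open>I\<close>. Unlike the spherical value and derivative it is
  also meaningful at real points, where \<open>c = 0\<close>, and for \<open>y < 0\<close>.\<close>

definition stem_rep :: "(quat \<Rightarrow> quat) \<Rightarrow> quat \<Rightarrow> complex \<Rightarrow> cquat \<Rightarrow> bool" where
  "stem_rep f I z A \<longleftrightarrow>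
     (\<exists>e>0. \<forall>J\<in>\<S>. dist J I < e \<longrightarrow> f (slice_pt J z) = cq_eval J A)"

definition stem :: "(quat \<Rightarrow> quat) \<Rightarrow> quat \<Rightarrow> complex \<Rightarrow> cquat" where
  "stem f I z = (THE A. stem_rep f I z A)"

text \<open>A second unit arbitrarily near \<open>I\<close> lies in both neighborhoods, and two
  evaluations determine an element.\<close>

lemma stem_rep_unique:
  assumes "I \<in> \<S>" "stem_rep f I z A" "stem_rep f I z B"
  shows "A = B"
proof -
  obtain d e where d: "d > 0" "\<And>J. J \<in> \<S> \<Longrightarrow> dist J I < d \<Longrightarrow> f (slice_pt J z) = cq_eval J A"
    and e: "e > 0" "\<And>J. J \<in> \<S> \<Longrightarrow> dist J I < e \<Longrightarrow> f (slice_pt J z) = cq_eval J B"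
    using assms(2,3) unfolding stem_rep_def by blast
  obtain J where J: "J \<in> \<S>" "dist J I < min d e" "J \<noteq> I"
    using imag_units_not_isolated[OF assms(1), of "min d e"] d(1) e(1) by auto
  show ?thesis
  proof (rule cq_eval_eq_imp_eq)
    show "cq_eval J A = cq_eval J B" using d(2)[OF J(1)] e(2)[OF J(1)] J(2) by simp
    show "cq_eval I A = cq_eval I B" using d(2)[OF assms(1)] e(2)[OF assms(1)] d(1) e(1) by simp
    show "J \<noteq> I" by fact
  qed
qed

lemma stem_eqI: "I \<in> \<S> \<Longrightarrow> stem_rep f I z A \<Longrightarrow> stem f I z = A"
  unfolding stem_def using stem_rep_unique by blast

lemma stem_rep_eval: "I \<in> \<S> \<Longrightarrow> stem_rep f I z A \<Longrightarrow> f (slice_pt I z) = cq_eval I A"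
  unfolding stem_rep_def by auto

text \<open>Makes the stem locally constant in the unit; half of the radius works by the triangle
  inequality.\<close>

lemma stem_rep_near:
  assumes "stem_rep f I z A"
  shows "\<exists>e>0. \<forall>J\<in>\<S>. dist J I < e \<longrightarrow> stem_rep f J z A"
proof -
  obtain e where e: "e > 0" "\<And>J. J \<in> \<S> \<Longrightarrow> dist J I < e \<Longrightarrow> f (slice_pt J z) = cq_eval J A"
    using assms unfolding stem_rep_def by blast
  have "stem_rep f J z A" if "dist J I < e / 2" for J
    unfolding stem_rep_def
  proof (intro exI[of _ "e/2"] conjI ballI impI)
    fix K assume K: "K \<in> \<S>" "dist K J < e / 2"
    have "dist K I < e" using dist_triangle[of K I J] K(2) that by linarith
    with e(2) K(1) show "f (slice_pt K z) = cq_eval K A" by blast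
  qed (use e in simp)
  then show ?thesis using e(1) by (intro exI[of _ "e/2"]) auto
qed

lemma stem_rep_cong_on:
  assumes "stem_rep f I z A" "open \<Omega>" "slice_pt I z \<in> \<Omega>" "\<And>q. q \<in> \<Omega> \<Longrightarrow> f q = g q"
  shows "stem_rep g I z A"
proof -
  obtain e where e: "e > 0" "\<And>J. J \<in> \<S> \<Longrightarrow> dist J I < e \<Longrightarrow> f (slice_pt J z) = cq_eval J A"
    using assms(1) unfolding stem_rep_def by blast
  obtain d where d: "d > 0" "\<And>J. dist J I < d \<Longrightarrow> slice_pt J z \<in> \<Omega>"
    using slice_pt_near_mem[OF assms(2,3)] by blast
  then have "f (slice_pt J z) = g (slice_pt J z)" if "dist J I < d" for J
    using that assms(4) by blast
  then have "\<forall>J\<in>\<S>. dist J I < min d e \<longrightarrow> g (slice_pt J z) = cq_eval J A"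
    using e(2) by (metis min_less_iff_conj)
  then show ?thesis
    unfolding stem_rep_def using d(1) e(1) by (intro exI[of _ "min d e"]) auto
qed

lemma stem_repI: "(\<And>J. J \<in> \<S> \<Longrightarrow> f (slice_pt J z) = cq_eval J A) \<Longrightarrow> stem_rep f I z A"
  unfolding stem_rep_def by (intro exI[of _ 1]) auto

lemma stem_rep_of_real: "stem_rep f I (of_real x) (cq_quat (f (of_real x)))"
  by (rule stem_repI) (simp add: cq_eval_arith)

lemma stem_of_real: "I \<in> \<S> \<Longrightarrow> stem f I (of_real x) = cq_quat (f (of_real x))"
  by (intro stem_eqI stem_rep_of_real)

lemma stem_rep_linear: "stem_rep (\<lambda>q. q - a) I z (cq_linear a z)"
  by (rule stem_repI) (simp add: cq_linear_def cq_eval_arith cq_eval_cplx)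

lemma stem_rep_diff_const: "stem_rep f I z A \<Longrightarrow> stem_rep (\<lambda>q. f q - a) I z (A - cq_quat a)"
  unfolding stem_rep_def by (auto simp: cq_eval_arith)

section \<open>Local existence of stems\<close>

lemma of_real_islimpt_Reals:
  assumes "open (V :: complex set)" "of_real r \<in> V"
  shows "of_real r islimpt (V \<inter> \<real>)"
  unfolding islimpt_def
proof (intro allI impI)
  fix T :: "complex set" assume "of_real r \<in> T" "open T"
  then have "open (T \<inter> V)" "of_real r \<in> T \<inter> V" using assms by auto
  then obtain e where e: "e > 0" "ball (of_real r) e \<subseteq> T \<inter> V" by (meson open_contains_ball)
  have "dist (complex_of_real r) (of_real (r + e / 2)) < e"
    using e(1) by (simp add: dist_norm)
  then have "complex_of_real (r + e / 2) \<in> T \<inter> V" using e(2) by (auto simp: subset_iff)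
  then show "\<exists>y\<in>V \<inter> \<real>. y \<in> T \<and> y \<noteq> of_real r"
    using e(1) by (intro bexI[of _ "of_real (r + e / 2)"]) (auto simp: complex_eq_iff)
qed

text \<open>\<open>G\<close> is chosen so as to represent \<open>f\<close> on the two slices of \<open>I1\<close> and \<open>I2\<close>; on a third slice,
  \<open>f\<close> and the function represented by \<open>G\<close> agree at the real points, hence everywhere.\<close>

lemma slice_representation:
  assumes f: "slice_regular_on \<Omega> f" "open \<Omega>" and V: "open V" "connected V" "of_real r \<in> V"
    and \<J>: "\<J> \<subseteq> \<S>" "I1 \<in> \<J>" "I2 \<in> \<J>" "I1 \<noteq> I2"
    and sub: "\<And>J z. J \<in> \<J> \<Longrightarrow> z \<in> V \<Longrightarrow> slice_pt J z \<in> \<Omega>"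
  shows "\<exists>G. G cq_hol_on V \<and> (\<forall>J\<in>\<J>. \<forall>z\<in>V. f (slice_pt J z) = cq_eval J (G z))"
proof -
  have hol: "(\<lambda>z. cq_lift J (f (slice_pt J z))) cq_hol_on V" if "J \<in> \<J>" for J
    by (rule cq_hol_on_subset[OF slice_regular_on_lift_holomorphic[OF f]])
      (use that sub \<J>(1) in auto)
  \<comment> \<open>If \<open>f\<close> has stem \<open>G\<close>, its lift at \<open>I1\<close> is
    (1 - \<i>I1)/2 times \<open>G\<close>, and likewise at \<open>I2\<close>, so the difference of
    the lifts is - \<i>(I1 - I2)/2 times \<open>G\<close>. \<open>T\<close> is the inverse of this
    factor.\<close>
  define T where "T = cq_cplx (2 * \<i>) * cq_quat (inverse (I1 - I2))"
  define G where "G z = T * (cq_lift I1 (f (slice_pt I1 z)) - cq_lift I2 (f (slice_pt I2 z)))" for z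
  have G: "G cq_hol_on V"
    unfolding G_def[abs_def]
    by (intro cq_hol_mult cq_hol_const cq_hol_diff hol \<J>)
  have real: "G (of_real x) = cq_quat (f (of_real x))" for x
  proof -
    define q where "q = f (of_real x)"
    have "cq_lift I1 q - cq_lift I2 q = - cq_cplx \<i> * cq_quat ((1/2) *\<^sub>R ((I1 - I2) * q))"
      by (simp add: cq_lift_def cquat_eq_iff algebra_simps)
    then have "G (of_real x) = T * (- cq_cplx \<i> * cq_quat ((1/2) *\<^sub>R ((I1 - I2) * q)))"
      by (simp add: G_def q_def)
    also have "\<dots> = cq_quat (inverse (I1 - I2)) * cq_quat ((I1 - I2) * q)"
      by (simp add: T_def cquat_eq_iff algebra_simps)
    also have "\<dots> = cq_quat (inverse (I1 - I2) * ((I1 - I2) * q))"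
      by (simp add: cq_quat_arith)
    also have "\<dots> = cq_quat q"
      using \<J>(4) by (simp add: mult.assoc[symmetric])
    finally show ?thesis by (simp add: q_def)
  qed
  have "f (slice_pt J z) = cq_eval J (G z)" if "J \<in> \<J>" "z \<in> V" for J z
  proof -
    have J: "J \<in> \<S>" using that \<J>(1) by blast
    \<comment> \<open>The error of the representation on the slice of \<open>J\<close>, lifted so as
      to become holomorphic.\<close>
    define \<psi> where "\<psi> z = cq_lift J (f (slice_pt J z)) - cq_lift J 1 * G z" for z
    have "\<psi> cq_hol_on V"
      unfolding \<psi>_def[abs_def]
      by (intro cq_hol_diff hol that cq_hol_mult cq_hol_const G)
    moreover have "\<psi> w = 0" if "w \<in> V \<inter> \<real>" for w
    proof -
      from that obtain x where "w = of_real x" by (auto elim: Reals_cases)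
      then show ?thesis
        using cq_lift_eq_mult[of J "f (of_real x)"] by (simp add: \<psi>_def real)
    qed
    ultimately have "\<psi> z = 0"
      using cq_hol_identity[of \<psi> V "V \<inter> \<real>" "of_real r" z]
        V of_real_islimpt_Reals[OF V(1,3)] \<open>z \<in> V\<close> by auto
    then have "cq_lift J (f (slice_pt J z) - cq_eval J (G z)) = 0"
      by (simp add: \<psi>_def cq_lift_diff cq_lift_eval[OF J])
    then show ?thesis by (simp add: cq_lift_eq_0_iff[OF J])
  qed
  with G show ?thesis by blast
qed

lemma connected_slice_dom:
  assumes "slice_domain \<Omega>" "I \<in> \<S>" shows "connected (slice_dom \<Omega> I)"
proof -
  have re: "q_re I = 0" using assms(2) by (simp add: imag_units_iff)
  have eq: "Complex (q_re (slice_pt I z)) (slice_pt I z \<bullet> I) = z" for z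
  proof -
    have "slice_pt I z \<bullet> I = Im z * ((q_i I)\<^sup>2 + (q_j I)\<^sup>2 + (q_k I)\<^sup>2)"
      using re by (simp add: inner_quat_def power2_eq_square algebra_simps)
    then show ?thesis using assms(2) by (simp add: imag_units_iff)
  qed
  have sl: "slice I = range (slice_pt I)"
    by (auto simp: slice_def slice_pt_def image_iff) (metis complex.sel)
  have "slice_dom \<Omega> I = (\<lambda>q. Complex (q_re q) (q \<bullet> I)) ` (\<Omega> \<inter> slice I)"
  proof (intro equalityI subsetI)
    fix z assume "z \<in> slice_dom \<Omega> I"
    then have "slice_pt I z \<in> \<Omega> \<inter> slice I" by (auto simp: sl)
    then show "z \<in> (\<lambda>q. Complex (q_re q) (q \<bullet> I)) ` (\<Omega> \<inter> slice I)"
      by (rule image_eqI[rotated]) (rule eq[symmetric])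
  next
    fix z assume "z \<in> (\<lambda>q. Complex (q_re q) (q \<bullet> I)) ` (\<Omega> \<inter> slice I)"
    then show "z \<in> slice_dom \<Omega> I" by (auto simp: sl eq simp del: slice_pt_sel)
  qed
  moreover have "connected (\<Omega> \<inter> slice I)"
    using assms unfolding slice_domain_def by blast
  moreover have "continuous_on (\<Omega> \<inter> slice I) (\<lambda>q. Complex (q_re q) (q \<bullet> I))"
    unfolding Complex_eq by (intro continuous_intros)
  ultimately show ?thesis by (simp add: connected_continuous_image)
qed

lemma slice_domain_open: "slice_domain \<Omega> \<Longrightarrow> open \<Omega>"
  by (simp add: slice_domain_def)

lemma slice_domain_real_point:
  assumes "slice_domain \<Omega>" obtains r where "of_real r \<in> \<Omega>"
  using assms unfolding slice_domain_def by (auto elim: Reals_cases)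

text \<open>A path in the slice of \<open>I\<close> joins \<open>z0\<close> to a real point. Its
  image is compact, so a tube \<open>V\<close> around it stays in \<Omega> for all units near
  \<open>I\<close>, and the representation on \<open>V\<close> is anchored at the real
  point.\<close>

lemma stem_exists_near:
  assumes \<Omega>: "slice_domain \<Omega>" and f: "slice_regular_on \<Omega> f" and I: "I \<in> \<S>"
    and z0: "slice_pt I z0 \<in> \<Omega>"
  obtains V d G where "open V" "z0 \<in> V" "d > 0" "G cq_hol_on V"
    "\<And>J z. J \<in> \<S> \<Longrightarrow> dist J I < d \<Longrightarrow> z \<in> V \<Longrightarrow> f (slice_pt J z) = cq_eval J (G z)"
proof -
  have op: "open \<Omega>" using \<Omega> by (rule slice_domain_open)
  obtain r where r: "of_real r \<in> \<Omega>" using slice_domain_real_point[OF \<Omega>] by blast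
  define U where "U = slice_dom \<Omega> I"
  have "open U" "connected U"
    using op \<Omega> I by (simp_all add: U_def open_slice_dom connected_slice_dom)
  then have "path_connected U" by (simp add: connected_open_path_connected)
  moreover have "z0 \<in> U" "of_real r \<in> U" using z0 r by (simp_all add: U_def)
  ultimately obtain g where g: "path g" "path_image g \<subseteq> U" "pathstart g = z0" "pathfinish g = of_real r"
    unfolding path_connected_def by blast
  define K where "K = path_image g"
  have K: "compact K" "connected K" "z0 \<in> K" "of_real r \<in> K" "K \<subseteq> U"
    using g pathstart_in_path_image[of g] pathfinish_in_path_image[of g]
    by (auto simp: K_def compact_path_image connected_path_image)
  define W where "W = (\<lambda>p. slice_pt (fst p) (snd p)) -` \<Omega>"
  have "continuous_on UNIV (\<lambda>p. slice_pt (fst p) (snd p))" by (intro continuous_intros)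
  then have "open W" using op by (simp add: W_def continuous_on_open_vimage)
  moreover have "compact ({I} \<times> K)" using K(1) by (simp add: compact_Times)
  moreover have "{I} \<times> K \<subseteq> W" using K(5) by (auto simp: W_def U_def)
  ultimately obtain e where e: "e > 0" "(\<Union>p\<in>{I} \<times> K. ball p e) \<subseteq> W"
    using compact_subset_open_imp_ball_epsilon_subset by blast
  \<comment> \<open>Half of \<open>e\<close> is spent on the distance to the path, the other half on
    the distance between the units.\<close>
  define V where "V = (\<lambda>p. fst p + snd p) ` (K \<times> ball 0 (e/2))"
  have V: "V = (\<Union>x\<in>K. \<Union>y\<in>ball 0 (e/2). {x + y})" by (force simp: V_def)
  have "open V" unfolding V by (rule open_sums) simp
  moreover have "connected V"
    unfolding V_def
    by (intro connected_continuous_image continuous_intros connected_Times K(2)) auto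
  moreover have "of_real r \<in> V" "z0 \<in> V" using K e(1) by (force simp: V)+
  moreover define \<J> where "\<J> = {J \<in> \<S>. dist J I < e / 2}"
  moreover have "slice_pt J z \<in> \<Omega>" if "J \<in> \<J>" "z \<in> V" for J z
  proof -
    from that(2) obtain k w where k: "z = k + w" "k \<in> K" "norm w < e / 2" by (auto simp: V)
    have "dist (I, k) (J, z) \<le> dist I J + dist k z"
      unfolding dist_prod_def by (simp add: sqrt_sum_squares_le_sum)
    also have "\<dots> < e" using that(1) k by (auto simp: \<J>_def dist_commute dist_norm norm_minus_commute)
    finally have "(J, z) \<in> W" using e(2) k(2) by (auto simp: subset_iff)
    then show ?thesis by (simp add: W_def)
  qed
  moreover have "I \<in> \<J>" using I e(1) by (simp add: \<J>_def)
  moreover obtain I2 where "I2 \<in> \<J>" "I2 \<noteq> I"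
    using imag_units_not_isolated[OF I, of "e/2"] e(1) by (auto simp: \<J>_def)
  ultimately obtain G where "G cq_hol_on V" "\<forall>J\<in>\<J>. \<forall>z\<in>V. f (slice_pt J z) = cq_eval J (G z)"
    using slice_representation[OF f op, of V r \<J> I I2] by (auto simp: \<J>_def)
  with \<open>open V\<close> \<open>z0 \<in> V\<close> e(1) show ?thesis
    by (intro that[of V "e/2" G]) (auto simp: \<J>_def)
qed

lemma stem_holomorphic_near:
  assumes "slice_domain \<Omega>" "slice_regular_on \<Omega> f" "I \<in> \<S>" "slice_pt I z0 \<in> \<Omega>"
  obtains V where "open V" "z0 \<in> V" "stem f I cq_hol_on V"
    "\<And>z. z \<in> V \<Longrightarrow> stem_rep f I z (stem f I z)"
proof -
  obtain V d G where *: "open V" "z0 \<in> V" "d > 0" "G cq_hol_on V"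
    "\<And>J z. J \<in> \<S> \<Longrightarrow> dist J I < d \<Longrightarrow> z \<in> V \<Longrightarrow> f (slice_pt J z) = cq_eval J (G z)"
    using stem_exists_near[OF assms] by blast
  have rep: "stem_rep f I z (G z)" if "z \<in> V" for z
    unfolding stem_rep_def using * that by blast
  then have eq: "stem f I z = G z" if "z \<in> V" for z
    using stem_eqI[OF assms(3)] that by blast
  with *(4) have "stem f I cq_hol_on V"
    by (simp cong: cq_hol_cong)
  with * rep eq show ?thesis by (intro that[of V]) auto
qed

lemma stem_rep_stem:
  assumes "slice_domain \<Omega>" "slice_regular_on \<Omega> f" "I \<in> \<S>" "slice_pt I z \<in> \<Omega>"
  shows "stem_rep f I z (stem f I z)"
  using stem_holomorphic_near[OF assms] by blast

lemma stem_eval: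
  assumes "slice_domain \<Omega>" "slice_regular_on \<Omega> f" "I \<in> \<S>" "slice_pt I z \<in> \<Omega>"
  shows "f (slice_pt I z) = cq_eval I (stem f I z)"
  using stem_rep_eval[OF assms(3) stem_rep_stem[OF assms]] .

lemma cq_hol_on_local:
  assumes "open U" "\<And>z0. z0 \<in> U \<Longrightarrow> \<exists>V. open V \<and> z0 \<in> V \<and> F cq_hol_on V"
  shows "F cq_hol_on U"
proof -
  have *: "c holomorphic_on U"
    if "\<And>z0. z0 \<in> U \<Longrightarrow> \<exists>V. open V \<and> z0 \<in> V \<and> c holomorphic_on V" for c :: "complex \<Rightarrow> complex"
  proof (rule holomorphic_onI)
    fix z assume "z \<in> U"
    with that obtain V where "open V" "z \<in> V" "c holomorphic_on V" by blast
    then have "c field_differentiable at z"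
      by (simp add: holomorphic_on_imp_differentiable_at)
    then show "c field_differentiable at z within U"
      by (rule field_differentiable_at_within)
  qed
  show ?thesis
    unfolding cq_hol_on_def
    by (intro conjI *; use assms(2) in \<open>unfold cq_hol_on_def, blast\<close>)
qed

lemma stem_holomorphic:
  assumes "slice_domain \<Omega>" "slice_regular_on \<Omega> f" "I \<in> \<S>"
  shows "stem f I cq_hol_on slice_dom \<Omega> I"
proof (rule cq_hol_on_local)
  show "open (slice_dom \<Omega> I)" using assms(1) by (intro open_slice_dom slice_domain_open)
  fix z0 assume "z0 \<in> slice_dom \<Omega> I"
  then have "slice_pt I z0 \<in> \<Omega>" by simp
  from stem_holomorphic_near[OF assms this]
  show "\<exists>V. open V \<and> z0 \<in> V \<and> stem f I cq_hol_on V" by metis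
qed

lemma cullen_derivative_stem:
  assumes "slice_domain \<Omega>" "slice_regular_on \<Omega> f" "I \<in> \<S>" "slice_pt I z \<in> \<Omega>"
  shows "cullen_derivative f (slice_pt I z) = cq_eval I (cq_deriv (stem f I) z)"
  using cullen_derivative_eq[OF assms(2) slice_domain_open[OF assms(1)] assms(3,4)]
    slice_dx_dy_eq(1)[OF stem_holomorphic[OF assms(1-3)], where z = z and f = f]
    open_slice_dom[OF slice_domain_open[OF assms(1)]] assms(3,4) stem_eval[OF assms(1-3)]
  by simp

section \<open>Spherical value and derivative, and the star product, in terms of stems\<close>

lemma qsphere_eq: "qsphere x y = {slice_pt J (Complex x y) | J. J \<in> \<S>}"
  by (simp add: qsphere_def slice_pt_Complex)

lemma spherical_rep_unique:
  assumes p: "p \<notin> \<real>" and r: "spherical_rep \<Omega> f p b c" "spherical_rep \<Omega> f p b' c'"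
  shows "b = b' \<and> c = c'"
proof -
  obtain I z where I: "I \<in> \<S>" "Im z \<ge> 0" and pI: "p = slice_pt I z" by (rule slice_pt_cover)
  have "Im z \<noteq> 0" using p I slice_pt_in_Reals_iff pI by blast
  define y where "y = Im z"
  have y: "y > 0" "norm (q_im p) = y" "q_re p = Re z" "Complex (Re z) y = z"
    using I \<open>Im z \<noteq> 0\<close> by (simp_all add: y_def pI slice_pt_norm_q_im slice_pt_q_re del: slice_pt_sel)
  have near: "\<exists>e>0. \<forall>J\<in>\<S>. dist J I < e \<longrightarrow> f (slice_pt J z) = b + J * c"
    if "spherical_rep \<Omega> f p b c" for b c
  proof -
    from that obtain U where U: "openin (top_of_set (qsphere (Re z) y)) U" "p \<in> U"
      and f: "\<And>J. J \<in> \<S> \<Longrightarrow> slice_pt J z \<in> U \<Longrightarrow> f (slice_pt J z) = b + J * c"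
      unfolding spherical_rep_def y slice_pt_Complex[symmetric] by blast
    obtain T where T: "open T" "U = qsphere (Re z) y \<inter> T" using U(1) by (auto simp: openin_open)
    obtain e where e: "e > 0" "\<And>J. dist J I < e \<Longrightarrow> slice_pt J z \<in> T"
      using slice_pt_near_mem[OF T(1)] U(2) T(2) pI by blast
    have "slice_pt J z \<in> U" if "J \<in> \<S>" "dist J I < e" for J
      using that e(2) T(2) y(4) by (auto simp: qsphere_eq)
    with e(1) f show ?thesis by blast
  qed
  from near[OF r(1)] near[OF r(2)] obtain d e where
    d: "d > 0" "\<And>J. J \<in> \<S> \<Longrightarrow> dist J I < d \<Longrightarrow> f (slice_pt J z) = b + J * c"
    and e: "e > 0" "\<And>J. J \<in> \<S> \<Longrightarrow> dist J I < e \<Longrightarrow> f (slice_pt J z) = b' + J * c'"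
    by blast
  obtain J where J: "J \<in> \<S>" "dist J I < min d e" "J \<noteq> I"
    using imag_units_not_isolated[OF I(1), of "min d e"] d(1) e(1) by auto
  have "b + J * c = b' + J * c'" using d(2)[OF J(1)] e(2)[OF J(1)] J(2) by simp
  moreover have *: "b + I * c = b' + I * c'" using d(2)[OF I(1)] e(2)[OF I(1)] d(1) e(1) by simp
  ultimately have "(b + J * c) - (b + I * c) = (b' + J * c') - (b' + I * c')" by simp
  then have "(J - I) * (c - c') = 0" by (simp add: algebra_simps)
  with J(3) have "c = c'" by simp
  with * show ?thesis by simp
qed

text \<open>For \<open>Im z < 0\<close> the spherical data describe the same points with the
  absolute value of \<open>Im z\<close> and the opposite unit, hence the sign.\<close>

lemma stem_rep_imp_spherical_rep:
  assumes I: "I \<in> \<S>" and rep: "stem_rep f I z A" and \<Omega>: "open \<Omega>" "slice_pt I z \<in> \<Omega>"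
    and y: "Im z \<noteq> 0"
  shows "spherical_rep \<Omega> f (slice_pt I z) (cq_Re A) (sgn (Im z) *\<^sub>R cq_Im A)"
proof -
  obtain e where e: "e > 0" "\<And>J. J \<in> \<S> \<Longrightarrow> dist J I < e \<Longrightarrow> f (slice_pt J z) = cq_eval J A"
    using rep unfolding stem_rep_def by blast
  \<comment> \<open>Recovers the unit from a point of the sphere; by its continuity a neighborhood
    of \<open>I\<close> gives a neighborhood of the point.\<close>
  define N where "N q = (q - of_real (Re z)) /\<^sub>R Im z" for q :: quat
  have N: "N (slice_pt J z) = J" for J using y by (simp add: N_def slice_pt_def of_real_def)
  have pt: "of_real (Re z) + of_real \<bar>Im z\<bar> * J = slice_pt (sgn (Im z) *\<^sub>R J) z" for J
    using y by (simp add: slice_pt_def of_real_def sgn_if)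
  have sg: "sgn (Im z) *\<^sub>R J \<in> \<S>" if "J \<in> \<S>" for J
    using that y imag_units_uminus by (auto simp: sgn_if)
  define T where "T = \<Omega> \<inter> N -` ball I e"
  have "continuous_on UNIV N" unfolding N_def[abs_def] by (intro continuous_intros)
  then have "open (N -` ball I e)" by (simp add: continuous_on_open_vimage)
  then have "open T" using \<Omega>(1) by (auto simp: T_def)
  define S where "S = qsphere (Re z) \<bar>Im z\<bar>"
  have mem: "slice_pt I z \<in> S"
  proof -
    have "slice_pt I z = of_real (Re z) + of_real \<bar>Im z\<bar> * (sgn (Im z) *\<^sub>R I)"
      using y by (subst pt) (simp add: sgn_if)
    then show ?thesis using sg[OF I] unfolding S_def qsphere_def by blast
  qed
  show ?thesis
    unfolding spherical_rep_def slice_pt_norm_q_im[OF I] slice_pt_q_re[OF I] S_def[symmetric]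
  proof (intro exI[of _ "S \<inter> T"] conjI ballI impI)
    show "openin (top_of_set S) (S \<inter> T)" using \<open>open T\<close> by auto
    show "slice_pt I z \<in> S \<inter> T" using mem \<Omega>(2) e(1) by (simp add: T_def N)
    show "S \<inter> T \<subseteq> \<Omega>" by (auto simp: T_def)
    fix J assume J: "J \<in> \<S>" "of_real (Re z) + of_real \<bar>Im z\<bar> * J \<in> S \<inter> T"
    then have "dist (sgn (Im z) *\<^sub>R J) I < e" by (simp add: pt T_def N dist_commute)
    with e(2) sg[OF J(1)] have "f (slice_pt (sgn (Im z) *\<^sub>R J) z) = cq_eval (sgn (Im z) *\<^sub>R J) A"
      by blast
    then show "f (of_real (Re z) + of_real \<bar>Im z\<bar> * J) = cq_Re A + J * (sgn (Im z) *\<^sub>R cq_Im A)"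
      by (simp add: pt cq_eval_def)
  qed
qed

lemma spherical_value_derivative_eq:
  assumes "I \<in> \<S>" "stem_rep f I z A" "open \<Omega>" "slice_pt I z \<in> \<Omega>" "Im z \<noteq> 0"
  shows "spherical_value \<Omega> f (slice_pt I z) = cq_Re A"
    "spherical_derivative \<Omega> f (slice_pt I z) = cq_Im A /\<^sub>R Im z"
proof -
  have nr: "slice_pt I z \<notin> \<real>" using assms by (simp add: slice_pt_in_Reals_iff)
  note rep = stem_rep_imp_spherical_rep[OF assms]
  have "(THE b. \<exists>c. spherical_rep \<Omega> f (slice_pt I z) b c) = cq_Re A"
    using rep spherical_rep_unique[OF nr] by blast
  then show "spherical_value \<Omega> f (slice_pt I z) = cq_Re A"
    using nr by (simp add: spherical_value_def)
  have "(THE c. \<exists>b. spherical_rep \<Omega> f (slice_pt I z) b c) = sgn (Im z) *\<^sub>R cq_Im A"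
    using rep spherical_rep_unique[OF nr] by blast
  then show "spherical_derivative \<Omega> f (slice_pt I z) = cq_Im A /\<^sub>R Im z"
    using assms by (simp add: spherical_derivative_def slice_pt_norm_q_im sgn_if)
qed

lemma stem_rep_Re_eq_imp:
  assumes "I \<in> \<S>" "stem_rep f I z A" "Im z = 0"
  shows "A = cq_quat (f (slice_pt I z))"
proof -
  have "z = of_real (Re z)" using assms(3) by (simp add: complex_eq_iff)
  then show ?thesis
    using stem_rep_unique[OF assms(1,2)] stem_rep_of_real[of f I "Re z"] by (metis slice_pt_of_real)
qed

text \<open>At a non-real point the formula for \<open>star\<close> is the product of two elements b
  + \<i>c, evaluated at \<open>I\<close>; at a real point both stems are constants
  \<open>cq_quat\<close>, on which the product is that of quaternions.\<close>

lemma star_eval: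
  assumes I: "I \<in> \<S>" and f: "stem_rep f I z A" and g: "stem_rep g I z B"
    and \<Omega>: "open \<Omega>" "slice_pt I z \<in> \<Omega>"
  shows "star \<Omega> f g (slice_pt I z) = cq_eval I (A * B)"
proof (cases "Im z = 0")
  case True
  then have "slice_pt I z \<in> \<real>" using I by (simp add: slice_pt_in_Reals_iff)
  moreover have "A = cq_quat (f (slice_pt I z))" "B = cq_quat (g (slice_pt I z))"
    using stem_rep_Re_eq_imp[OF I f True] stem_rep_Re_eq_imp[OF I g True] .
  ultimately show ?thesis
    by (simp add: star_def) (metis cq_eval_arith(5) cq_quat_arith(5))
next
  case False
  then have nr: "slice_pt I z \<notin> \<real>" using I by (simp add: slice_pt_in_Reals_iff)
  define y where "y = Im z"
  have "q_im (slice_pt I z) = y *\<^sub>R I" using I by (simp add: slice_pt_q_im y_def of_real_def)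
  moreover from this have "(q_im (slice_pt I z))\<^sup>2 = - (y * y) *\<^sub>R 1"
    by (simp add: power2_eq_square imag_units_mult_self[OF I])
  ultimately show ?thesis
    using False spherical_value_derivative_eq[OF I f \<Omega> False] spherical_value_derivative_eq[OF I g \<Omega> False] nr
    by (simp add: star_def cq_eval_def cq_Re_Im_mult y_def[symmetric] algebra_simps)
qed

lemma stem_rep_star:
  assumes "stem_rep f I z A" "stem_rep g I z B" "open \<Omega>" "slice_pt I z \<in> \<Omega>"
  shows "stem_rep (star \<Omega> f g) I z (A * B)"
proof -
  obtain d1 where d1: "d1 > 0" "\<forall>J\<in>\<S>. dist J I < d1 \<longrightarrow> stem_rep f J z A"
    using stem_rep_near[OF assms(1)] by blast
  obtain d2 where d2: "d2 > 0" "\<forall>J\<in>\<S>. dist J I < d2 \<longrightarrow> stem_rep g J z B"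
    using stem_rep_near[OF assms(2)] by blast
  obtain d3 where d3: "d3 > 0" "\<And>J. dist J I < d3 \<Longrightarrow> slice_pt J z \<in> \<Omega>"
    using slice_pt_near_mem[OF assms(3,4)] by blast
  have "star \<Omega> f g (slice_pt J z) = cq_eval J (A * B)"
    if "J \<in> \<S>" "dist J I < min d1 (min d2 d3)" for J
    using that d1(2) d2(2) d3(2) by (intro star_eval assms(3)) auto
  then show ?thesis
    unfolding stem_rep_def using d1(1) d2(1) d3(1) by (intro exI[of _ "min d1 (min d2 d3)"]) auto
qed

lemma slice_regular_on_star:
  assumes \<Omega>: "slice_domain \<Omega>" and f: "slice_regular_on \<Omega> f" and g: "slice_regular_on \<Omega> g"
  shows "slice_regular_on \<Omega> (star \<Omega> f g)"
proof (rule slice_regular_onI)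
  show op: "open \<Omega>" using \<Omega> by (rule slice_domain_open)
  fix I assume I: "I \<in> \<S>"
  show "\<exists>G. G cq_hol_on slice_dom \<Omega> I \<and>
      (\<forall>z. slice_pt I z \<in> \<Omega> \<longrightarrow> star \<Omega> f g (slice_pt I z) = cq_eval I (G z))"
  proof (intro exI conjI allI impI)
    show "(\<lambda>z. stem f I z * stem g I z) cq_hol_on slice_dom \<Omega> I"
      by (intro cq_hol_mult stem_holomorphic assms I)
    fix z assume z: "slice_pt I z \<in> \<Omega>"
    show "star \<Omega> f g (slice_pt I z) = cq_eval I (stem f I z * stem g I z)"
      by (intro star_eval I op z stem_rep_stem[OF \<Omega>] f g)
  qed
qed

text \<open>At a non-real point the value is \<open>slice_pt I (cq_nrm A)\<close>; at a real point
  it is the squared norm of the value of \<open>f\<close>, and \<open>A\<close> is that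
  value.\<close>

lemma normal_fun_eq_0_iff:
  assumes I: "I \<in> \<S>" and f: "stem_rep f I z A" and \<Omega>: "open \<Omega>" "slice_pt I z \<in> \<Omega>"
  shows "normal_fun \<Omega> f (slice_pt I z) = 0 \<longleftrightarrow> cq_nrm A = 0"
proof (cases "Im z = 0")
  case True
  then have "slice_pt I z \<in> \<real>" using I by (simp add: slice_pt_in_Reals_iff)
  moreover have "A = cq_quat (f (slice_pt I z))"
    using stem_rep_Re_eq_imp[OF I f True] .
  ultimately show ?thesis
    by (metis cq_nrm_quat_eq_0 normal_fun_def norm_eq_zero of_real_eq_0_iff power_eq_0_iff zero_less_numeral)
next
  case False
  then have nr: "slice_pt I z \<notin> \<real>" using I by (simp add: slice_pt_in_Reals_iff)
  define y where "y = Im z"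
  have im: "q_im (slice_pt I z) = y *\<^sub>R I" using I by (simp add: slice_pt_q_im y_def of_real_def)
  have "norm (y *\<^sub>R I * (cq_Im A /\<^sub>R y)) = norm (cq_Im A)"
    using False by (simp add: y_def norm_mult norm_imag_units[OF I])
  moreover have "q_re (cq_Re A * q_cnj (cq_Im A /\<^sub>R y)) = (cq_Re A \<bullet> cq_Im A) / y"
    using False by (simp add: y_def inner_quat_def field_simps)
  ultimately have "normal_fun \<Omega> f (slice_pt I z) =
     of_real ((norm (cq_Re A))\<^sup>2 - (norm (cq_Im A))\<^sup>2) + 2 * (y *\<^sub>R I) * of_real ((cq_Re A \<bullet> cq_Im A) / y)"
    using spherical_value_derivative_eq[OF I f \<Omega> False] nr
    by (simp add: normal_fun_def im y_def)
  also have "2 * (y *\<^sub>R I) * of_real ((cq_Re A \<bullet> cq_Im A) / y) = of_real (2 * (cq_Re A \<bullet> cq_Im A)) * I"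
  proof -
    have "c *\<^sub>R (2 * I) = (2 * c) *\<^sub>R I" for c :: real
      by (simp only: mult_2 scaleR_add_right scaleR_add_left)
    then show ?thesis using False by (simp add: y_def of_real_def)
  qed
  also have "of_real ((norm (cq_Re A))\<^sup>2 - (norm (cq_Im A))\<^sup>2) + \<dots> = slice_pt I (cq_nrm A)"
    unfolding cq_nrm_eq_Complex slice_pt_Complex ..
  finally show ?thesis by (simp add: slice_pt_eq_0_iff[OF I])
qed

section \<open>Division\<close>

text \<open>At a zero of \<pi> numerator and denominator are both divisible by the linear polynomial
  of that zero, and the quotient of their difference quotients is holomorphic there. Its value is
  that of l'Hospital's rule, stated explicitly so that it can be matched between slices.\<close>

lemma holomorphic_divide_simple_zeros:
  assumes U: "open U" and c: "c holomorphic_on U" and \<pi>: "\<pi> holomorphic_on U"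
    and z: "\<And>z. z \<in> U \<Longrightarrow> \<pi> z = 0 \<Longrightarrow> deriv \<pi> z \<noteq> 0 \<and> c z = 0"
  shows "(\<lambda>z. if \<pi> z = 0 then inverse (deriv \<pi> z) * deriv c z else inverse (\<pi> z) * c z) holomorphic_on U"
    (is "?m holomorphic_on U")
proof (rule holomorphic_onI)
  fix z0 assume z0: "z0 \<in> U"
  define quot where "quot g z = (if z = z0 then deriv g z0 else (g z - g z0) / (z - z0))" for g :: "complex \<Rightarrow> complex" and z
  have quot: "quot g holomorphic_on U" if "g holomorphic_on U" for g
    using pole_lemma_open[OF that U, of z0] by (simp add: quot_def[abs_def])
  have "\<exists>V F. open V \<and> z0 \<in> V \<and> F holomorphic_on V \<and> (\<forall>z\<in>V. F z = ?m z)"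
  proof (cases "\<pi> z0 = 0")
    case False
    define V where "V = {z\<in>U. \<pi> z \<noteq> 0}"
    have "open V"
      unfolding V_def using continuous_open_preimage[OF holomorphic_on_imp_continuous_on[OF \<pi>] U, of "- {0}"]
      by (simp add: vimage_def Int_def open_Compl)
    moreover have "(\<lambda>z. inverse (\<pi> z) * c z) holomorphic_on V"
      using c \<pi> by (intro holomorphic_intros) (auto simp: V_def intro: holomorphic_on_subset)
    ultimately show ?thesis using z0 False by (intro exI[of _ V] exI) (auto simp: V_def)
  next
    case True
    define V where "V = {z\<in>U. quot \<pi> z \<noteq> 0}"
    have "open V"
      unfolding V_def using continuous_open_preimage[OF holomorphic_on_imp_continuous_on[OF quot[OF \<pi>]] U, of "- {0}"]
      by (simp add: vimage_def Int_def open_Compl)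
    moreover have "(\<lambda>z. inverse (quot \<pi> z) * quot c z) holomorphic_on V"
      using quot[OF c] quot[OF \<pi>] by (intro holomorphic_intros) (auto simp: V_def intro: holomorphic_on_subset)
    moreover have "z0 \<in> V" using z0 z[OF z0 True] by (simp add: V_def quot_def)
    moreover have "inverse (quot \<pi> z) * quot c z = ?m z" if "z \<in> V" for z
      using that z[OF z0 True] True by (auto simp: V_def quot_def field_simps)
    ultimately show ?thesis by (intro exI[of _ V] exI) auto
  qed
  then obtain V F where V: "open V" "z0 \<in> V" "F holomorphic_on V" "\<And>z. z \<in> V \<Longrightarrow> F z = ?m z" by blast
  have "?m holomorphic_on V" by (rule holomorphic_transform[OF V(3)]) (rule V(4))
  then have "?m field_differentiable at z0"
    using V holomorphic_on_imp_differentiable_at by blast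
  then show "?m field_differentiable at z0 within U" by (rule field_differentiable_at_within)
qed

lemma slice_regular_on_subset:
  assumes "slice_regular_on \<Omega> f" "\<Lambda> \<subseteq> \<Omega>" shows "slice_regular_on \<Lambda> f"
proof -
  have "{(x, y). of_real x + of_real y * I \<in> \<Lambda>} \<subseteq> {(x, y). of_real x + of_real y * I \<in> \<Omega>}" for I
    using assms(2) by blast
  then show ?thesis
    using assms unfolding slice_regular_on_def by (meson continuous_on_subset subsetD)
qed

lemma slice_pt_inverse: "J \<in> \<S> \<Longrightarrow> slice_pt J (inverse z) = inverse (slice_pt J z)"
proof (cases "z = 0")
  case False
  assume J: "J \<in> \<S>"
  have "slice_pt J (inverse z) * slice_pt J z = 1"
    using False by (simp add: slice_pt_mult[OF J, symmetric]) (simp add: slice_pt_def)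
  then show ?thesis by (metis inverse_unique inverse_inverse_eq)
qed (simp add: slice_pt_def)

text \<open>The quotients on the slices have to be values of a single function \<open>g\<close>. At
  zeros of \<open>P\<close> this holds because the value is formed with the Cullen derivative, which
  does not depend on the slice through the point.\<close>

lemma slice_regular_divide:
  assumes \<Omega>: "open \<Omega>" and k: "slice_regular_on \<Omega> k"
    and \<pi>: "\<pi> holomorphic_on UNIV" "\<And>z. \<pi> z = 0 \<Longrightarrow> deriv \<pi> z \<noteq> 0"
    and P: "\<And>J z. J \<in> \<S> \<Longrightarrow> P (slice_pt J z) = slice_pt J (\<pi> z)"
    and P': "\<And>J z. J \<in> \<S> \<Longrightarrow> P' (slice_pt J z) = slice_pt J (deriv \<pi> z)"
    and zero: "\<And>q. q \<in> \<Omega> \<Longrightarrow> P q = 0 \<Longrightarrow> k q = 0"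
  shows "\<exists>g. slice_regular_on \<Omega> g \<and> (\<forall>q\<in>\<Omega>. k q = P q * g q)"
proof (intro exI conjI ballI)
  define g where "g q = (if P q = 0 then inverse (P' q) * cullen_derivative k q
      else inverse (P q) * k q)" for q
  show "k q = P q * g q" if "q \<in> \<Omega>" for q
    using zero[OF that] by (simp add: g_def mult.assoc[symmetric])
  show "slice_regular_on \<Omega> g"
  proof (rule slice_regular_onI[OF \<Omega>])
    fix I assume I: "I \<in> \<S>"
    define U where "U = slice_dom \<Omega> I"
    have U: "open U" using \<Omega> by (simp add: U_def open_slice_dom)
    \<comment> \<open>The lift vanishes wherever \<open>k\<close> does, as division in each
      component requires; a stem of \<open>k\<close> may be nonzero at a zero of
      \<open>k\<close>.\<close>
    define L where "L z = cq_lift I (k (slice_pt I z))" for z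
    have L: "L cq_hol_on U"
      using slice_regular_on_lift_holomorphic[OF k \<Omega> I] by (simp add: L_def[abs_def] U_def)
    have kL: "k (slice_pt I z) = cq_eval I (L z)" for z by (simp add: L_def cq_eval_lift[OF I])
    have \<pi>0: "\<pi> z = 0 \<longleftrightarrow> P (slice_pt I z) = 0" for z
      by (simp add: P[OF I] slice_pt_eq_0_iff[OF I])
    have L0: "L z = 0" if "z \<in> U" "\<pi> z = 0" for z
      using zero that by (simp add: L_def U_def \<pi>0 cq_lift_eq_0_iff[OF I])
    define M where "M z = (if \<pi> z = 0 then cq_cplx (inverse (deriv \<pi> z)) * cq_deriv L z
      else cq_cplx (inverse (\<pi> z)) * L z)" for z
    have M_sel: "cq_re (M z) = (if \<pi> z = 0 then inverse (deriv \<pi> z) * deriv (\<lambda>z. cq_re (L z)) z else inverse (\<pi> z) * cq_re (L z))"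
      "cq_i (M z) = (if \<pi> z = 0 then inverse (deriv \<pi> z) * deriv (\<lambda>z. cq_i (L z)) z else inverse (\<pi> z) * cq_i (L z))"
      "cq_j (M z) = (if \<pi> z = 0 then inverse (deriv \<pi> z) * deriv (\<lambda>z. cq_j (L z)) z else inverse (\<pi> z) * cq_j (L z))"
      "cq_k (M z) = (if \<pi> z = 0 then inverse (deriv \<pi> z) * deriv (\<lambda>z. cq_k (L z)) z else inverse (\<pi> z) * cq_k (L z))" for z
      by (simp_all add: M_def)
    have "\<pi> holomorphic_on U" using \<pi>(1) holomorphic_on_subset by blast
    note div = holomorphic_divide_simple_zeros[OF U _ this]
    have "M cq_hol_on U"
      unfolding cq_hol_on_def M_sel
      using L \<pi>(2) L0 by (intro conjI div) (simp_all add: cq_hol_on_def)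
    moreover have "g (slice_pt I z) = cq_eval I (M z)" if "slice_pt I z \<in> \<Omega>" for z
    proof -
      have "cullen_derivative k (slice_pt I z) = cq_eval I (cq_deriv L z)"
        using cullen_derivative_eq[OF k \<Omega> I that] slice_dx_dy_eq(1)[OF L U _ I, where f = k] kL that
        by (simp add: U_def)
      then show ?thesis
        by (simp add: g_def M_def P[OF I] P'[OF I] slice_pt_eq_0_iff[OF I] cq_eval_cplx_mult[OF I]
            slice_pt_inverse[OF I] kL)
    qed
    ultimately show "\<exists>G. G cq_hol_on slice_dom \<Omega> I \<and>
        (\<forall>z. slice_pt I z \<in> \<Omega> \<longrightarrow> g (slice_pt I z) = cq_eval I (G z))"
      unfolding U_def by blast
  qed
qed

text \<open>Both the restriction of the sphere polynomial to a slice and the norm of any linear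
  factor whose root lies on the sphere of \<open>z0\<close>.\<close>

definition quad :: "complex \<Rightarrow> complex \<Rightarrow> complex" where
  "quad z0 z = (z - of_real (Re z0))\<^sup>2 + (of_real (Im z0))\<^sup>2"

lemma quad_factor: "quad z0 z = (z - z0) * (z - cnj z0)"
proof -
  have z0: "z0 = of_real (Re z0) + \<i> * of_real (Im z0)" "cnj z0 = of_real (Re z0) - \<i> * of_real (Im z0)"
    by (simp_all add: complex_eq_iff)
  have "(z - (a + \<i> * b)) * (z - (a - \<i> * b)) = (z - a)\<^sup>2 + b\<^sup>2" for a b :: complex
    by (simp add: power2_eq_square algebra_simps)
  with z0 show ?thesis by (metis quad_def)
qed

lemma quad_eq_0_iff: "quad z0 z = 0 \<longleftrightarrow> z = z0 \<or> z = cnj z0"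
  by (simp add: quad_factor)

lemma quad_self [simp]: "quad z0 z0 = 0"
  by (simp add: quad_eq_0_iff)

lemma quad_holomorphic: "quad z0 holomorphic_on U"
  unfolding quad_def[abs_def] by (intro holomorphic_intros)

lemma cq_hol_cancel:
  assumes "F cq_hol_on U" "G cq_hol_on U" "open U" "z \<in> U"
    and eq: "\<And>z. z \<in> U \<Longrightarrow>
      cq_cplx (quad z0 z ^ m) * F z = cq_cplx (quad z0 z ^ m) * G z"
  shows "F z = G z"
proof (rule cq_hol_eqI)
  \<comment> \<open>Deletes the zeros of \<open>quad z0\<close> other than \<open>z\<close>, so that
    the factor is invertible off \<open>z\<close> and continuity settles the value at
    \<open>z\<close>.\<close>
  define V where "V = U - ({z0, cnj z0} - {z})"
  show "F cq_hol_on V" "G cq_hol_on V"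
    using assms(1,2) by (auto intro: cq_hol_on_subset simp: V_def)
  show "open V" using assms(3) unfolding V_def by (intro open_Diff finite_imp_closed) auto
  show "z \<in> V" using assms(4) by (simp add: V_def)
  show "F w = G w" if "w \<in> V" "w \<noteq> z" for w
  proof -
    have "quad z0 w ^ m \<noteq> 0" using that by (auto simp: V_def quad_eq_0_iff)
    then show ?thesis using eq[of w] that(1) cq_cplx_mult_cancel by (auto simp: V_def)
  qed
qed

lemma slice_pt_power: "J \<in> \<S> \<Longrightarrow> slice_pt J (z ^ n) = slice_pt J z ^ n"
  by (induction n) (simp_all add: slice_pt_mult, simp add: slice_pt_def)

abbreviation sphere_poly :: "complex \<Rightarrow> nat \<Rightarrow> quat \<Rightarrow> quat" where
  "sphere_poly z0 \<equiv> sphere_poly_power (Re z0) (Im z0)"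

lemma sphere_poly_power_slice_pt:
  assumes "J \<in> \<S>"
  shows "sphere_poly z0 m (slice_pt J z) = slice_pt J (quad z0 z ^ m)"
  by (simp add: sphere_poly_power_def slice_pt_power[OF assms] quad_def slice_pt_add
      slice_pt_diff power2_eq_square slice_pt_mult[OF assms])

lemma sphere_poly_zero_cases:
  assumes "sphere_poly z0 1 q = 0"
  obtains J where "J \<in> \<S>" "q = slice_pt J z0"
proof -
  obtain J z where J: "J \<in> \<S>" "q = slice_pt J z" by (rule slice_pt_cover)
  then have "quad z0 z = 0"
    using assms sphere_poly_power_slice_pt[OF J(1), of z0 1 z] by (simp add: slice_pt_eq_0_iff)
  then have "z = z0 \<or> z = cnj z0" by (simp add: quad_eq_0_iff)
  then show ?thesis
  proof
    assume "z = cnj z0"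
    then have "q = slice_pt (- J) z0" using J(2) slice_pt_uminus_cnj[of "J" z] slice_pt_uminus_cnj[of "-J" z0] by simp
    then show ?thesis using J(1) imag_units_uminus that by blast
  qed (use J that in blast)
qed

text \<open>As \<open>z0\<close> is not real, the zeros \<open>z0\<close> and \<open>cnj z0\<close>
  of \<open>quad z0\<close> are distinct, hence simple.\<close>

lemma slice_regular_divide_sphere:
  assumes \<Omega>: "open \<Omega>" and k: "slice_regular_on \<Omega> k" and z0: "Im z0 \<noteq> 0"
    and zero: "\<And>J. J \<in> \<S> \<Longrightarrow> slice_pt J z0 \<in> \<Omega> \<Longrightarrow> k (slice_pt J z0) = 0"
  shows "\<exists>g. slice_regular_on \<Omega> g \<and> (\<forall>q\<in>\<Omega>. k q = sphere_poly z0 1 q * g q)"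
proof (rule slice_regular_divide[OF \<Omega> k quad_holomorphic])
  have D: "deriv (quad z0) z = 2 * (z - of_real (Re z0))" for z
    unfolding quad_def[abs_def]
    by (rule DERIV_imp_deriv) (auto intro!: derivative_eq_intros)
  have z0': "z0 \<noteq> of_real (Re z0)" "cnj z0 \<noteq> of_real (Re z0)"
    using z0 by (auto simp: complex_eq_iff)
  show "deriv (quad z0) z \<noteq> 0" if "quad z0 z = 0" for z
    using that z0' by (auto simp: D quad_eq_0_iff)
  show "sphere_poly z0 1 (slice_pt J z) = slice_pt J (quad z0 z)"
    if "J \<in> \<S>" for J z
    using sphere_poly_power_slice_pt[OF that, of z0 1 z] by simp
  show "2 * (slice_pt J z - of_real (Re z0)) = slice_pt J (deriv (quad z0) z)"
    if "J \<in> \<S>" for J z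
    by (simp only: D mult_2 slice_pt_add slice_pt_diff slice_pt_of_real)
  show "k q = 0" if "q \<in> \<Omega>" "sphere_poly z0 1 q = 0" for q
    using sphere_poly_zero_cases[OF that(2)] zero that(1) by metis
qed

lemma stem_rep_cplx_mult:
  assumes "\<And>J z. J \<in> \<S> \<Longrightarrow> P (slice_pt J z) = slice_pt J (\<pi> z)" "stem_rep g I z B"
  shows "stem_rep (\<lambda>q. P q * g q) I z (cq_cplx (\<pi> z) * B)"
  using assms unfolding stem_rep_def by (auto simp: cq_eval_cplx_mult)

lemma stem_rep_sphere_poly:
  "stem_rep (sphere_poly z0 m) I z (cq_cplx (quad z0 z ^ m))"
  by (rule stem_repI) (simp add: sphere_poly_power_slice_pt cq_eval_cplx)

text \<open>A stem depends on the function only near the point, so factorizations on different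
  \<Lambda> can be compared through their stems at common points.\<close>

lemma stem_eq_mult:
  assumes \<Lambda>: "slice_domain \<Lambda>" and g: "slice_regular_on \<Lambda> g" and J: "J \<in> \<S>"
    and h: "\<And>q. q \<in> \<Lambda> \<Longrightarrow> h q = star \<Lambda> P g q"
    and P: "stem_rep P J z A" and z: "slice_pt J z \<in> \<Lambda>"
  shows "stem h J z = A * stem g J z"
proof -
  have op: "open \<Lambda>" using \<Lambda> by (rule slice_domain_open)
  have "stem_rep (star \<Lambda> P g) J z (A * stem g J z)"
    by (intro stem_rep_star P stem_rep_stem[OF \<Lambda> g J z] op z)
  then have "stem_rep h J z (A * stem g J z)"
    by (rule stem_rep_cong_on[OF _ op z]) (simp add: h)
  then show ?thesis by (rule stem_eqI[OF J])
qed

lemma star_eqI: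
  assumes \<Lambda>: "slice_domain \<Lambda>" and g: "slice_regular_on \<Lambda> g" "slice_regular_on \<Lambda> h"
    and P: "\<And>J z. J \<in> \<S> \<Longrightarrow> slice_pt J z \<in> \<Lambda> \<Longrightarrow> stem_rep P J z (A J z)"
    and eq: "\<And>J z. J \<in> \<S> \<Longrightarrow> slice_pt J z \<in> \<Lambda> \<Longrightarrow> stem h J z = A J z * stem g J z"
    and q: "q \<in> \<Lambda>"
  shows "h q = star \<Lambda> P g q"
proof -
  obtain J z where J: "J \<in> \<S>" "q = slice_pt J z" by (rule slice_pt_cover)
  have z: "slice_pt J z \<in> \<Lambda>" using q J by simp
  have "star \<Lambda> P g q = cq_eval J (A J z * stem g J z)"
    unfolding J(2)
    by (intro star_eval J P z stem_rep_stem[OF \<Lambda> g(1)] slice_domain_open[OF \<Lambda>])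
  also have "\<dots> = h q"
    using eq[OF J(1) z] stem_eval[OF \<Lambda> g(2) J(1) z] J(2) by simp
  finally show ?thesis ..
qed

lemma slice_regular_on_linear: "open \<Omega> \<Longrightarrow> slice_regular_on \<Omega> (\<lambda>q. q - a)"
  by (rule slice_regular_onI)
    (use cq_hol_linear in \<open>auto simp: cq_linear_def cq_eval_arith cq_eval_cplx
      intro!: exI[of _ "cq_linear a"]\<close>)

lemma slice_regular_on_sphere_poly:
  assumes "open \<Omega>" shows "slice_regular_on \<Omega> (sphere_poly z0 m)"
proof (rule slice_regular_onI[OF assms])
  fix I assume I: "I \<in> \<S>"
  have "(\<lambda>z. cq_cplx (quad z0 z ^ m)) cq_hol_on slice_dom \<Omega> I"
    by (intro cq_hol_cplx holomorphic_intros quad_holomorphic)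
  then show "\<exists>G. G cq_hol_on slice_dom \<Omega> I \<and>
    (\<forall>z. slice_pt I z \<in> \<Omega> \<longrightarrow> sphere_poly z0 m (slice_pt I z) = cq_eval I (G z))"
    by (auto simp: sphere_poly_power_slice_pt[OF I] cq_eval_cplx intro!: exI)
qed

text \<open>\<open>(q - p) * g = h\<close> is solved by dividing \<open>(q - cnj p) * h\<close>, which vanishes on the whole sphere
  of \<open>p\<close>, by \<open>(q - p) * (q - cnj p)\<close>.\<close>

lemma slice_regular_divide_linear_nonreal:
  assumes \<Lambda>: "slice_domain \<Lambda>" and h: "slice_regular_on \<Lambda> h" and K: "K \<in> \<S>"
    and z0: "Im z0 \<noteq> 0"
    and zero: "\<And>J. J \<in> \<S> \<Longrightarrow> slice_pt J z0 \<in> \<Lambda> \<Longrightarrow> cq_eval K (stem h J z0) = 0"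
  shows "\<exists>g. slice_regular_on \<Lambda> g \<and> (\<forall>q\<in>\<Lambda>. h q = star \<Lambda> (\<lambda>q. q - slice_pt K z0) g q)"
proof -
  define p where "p = slice_pt K z0"
  define k where "k = star \<Lambda> (\<lambda>q. q - q_cnj p) h"
  have op: "open \<Lambda>" using \<Lambda> by (rule slice_domain_open)
  have k: "slice_regular_on \<Lambda> k"
    unfolding k_def by (intro slice_regular_on_star \<Lambda> h slice_regular_on_linear op)
  have stem_k: "stem k J z = cq_linear (q_cnj p) z * stem h J z"
    if "J \<in> \<S>" "slice_pt J z \<in> \<Lambda>" for J z
    by (rule stem_eq_mult[OF \<Lambda> h that(1) _ stem_rep_linear that(2)]) (simp add: k_def)
  have "k (slice_pt J z0) = 0" if "J \<in> \<S>" "slice_pt J z0 \<in> \<Lambda>" for J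
    using stem_eval[OF \<Lambda> k that] stem_k[OF that] zero[OF that]
      cq_linear_cnj_mult_eq_0_iff[OF K z0, of "stem h J z0"]
    by (simp add: p_def cq_eval_arith)
  from slice_regular_divide_sphere[OF op k z0 this]
  obtain g where g: "slice_regular_on \<Lambda> g"
    and kg: "\<And>q. q \<in> \<Lambda> \<Longrightarrow> k q = sphere_poly z0 1 q * g q" by blast
  have stem_kg: "stem k J z = cq_cplx (quad z0 z) * stem g J z"
    if "J \<in> \<S>" "slice_pt J z \<in> \<Lambda>" for J z
  proof -
    have "stem_rep (\<lambda>q. sphere_poly z0 1 q * g q) J z
        (cq_cplx (quad z0 z ^ 1) * stem g J z)"
      by (intro stem_rep_cplx_mult sphere_poly_power_slice_pt stem_rep_stem[OF \<Lambda> g that])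
    then have "stem_rep k J z (cq_cplx (quad z0 z ^ 1) * stem g J z)"
      using stem_rep_cong_on[OF _ op that(2)] kg by fastforce
    then show ?thesis using stem_eqI[OF that(1)] by simp
  qed
  \<comment> \<open>Multiplying the stem of \<open>k\<close> by the linear factor of
    \<open>p\<close> makes the central factor \<open>quad z0\<close> appear on both sides, ready to
    be cancelled.\<close>
  have mult: "cq_cplx (quad z0 z ^ 1) * stem h J z
      = cq_cplx (quad z0 z ^ 1) * (cq_linear p z * stem g J z)"
    if "J \<in> \<S>" "z \<in> slice_dom \<Lambda> J" for J z
  proof -
    have "cq_cplx (quad z0 z) * stem h J z = cq_linear p z * stem k J z"
      using stem_k[of J z] that cq_linear_mult_cnj(1)[of p z] cq_nrm_linear[OF K, of z0 z]
      by (simp add: quad_def p_def mult.assoc[symmetric])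
    then show ?thesis using stem_kg[of J z] that by (simp add: cq_cplx_left_commute)
  qed
  have "stem h J z = cq_linear p z * stem g J z"
    if J: "J \<in> \<S>" and z: "slice_pt J z \<in> \<Lambda>" for J z
    by (rule cq_hol_cancel[where U = "slice_dom \<Lambda> J", OF _ _ _ _ mult[OF J]])
      (use z op in \<open>auto intro: stem_holomorphic[OF \<Lambda>] h g J cq_hol_mult
        cq_hol_linear open_slice_dom\<close>)
  then have "h q = star \<Lambda> (\<lambda>q. q - p) g q" if "q \<in> \<Lambda>" for q
    using star_eqI[OF \<Lambda> g h stem_rep_linear _ that, of p] by blast
  with g show ?thesis unfolding p_def by blast
qed

lemma slice_regular_divide_linear_real:
  assumes \<Lambda>: "slice_domain \<Lambda>" and h: "slice_regular_on \<Lambda> h"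
    and zero: "of_real x \<in> \<Lambda> \<Longrightarrow> h (of_real x) = 0"
  shows "\<exists>g. slice_regular_on \<Lambda> g \<and> (\<forall>q\<in>\<Lambda>. h q = (q - of_real x) * g q)"
proof (rule slice_regular_divide[where \<pi> = "\<lambda>z. z - of_real x" and P' = "\<lambda>q. 1"])
  have D: "deriv (\<lambda>z. z - of_real x) z = 1" for z :: complex
    by (rule DERIV_imp_deriv) (auto intro!: derivative_eq_intros)
  show "open \<Lambda>" using \<Lambda> by (rule slice_domain_open)
  show "(\<lambda>z. z - complex_of_real x) holomorphic_on UNIV" by (intro holomorphic_intros)
  show "deriv (\<lambda>z. z - complex_of_real x) z \<noteq> 0" for z by (simp add: D)
  show "(1 :: quat) = slice_pt J (deriv (\<lambda>z. z - complex_of_real x) z)" for J z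
    unfolding D by (simp add: slice_pt_def)
  show "h q = 0" if "q \<in> \<Lambda>" "q - of_real x = 0" for q using that zero by simp
qed (simp_all add: h slice_pt_diff)

lemma star_slice_preserving:
  assumes \<Lambda>: "slice_domain \<Lambda>" and g: "slice_regular_on \<Lambda> g" and q: "q \<in> \<Lambda>"
    and P: "\<And>J z. J \<in> \<S> \<Longrightarrow> P (slice_pt J z) = slice_pt J (\<pi> z)"
  shows "star \<Lambda> P g q = P q * g q"
proof -
  obtain J z where J: "J \<in> \<S>" "q = slice_pt J z" by (rule slice_pt_cover)
  have z: "slice_pt J z \<in> \<Lambda>" using q J by simp
  have "stem_rep P J z (cq_cplx (\<pi> z))" by (rule stem_repI) (simp add: P cq_eval_cplx)
  then have "star \<Lambda> P g q = cq_eval J (cq_cplx (\<pi> z) * stem g J z)"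
    unfolding J(2) by (intro star_eval J z stem_rep_stem[OF \<Lambda> g] slice_domain_open[OF \<Lambda>])
  then show ?thesis
    using stem_eval[OF \<Lambda> g J(1) z] J by (simp add: cq_eval_cplx_mult P)
qed

lemma star_linear_real:
  assumes "slice_domain \<Lambda>" "slice_regular_on \<Lambda> g" "q \<in> \<Lambda>"
  shows "star \<Lambda> (\<lambda>q. q - of_real x) g q = (q - of_real x) * g q"
  by (rule star_slice_preserving[OF assms, where \<pi> = "\<lambda>z. z - of_real x"]) (simp add: slice_pt_diff)

text \<open>\<Lambda> may meet the sphere in several components with different stems at
  \<open>z0\<close>; evaluation at one and the same \<open>K\<close> has to annihilate all of them.
  The root \<open>slice_pt K z0\<close> itself may lie outside \<Lambda>.\<close>

lemma slice_regular_divide_linear: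
  assumes \<Lambda>: "slice_domain \<Lambda>" and h: "slice_regular_on \<Lambda> h" and K: "K \<in> \<S>"
    and zero: "\<And>J. J \<in> \<S> \<Longrightarrow> slice_pt J z0 \<in> \<Lambda> \<Longrightarrow> cq_eval K (stem h J z0) = 0"
  shows "\<exists>g. slice_regular_on \<Lambda> g \<and> (\<forall>q\<in>\<Lambda>. h q = star \<Lambda> (\<lambda>q. q - slice_pt K z0) g q)"
proof (cases "Im z0 = 0")
  case True
  then have z0: "z0 = of_real (Re z0)" by (simp add: complex_eq_iff)
  have pt: "slice_pt K z0 = of_real (Re z0)" by (subst z0) simp
  have "h (of_real (Re z0)) = 0" if "of_real (Re z0) \<in> \<Lambda>"
    using zero[OF K] stem_eval[OF \<Lambda> h K, of z0] that by (simp add: pt)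
  then show ?thesis
    using slice_regular_divide_linear_real[OF \<Lambda> h] star_linear_real[OF \<Lambda>] unfolding pt by metis
next
  case False
  then show ?thesis using slice_regular_divide_linear_nonreal[OF \<Lambda> h K] zero by blast
qed

section \<open>Left factors of a divisor\<close>

lemma stem_rep_star_power:
  "I \<in> \<S> \<Longrightarrow> stem_rep (linear_star_power p k) I z (cq_linear p z ^ k)"
proof (induction k)
  case 0
  show ?case by (rule stem_repI) (simp add: cq_eval_arith)
next
  case (Suc k)
  then show ?case
    by (auto intro!: stem_rep_star stem_rep_linear)
qed

text \<open>On stems, \<open>P\<close> is the product of \<open>P1\<close> and \<open>P2\<close>,
  and the factor \<open>P2\<close> is moved into the quotient.\<close>

lemma divides_near_mult_imp:
  assumes "divides_near \<Omega> C P h"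
    and P: "\<And>J z. J \<in> \<S> \<Longrightarrow> stem_rep P J z (A z * B z)"
    and P1: "\<And>J z. J \<in> \<S> \<Longrightarrow> stem_rep P1 J z (A z)"
    and P2: "\<And>J z. J \<in> \<S> \<Longrightarrow> stem_rep P2 J z (B z)" "\<And>\<Lambda>. open \<Lambda> \<Longrightarrow> slice_regular_on \<Lambda> P2"
    and h: "slice_regular_on \<Omega> h"
  shows "divides_near \<Omega> C P1 h"
proof -
  from assms(1) obtain \<Lambda> g where \<Lambda>: "slice_domain \<Lambda>" "C \<subseteq> \<Lambda>" "\<Lambda> \<subseteq> \<Omega>" and g: "slice_regular_on \<Lambda> g"
    and hg: "\<And>q. q \<in> \<Lambda> \<Longrightarrow> h q = star \<Lambda> P g q" unfolding divides_near_def by blast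
  have op: "open \<Lambda>" using \<Lambda>(1) by (rule slice_domain_open)
  define g' where "g' = star \<Lambda> P2 g"
  have g': "slice_regular_on \<Lambda> g'" unfolding g'_def by (intro slice_regular_on_star \<Lambda> P2 g op)
  have "h q = star \<Lambda> P1 g' q" if "q \<in> \<Lambda>" for q
  proof (rule star_eqI[OF \<Lambda>(1) g' slice_regular_on_subset[OF h \<Lambda>(3)] P1 _ that])
    fix J z assume J: "J \<in> \<S>" "slice_pt J z \<in> \<Lambda>"
    have "stem h J z = A z * B z * stem g J z"
      using stem_eq_mult[OF \<Lambda>(1) g J(1) hg P J(2)] J(1) by simp
    moreover have "stem g' J z = B z * stem g J z"
      using stem_eq_mult[OF \<Lambda>(1) g J(1) _ P2(1) J(2), of g'] J(1) by (simp add: g'_def)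
    ultimately show "stem h J z = A z * stem g' J z" by (simp add: mult.assoc)
  qed
  with \<Lambda> g' show ?thesis unfolding divides_near_def by blast
qed

lemma divides_near_sphere_mono:
  assumes "divides_near \<Omega> C (sphere_poly z0 m) h" "slice_regular_on \<Omega> h" "k \<le> m"
  shows "divides_near \<Omega> C (sphere_poly z0 k) h"
proof (rule divides_near_mult_imp[OF assms(1) _ stem_rep_sphere_poly stem_rep_sphere_poly
    slice_regular_on_sphere_poly assms(2)])
  have "stem_rep (sphere_poly z0 m) J z (cq_cplx (quad z0 z ^ (k + (m - k))))" for J z
    using stem_rep_sphere_poly[of z0 m J z] assms(3) by simp
  then show "stem_rep (sphere_poly z0 m) J z
      (cq_cplx (quad z0 z ^ k) * cq_cplx (quad z0 z ^ (m - k)))" for J z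
    unfolding power_add cq_cplx_arith .
qed

lemma divides_near_linear_Suc:
  assumes "divides_near \<Omega> C (linear_star_power p (Suc k)) h" "slice_regular_on \<Omega> h"
  shows "divides_near \<Omega> C (linear_star_power p k) h"
  by (rule divides_near_mult_imp[OF assms(1) _ stem_rep_star_power stem_rep_linear
      slice_regular_on_linear assms(2)])
    (use stem_rep_star_power[where k = "Suc k"] in \<open>simp only: power_Suc2\<close>)

section \<open>Multiplicities\<close>

text \<open>\<open>quad z0\<close> vanishes at \<open>z0\<close>, so \<open>k\<close> is at most the
  order of the zero of \<nu> there, and this order is finite because \<nu> is not identically zero
  on the connected set \<open>U\<close>.\<close>

lemma zero_order_bound:
  assumes \<nu>: "\<nu> holomorphic_on U" and U: "open U" "connected U" "z0 \<in> U"
    and nz: "\<exists>z\<in>U. \<nu> z \<noteq> 0"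
  shows "\<exists>M. \<forall>k V r. open V \<and> z0 \<in> V \<and> r holomorphic_on V \<and>
            (\<forall>z\<in>V. \<nu> z = quad z0 z ^ k * r z) \<longrightarrow> k \<le> M"
proof (cases "\<nu> z0 = 0")
  case False
  then have "k = 0" if "z0 \<in> V" "\<forall>z\<in>V. \<nu> z = quad z0 z ^ k * r z" for k V r
    using that by (metis quad_self mult_zero_left power_eq_0_iff bot_nat_0.not_eq_extremum)
  then show ?thesis by (intro exI[of _ 0]) auto
next
  case True
  have "\<not> \<nu> constant_on U" using nz True U(3) by (metis constant_on_def)
  from holomorphic_factor_zero_nonconstant[OF \<nu> U True this]
  obtain g \<rho> n where g: "0 < \<rho>" "g holomorphic_on ball z0 \<rho>"
    "\<And>w. w \<in> ball z0 \<rho> \<Longrightarrow> \<nu> w = (w - z0) ^ n * g w" "\<And>w. w \<in> ball z0 \<rho> \<Longrightarrow> g w \<noteq> 0"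
    by metis
  have "k \<le> n" if V: "open V" "z0 \<in> V" and r: "r holomorphic_on V"
    and eq: "\<And>z. z \<in> V \<Longrightarrow> \<nu> z = quad z0 z ^ k * r z" for k V r
  proof (rule ccontr)
    assume "\<not> k \<le> n"
    define W where "W = V \<inter> ball z0 \<rho>"
    \<comment> \<open>What remains of the right-hand side after cancelling
      \<open>(z - z0) ^ n\<close>. It vanishes at \<open>z0\<close> because \<open>k > n\<close>,
      while \<open>g\<close> does not.\<close>
    define F where "F z = (z - z0) ^ (k - n) * ((z - cnj z0) ^ k * r z)" for z
    have "F holomorphic_on W"
      unfolding F_def[abs_def] using r by (intro holomorphic_intros) (auto simp: W_def intro: holomorphic_on_subset)
    then have "(\<lambda>z. cq_cplx (F z)) cq_hol_on W" by (rule cq_hol_cplx)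
    moreover have "(\<lambda>z. cq_cplx (g z)) cq_hol_on W"
      using g(2) by (intro cq_hol_cplx) (auto simp: W_def intro: holomorphic_on_subset)
    moreover have "open W" "z0 \<in> W" using V g(1) by (auto simp: W_def)
    moreover have "cq_cplx (g z) = cq_cplx (F z)" if z: "z \<in> W" "z \<noteq> z0" for z
    proof -
      have "(z - z0) ^ n * g z = (z - z0) ^ k * ((z - cnj z0) ^ k * r z)"
        using eq[of z] g(3)[of z] z(1) by (simp add: W_def quad_factor power_mult_distrib)
      also have "(z - z0) ^ k = (z - z0) ^ n * (z - z0) ^ (k - n)"
        using \<open>\<not> k \<le> n\<close> by (simp flip: power_add)
      finally have "g z = F z" using z(2) by (simp add: F_def)
      then show ?thesis by simp
    qed
    ultimately have "cq_cplx (g z0) = cq_cplx (F z0)"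
      using cq_hol_eqI[of "\<lambda>z. cq_cplx (g z)" W "\<lambda>z. cq_cplx (F z)" z0] by blast
    then have "g z0 = F z0" by (simp add: cquat_eq_iff)
    also have "F z0 = 0" using \<open>\<not> k \<le> n\<close> by (simp add: F_def)
    finally show False using g(1,4) by simp
  qed
  then show ?thesis by blast
qed

text \<open>The normal function of \<open>h\<close> equals \<open>|h|\<^sup>2\<close> on the real axis, so it cannot vanish identically.\<close>

lemma stem_nrm_nonzero:
  assumes \<Omega>: "slice_domain \<Omega>" and h: "slice_regular_on \<Omega> h" and nz: "q \<in> \<Omega>" "h q \<noteq> 0"
    and I: "I \<in> \<S>"
  shows "\<exists>z\<in>slice_dom \<Omega> I. cq_nrm (stem h I z) \<noteq> 0"
proof (rule ccontr)
  assume neg: "\<not> ?thesis"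
  have op: "open \<Omega>" using \<Omega> by (rule slice_domain_open)
  obtain r where r: "of_real r \<in> \<Omega>" using slice_domain_real_point[OF \<Omega>] by blast
  have zero: "h (of_real x) = 0" if "of_real x \<in> \<Omega>" for x
  proof -
    have "cq_nrm (stem h I (of_real x)) = 0" using neg that by (metis mem_slice_dom slice_pt_of_real)
    then show ?thesis by (simp add: stem_of_real[OF I] cq_nrm_quat_eq_0)
  qed
  obtain J z where J: "J \<in> \<S>" "q = slice_pt J z" by (rule slice_pt_cover)
  define U where "U = slice_dom \<Omega> J"
  have U: "open U" "connected U" "of_real r \<in> U" "z \<in> U"
    using op \<Omega> J r nz(1) by (simp_all add: U_def open_slice_dom connected_slice_dom)
  have "(\<lambda>z. cq_lift J (h (slice_pt J z))) cq_hol_on U"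
    unfolding U_def by (rule slice_regular_on_lift_holomorphic[OF h op J(1)])
  moreover have "cq_lift J (h (slice_pt J w)) = 0" if "w \<in> U \<inter> \<real>" for w
    using that zero by (auto simp: U_def cq_lift_eq_0_iff[OF J(1)] elim!: Reals_cases)
  ultimately have "cq_lift J (h (slice_pt J z)) = 0"
    using cq_hol_identity[of _ U "U \<inter> \<real>" "of_real r" z] U of_real_islimpt_Reals[OF U(1,3)]
    by blast
  then show False using nz(2) J by (simp add: cq_lift_eq_0_iff)
qed

lemma ex_greatest_nat:
  fixes D :: "nat \<Rightarrow> bool"
  assumes "D 0" "\<And>k. D k \<Longrightarrow> k \<le> M"
  obtains k where "D k" "\<not> D (Suc k)"
proof -
  have "\<exists>k. D k \<and> \<not> D (Suc k)"
  proof (rule ccontr)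
    assume "\<nexists>k. D k \<and> \<not> D (Suc k)"
    then have "D k" for k by (induction k) (use assms(1) in auto)
    then show False using assms(2) not_less_eq_eq by blast
  qed
  then show ?thesis using that by blast
qed

text \<open>The number selected in the definition of the classical multiplicity is unique because
  divisibility is inherited by smaller exponents, and it exists because the exponents are
  bounded.\<close>

lemma The_greatest_nat:
  fixes D :: "nat \<Rightarrow> bool"
  assumes "D 0" "\<And>k. D (Suc k) \<Longrightarrow> D k" "\<And>k. D k \<Longrightarrow> k \<le> M"
  shows "j \<le> (THE k. D k \<and> \<not> D (Suc k)) \<longleftrightarrow> D j"
proof -
  have down: "D j" if "D k" "j \<le> k" for j k
    using that(2,1) by (induction rule: inc_induct) (auto intro: assms(2))
  obtain k where k: "D k" "\<not> D (Suc k)" using ex_greatest_nat[of D M] assms(1,3) by blast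
  have le: "j \<le> k \<longleftrightarrow> D j" for j
    using down[of k j] down[of j "Suc k"] k by (meson not_less_eq_eq)
  have "(THE k. D k \<and> \<not> D (Suc k)) = k"
  proof (rule the_equality)
    fix k' assume "D k' \<and> \<not> D (Suc k')"
    then show "k' = k" using le[of k'] le[of "Suc k'"] by simp
  qed (use k in blast)
  with le show ?thesis by simp
qed

section \<open>The Leibniz rule at a linear factor\<close>

lemma cq_deriv_linear_mult:
  assumes "X cq_hol_on U" "open U" "z0 \<in> U"
  shows "cq_deriv (\<lambda>z. cq_linear a z * X z) z0 = X z0 + cq_linear a z0 * cq_deriv X z0"
proof -
  have d: "(c has_field_derivative deriv c z0) (at z0)" if "c holomorphic_on U" for c
    using that assms(2,3) holomorphic_derivI by blast
  note h = assms(1)[unfolded cq_hol_on_def]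
  note ds = h[THEN conjunct1, THEN d] h[THEN conjunct2, THEN conjunct1, THEN d]
    h[THEN conjunct2, THEN conjunct2, THEN conjunct1, THEN d]
    h[THEN conjunct2, THEN conjunct2, THEN conjunct2, THEN d]
  show ?thesis
    unfolding cquat_eq_iff cq_deriv_sel cquat_sel cq_linear_def cq_cplx_sel cq_quat_sel
    by (intro conjI DERIV_imp_deriv) (rule derivative_eq_intros ds refl | simp add: algebra_simps)+
qed

lemma cq_deriv_cong:
  assumes "open U" "z0 \<in> U" "\<And>z. z \<in> U \<Longrightarrow> F z = G z"
  shows "cq_deriv F z0 = cq_deriv G z0"
proof -
  have "\<forall>\<^sub>F z in nhds z0. F z = G z" using assms eventually_nhds by blast
  then have "\<forall>\<^sub>F z in nhds z0. c (F z) = c (G z)" for c :: "cquat \<Rightarrow> complex"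
    by eventually_elim simp
  then show ?thesis by (simp add: cquat_eq_iff deriv_cong_ev)
qed

text \<open>By the Leibniz rule the derivative at \<open>z0\<close> is \<open>X z0\<close> plus a
  term with the linear factor in front, and evaluation at \<open>I\<close> annihilates that
  term.\<close>

lemma cullen_derivative_factor:
  assumes \<Omega>: "slice_domain \<Omega>" and h: "slice_regular_on \<Omega> h" and I: "I \<in> \<S>"
    and z0: "slice_pt I z0 \<in> \<Omega>" and U: "open U" "z0 \<in> U" and X: "X cq_hol_on U"
    and eq: "\<And>z. z \<in> U \<Longrightarrow> stem h I z = cq_linear (slice_pt I z0) z * X z"
  shows "cullen_derivative h (slice_pt I z0) = cq_eval I (X z0)"
  by (simp add: cullen_derivative_stem[OF \<Omega> h I z0] cq_deriv_cong[OF U eq]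
      cq_deriv_linear_mult[OF X U] cq_eval_arith cq_eval_linear_mult[OF I])

section \<open>Products of linear factors\<close>

definition cq_prod :: "quat list \<Rightarrow> complex \<Rightarrow> cquat" where
  "cq_prod ps z = foldr (\<lambda>a X. cq_linear a z * X) ps 1"

lemma cq_prod_simps [simp]:
  "cq_prod [] z = 1" "cq_prod (a # ps) z = cq_linear a z * cq_prod ps z"
  by (simp_all add: cq_prod_def)

lemma cq_prod_snoc: "cq_prod (ps @ [a]) z = cq_prod ps z * cq_linear a z"
  by (induction ps) (simp_all add: mult.assoc)

lemma cq_prod_holomorphic: "cq_prod ps cq_hol_on U"
proof (induction ps)
  case Nil
  show ?case using cq_hol_const[of 1 U] by (simp add: cq_prod_def[abs_def])
next
  case (Cons a ps)
  have "cq_prod (a # ps) = (\<lambda>z. cq_linear a z * cq_prod ps z)" by (rule ext) simp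
  with Cons show ?case by (simp add: cq_hol_mult cq_hol_linear)
qed

lemma qsphere_Re_Im: "qsphere (Re z0) (Im z0) = {slice_pt J z0 | J. J \<in> \<S>}"
  by (simp add: qsphere_eq)

lemma cq_nrm_prod:
  "set ps \<subseteq> qsphere (Re z0) (Im z0) \<Longrightarrow> cq_nrm (cq_prod ps z) = quad z0 z ^ length ps"
proof (induction ps)
  case Nil
  show ?case by (simp add: cq_nrm_def)
next
  case (Cons a ps)
  then obtain K where "K \<in> \<S>" "a = slice_pt K z0" by (auto simp: qsphere_Re_Im)
  with Cons show ?case by (simp add: cq_nrm_mult cq_nrm_linear quad_def)
qed

text \<open>Adjacent conjugate points contribute the central factor \<open>quad z0\<close>, which is
  zero at \<open>z0\<close>. Hence a product that is nonzero at \<open>z0\<close> satisfies the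
  condition on consecutive points.\<close>

lemma cq_prod_conj_pair:
  assumes "set ps \<subseteq> qsphere (Re z0) (Im z0)" "Suc i < length ps" "ps ! i = q_cnj (ps ! Suc i)"
  shows "cq_prod ps z0 = 0"
  using assms
proof (induction ps arbitrary: i)
  case (Cons a ps)
  show ?case
  proof (cases i)
    case 0
    with Cons.prems obtain b qs where ps: "ps = b # qs" "a = q_cnj b" by (cases ps) auto
    with Cons.prems(1) obtain K where K: "K \<in> \<S>" "b = slice_pt K z0" by (auto simp: qsphere_Re_Im)
    have "cq_nrm (cq_linear b z0) = 0"
      using quad_self[of z0] unfolding K(2) cq_nrm_linear[OF K(1)] quad_def .
    then have "cq_linear (q_cnj b) z0 * cq_linear b z0 = 0"
      by (simp add: cq_linear_mult_cnj cq_cplx_arith)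
    then show ?thesis by (simp add: ps mult.assoc[symmetric])
  next
    case (Suc j)
    then have "cq_prod ps z0 = 0" using Cons.IH[of j] Cons.prems by simp
    then show ?thesis by simp
  qed
qed simp

text \<open>The common value at \<open>z0\<close> is nonzero but annihilated by evaluation at the
  unit of the first point, so that unit is determined. The common first factor is then cancelled and
  the argument repeated.\<close>

lemma linear_factors_unique:
  assumes "set ps \<subseteq> qsphere (Re z0) (Im z0)" "set ps' \<subseteq> qsphere (Re z0) (Im z0)"
    and U: "open U" "z0 \<in> U"
    and G: "G cq_hol_on U" "cq_nrm (G z0) \<noteq> 0"
    and G': "G' cq_hol_on U" "cq_nrm (G' z0) \<noteq> 0"
    and eq: "\<And>z. z \<in> U \<Longrightarrow> cq_prod ps z * G z = cq_prod ps' z * G' z"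
    and nz: "cq_prod ps z0 * G z0 \<noteq> 0"
  shows "ps = ps'"
  using assms(1,2) eq nz
proof (induction ps arbitrary: ps')
  case Nil
  \<comment> \<open>Each linear factor contributes a zero of the norm at \<open>z0\<close>, so an
    empty product on one side forces an empty product on the other.\<close>
  have "cq_nrm (cq_prod ps' z0 * G' z0) = quad z0 z0 ^ length ps' * cq_nrm (G' z0)"
    using cq_nrm_prod[OF Nil.prems(2)] by (simp add: cq_nrm_mult)
  moreover have "cq_nrm (cq_prod ps' z0 * G' z0) \<noteq> 0" using Nil.prems(3)[OF U(2)] G(2) by simp
  ultimately have "length ps' = 0" by (metis mult_zero_left power_eq_0_iff quad_self neq0_conv)
  then show ?case by simp
next
  case (Cons a ps)
  show ?case
  proof (cases ps')
    case Nil
    have "cq_nrm (G' z0) = quad z0 z0 ^ length (a # ps) * cq_nrm (G z0)"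
      using cq_nrm_prod[OF Cons.prems(1), of z0] Cons.prems(3)[OF U(2)] Nil
      by (metis cq_nrm_mult cq_prod_simps(1) mult_1)
    then show ?thesis using G'(2) by simp
  next
    case ps': (Cons a' qs)
    from Cons.prems(1,2) ps' obtain K K' where K: "K \<in> \<S>" "a = slice_pt K z0"
      and K': "K' \<in> \<S>" "a' = slice_pt K' z0" by (auto simp: qsphere_Re_Im)
    define A where "A = cq_prod (a # ps) z0 * G z0"
    have "A \<noteq> 0" using Cons.prems(4) by (simp add: A_def)
    have "cq_eval K A = 0"
      unfolding A_def K(2) cq_prod_simps mult.assoc by (rule cq_eval_linear_mult[OF K(1)])
    moreover have "A = cq_prod ps' z0 * G' z0" unfolding A_def using Cons.prems(3) U(2) by blast
    then have "cq_eval K' A = 0"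
      unfolding K'(2) ps' cq_prod_simps mult.assoc by (simp add: cq_eval_linear_mult[OF K'(1)])
    ultimately have "K = K'"
      using cq_eval_eq_imp_eq[of K A 0 K'] \<open>A \<noteq> 0\<close> by (auto simp: cq_eval_arith)
    then have a: "a = a'" using K K' by simp
    have "cq_cplx (quad z0 z ^ 1) * (cq_prod ps z * G z)
        = cq_cplx (quad z0 z ^ 1) * (cq_prod qs z * G' z)" if "z \<in> U" for z
    proof -
      have "cq_linear a z * (cq_prod ps z * G z) = cq_linear a z * (cq_prod qs z * G' z)"
        using Cons.prems(3)[OF that] ps' a by (simp add: mult.assoc)
      \<comment> \<open>The conjugate factor on the left makes the common factor central, hence
        cancellable also at \<open>z0\<close>, where the linear factor is a zero divisor.\<close>
      then have "cq_linear (q_cnj a) z * cq_linear a z * (cq_prod ps z * G z)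
          = cq_linear (q_cnj a) z * cq_linear a z * (cq_prod qs z * G' z)"
        by (simp add: mult.assoc)
      then show ?thesis
        unfolding K(2) cq_linear_mult_cnj cq_nrm_linear[OF K(1)] quad_def[symmetric] by simp
    qed
    from cq_hol_cancel[OF _ _ U(1) _ this]
    have all: "cq_prod ps z * G z = cq_prod qs z * G' z" if "z \<in> U" for z
      using that by (simp add: cq_hol_mult cq_prod_holomorphic G(1) G'(1))
    have "ps = qs"
    proof (rule Cons.IH)
      show "cq_prod ps z0 * G z0 \<noteq> 0"
        using Cons.prems(4) by (auto simp: mult.assoc)
    qed (use Cons.prems(1,2) ps' all in auto)
    with a ps' show ?thesis by simp
  qed
qed

abbreviation star_linear :: "quat set \<Rightarrow> quat list \<Rightarrow> (quat \<Rightarrow> quat) \<Rightarrow> quat \<Rightarrow> quat" where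
  "star_linear \<Lambda> \<equiv> foldr (\<lambda>a F. star \<Lambda> (\<lambda>q. q - a) F)"

lemma stem_rep_star_linear:
  assumes "open \<Lambda>" "slice_pt J z \<in> \<Lambda>" "stem_rep g J z B"
  shows "stem_rep (star_linear \<Lambda> ps g) J z (cq_prod ps z * B)"
proof (induction ps)
  case (Cons a ps)
  from stem_rep_star[OF stem_rep_linear this assms(1,2), of a] show ?case
    by (simp add: mult.assoc)
qed (simp add: assms(3))

text \<open>\<open>W\<close> meets the sphere of \<open>z0\<close> only in \<open>C\<close>, so a quotient which exists near one point of \<open>C\<close> is
  slice regular on all of \<open>W\<close>.\<close>

locale sphere_component =
  fixes \<Omega> C W :: "quat set" and I :: quat and z0 :: complex
  assumes slice_domain_\<Omega>: "slice_domain \<Omega>" and I: "I \<in> \<S>"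
    and W: "slice_domain W" "C \<subseteq> W" "W \<subseteq> \<Omega>"
    and mem: "slice_pt I z0 \<in> C" and sub_sphere: "C \<subseteq> qsphere (Re z0) (Im z0)"
    and only: "\<And>J. J \<in> \<S> \<Longrightarrow> slice_pt J z0 \<in> W \<Longrightarrow> slice_pt J z0 \<in> C"
    and const: "\<And>\<Lambda> g J. slice_domain \<Lambda> \<Longrightarrow> C \<subseteq> \<Lambda> \<Longrightarrow> slice_regular_on \<Lambda> g \<Longrightarrow> J \<in> \<S> \<Longrightarrow>
          slice_pt J z0 \<in> C \<Longrightarrow> stem g J z0 = stem g I z0"
begin

lemma mem_W: "slice_pt I z0 \<in> W" and mem_\<Omega>: "slice_pt I z0 \<in> \<Omega>"
  using mem W by blast+

lemma open_slice_dom_\<Lambda>: "slice_domain \<Lambda> \<Longrightarrow> open (slice_dom \<Lambda> I)"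
  by (simp add: open_slice_dom slice_domain_open)

text \<open>By \<open>only\<close> and \<open>const\<close> the stem at \<open>z0\<close> is the
  same at all points of the sphere in \<open>W\<close>, so one vanishing condition gives division on
  all of \<open>W\<close>.\<close>

lemma divide_linear_near:
  assumes g: "slice_regular_on W g" and K: "K \<in> \<S>" and zero: "cq_eval K (stem g I z0) = 0"
  shows "\<exists>g'. slice_regular_on W g' \<and> (\<forall>q\<in>W. g q = star W (\<lambda>q. q - slice_pt K z0) g' q)"
  using const[OF W(1,2) g] only zero by (intro slice_regular_divide_linear[OF W(1) g K]) auto

lemma order_bound:
  assumes h: "slice_regular_on \<Omega> h" and nz: "\<exists>q\<in>\<Omega>. h q \<noteq> 0"
  shows "\<exists>M. \<forall>k V r. open V \<and> z0 \<in> V \<and> r holomorphic_on V \<and>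
            (\<forall>z\<in>V. cq_nrm (stem h I z) = quad z0 z ^ k * r z) \<longrightarrow> k \<le> M"
proof (rule zero_order_bound)
  show "(\<lambda>z. cq_nrm (stem h I z)) holomorphic_on slice_dom \<Omega> I"
    by (intro cq_nrm_holomorphic stem_holomorphic slice_domain_\<Omega> h I)
  show "open (slice_dom \<Omega> I)" "connected (slice_dom \<Omega> I)" "z0 \<in> slice_dom \<Omega> I"
    using slice_domain_\<Omega> I mem_\<Omega> by (simp_all add: open_slice_dom_\<Lambda> connected_slice_dom)
  show "\<exists>z\<in>slice_dom \<Omega> I. cq_nrm (stem h I z) \<noteq> 0"
    using stem_nrm_nonzero[OF slice_domain_\<Omega> h _ _ I] nz by blast
qed

text \<open>Near \<open>z0\<close> the norm of the stem of \<open>h\<close> is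
  \<open>quad z0 z ^ k\<close> times a holomorphic function. The bound is uniform in \<Lambda>,
  since divisibility near \<open>C\<close> leaves \<Lambda> free.\<close>

lemma star_factor_bound:
  assumes h: "slice_regular_on \<Omega> h" and nz: "\<exists>q\<in>\<Omega>. h q \<noteq> 0"
  shows "\<exists>M. \<forall>\<Lambda> P g A k. slice_domain \<Lambda> \<and> C \<subseteq> \<Lambda> \<and> slice_regular_on \<Lambda> g \<and>
      (\<forall>q\<in>\<Lambda>. h q = star \<Lambda> P g q) \<and>
      (\<forall>z. stem_rep P I z (A z) \<and> cq_nrm (A z) = quad z0 z ^ k) \<longrightarrow> k \<le> M"
proof -
  obtain M where M: "\<And>k V r. open V \<and> z0 \<in> V \<and> r holomorphic_on V \<and>
      (\<forall>z\<in>V. cq_nrm (stem h I z) = quad z0 z ^ k * r z) \<Longrightarrow> k \<le> M"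
    using order_bound[OF assms] by blast
  show ?thesis
  proof (intro exI allI impI, elim conjE, rule M, intro conjI ballI)
    fix \<Lambda> P g A k
    assume \<Lambda>: "slice_domain \<Lambda>" "C \<subseteq> \<Lambda>" and g: "slice_regular_on \<Lambda> g"
      and hg: "\<forall>q\<in>\<Lambda>. h q = star \<Lambda> P g q"
      and A: "\<forall>z. stem_rep P I z (A z) \<and> cq_nrm (A z) = quad z0 z ^ k"
    show "open (slice_dom \<Lambda> I)" "z0 \<in> slice_dom \<Lambda> I" using \<Lambda> mem by (auto simp: open_slice_dom_\<Lambda>)
    show "(\<lambda>z. cq_nrm (stem g I z)) holomorphic_on slice_dom \<Lambda> I"
      by (intro cq_nrm_holomorphic stem_holomorphic \<Lambda> g I)
    fix z assume "z \<in> slice_dom \<Lambda> I"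
    then have "stem h I z = A z * stem g I z" using stem_eq_mult[OF \<Lambda>(1) g I] hg A by simp
    then show "cq_nrm (stem h I z) = quad z0 z ^ k * cq_nrm (stem g I z)"
      by (simp add: cq_nrm_mult A)
  qed
qed

lemma star_one_eq:
  assumes "slice_regular_on W h" "\<And>J z. J \<in> \<S> \<Longrightarrow> stem_rep P J z 1" "q \<in> W"
  shows "h q = star W P h q"
  using star_eqI[OF W(1) assms(1,1) assms(2) _ assms(3)] by simp

text \<open>Division by the first factor leaves \<open>g1\<close>, whose stem at \<open>z0\<close>
  evaluates at \<open>I\<close> to the Cullen derivative of \<open>h\<close>; a further factor with
  the same root exists exactly if this value is zero. Real and non-real points are treated
  alike.\<close>

lemma classical_multiplicity_ge_2_iff:
  assumes h: "slice_regular_on \<Omega> h" and nz: "\<exists>q\<in>\<Omega>. h q \<noteq> 0" and h0: "h (slice_pt I z0) = 0"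
  shows "classical_multiplicity \<Omega> h C (slice_pt I z0) \<ge> 2 \<longleftrightarrow> cullen_derivative h (slice_pt I z0) = 0"
proof -
  define p where "p = slice_pt I z0"
  define D where "D k \<longleftrightarrow> divides_near \<Omega> C (linear_star_power p k) h" for k
  have h': "slice_regular_on W h" using h W(3) by (rule slice_regular_on_subset)
  have "h q = star W (linear_star_power p 0) h q" if "q \<in> W" for q
    using star_one_eq[OF h' _ that] stem_rep_star_power[where k = 0] by auto
  then have D0: "D 0" unfolding D_def divides_near_def using W h' by blast
  have pow: "cq_nrm (A ^ k) = cq_nrm A ^ k" for A k
    by (induction k) (simp_all add: cq_nrm_mult, simp add: cq_nrm_def)
  have nrm: "cq_nrm (cq_linear p z ^ k) = quad z0 z ^ k" for z k
    by (simp add: pow p_def cq_nrm_linear[OF I] quad_def)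
  from star_factor_bound[OF h nz] obtain M where M: "\<And>\<Lambda> P g A k. slice_domain \<Lambda> \<and> C \<subseteq> \<Lambda> \<and>
      slice_regular_on \<Lambda> g \<and> (\<forall>q\<in>\<Lambda>. h q = star \<Lambda> P g q) \<and>
      (\<forall>z. stem_rep P I z (A z) \<and> cq_nrm (A z) = quad z0 z ^ k) \<Longrightarrow> k \<le> M" by blast
  have "k \<le> M" if "D k" for k
    using that M[of _ _ "linear_star_power p k" "\<lambda>z. cq_linear p z ^ k" k]
      stem_rep_star_power[OF I] nrm unfolding D_def divides_near_def by blast
  from The_greatest_nat[of D, OF D0 _ this]
  have "classical_multiplicity \<Omega> h C p \<ge> 2 \<longleftrightarrow> D 2"
    unfolding classical_multiplicity_def D_def using divides_near_linear_Suc[OF _ h] by blast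
  also have "D 2 \<longleftrightarrow> cullen_derivative h p = 0"
  proof
    assume "D 2"
    then obtain \<Lambda> g where \<Lambda>: "slice_domain \<Lambda>" "C \<subseteq> \<Lambda>" "\<Lambda> \<subseteq> \<Omega>" and g: "slice_regular_on \<Lambda> g"
      and hg: "\<And>q. q \<in> \<Lambda> \<Longrightarrow> h q = star \<Lambda> (linear_star_power p 2) g q"
      unfolding D_def divides_near_def by blast
    have "stem h I z = cq_linear p z * (cq_linear p z * stem g I z)" if "z \<in> slice_dom \<Lambda> I" for z
      using stem_eq_mult[OF \<Lambda>(1) g I hg stem_rep_star_power[OF I]] that
      by (simp add: power2_eq_square mult.assoc)
    then have "cullen_derivative h p = cq_eval I (cq_linear p z0 * stem g I z0)"
      unfolding p_def
      by (intro cullen_derivative_factor[OF slice_domain_\<Omega> h I mem_\<Omega> open_slice_dom_\<Lambda>[OF \<Lambda>(1)]]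
        cq_hol_mult cq_hol_linear stem_holomorphic \<Lambda> g I)
        (use mem \<Lambda> in auto)
    then show "cullen_derivative h p = 0" by (simp add: p_def cq_eval_linear_mult[OF I])
  next
    assume c0: "cullen_derivative h p = 0"
    have "cq_eval I (stem h I z0) = 0" using stem_eval[OF slice_domain_\<Omega> h I mem_\<Omega>] h0 by simp
    from divide_linear_near[OF h' I this] obtain g1 where g1: "slice_regular_on W g1"
      and hg1: "\<And>q. q \<in> W \<Longrightarrow> h q = star W (\<lambda>q. q - p) g1 q" by (auto simp: p_def)
    have stem1: "stem h J z = cq_linear p z * stem g1 J z"
      if "J \<in> \<S>" "slice_pt J z \<in> W" for J z
      using stem_eq_mult[OF W(1) g1 that(1) hg1 stem_rep_linear that(2)] .
    have "cullen_derivative h p = cq_eval I (stem g1 I z0)"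
      unfolding p_def
      by (intro cullen_derivative_factor[OF slice_domain_\<Omega> h I mem_\<Omega> open_slice_dom_\<Lambda>[OF W(1)]]
        stem_holomorphic W g1 I)
        (use mem_W stem1[OF I] in \<open>auto simp: p_def\<close>)
    with c0 have "cq_eval I (stem g1 I z0) = 0" by simp
    from divide_linear_near[OF g1 I this] obtain g2 where g2: "slice_regular_on W g2"
      and g12: "\<And>q. q \<in> W \<Longrightarrow> g1 q = star W (\<lambda>q. q - p) g2 q" by (auto simp: p_def)
    have "stem g1 J z = cq_linear p z * stem g2 J z"
      if "J \<in> \<S>" "slice_pt J z \<in> W" for J z
      using stem_eq_mult[OF W(1) g2 that(1) g12 stem_rep_linear that(2)] .
    with stem1 have stem2: "stem h J z = cq_linear p z ^ 2 * stem g2 J z"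
      if "J \<in> \<S>" "slice_pt J z \<in> W" for J z
      using that by (simp add: power2_eq_square mult.assoc)
    have "h q = star W (linear_star_power p 2) g2 q" if "q \<in> W" for q
      by (rule star_eqI[OF W(1) g2 h' stem_rep_star_power stem2 that])
    then show "D 2" unfolding D_def divides_near_def using W g2 by blast
  qed
  finally show ?thesis by (simp add: p_def)
qed

end

section \<open>Spherical and isolated multiplicities\<close>

lemma stem_sphere_poly_mult:
  assumes \<Lambda>: "slice_domain \<Lambda>" and J: "J \<in> \<S>" "slice_pt J z \<in> \<Lambda>"
    and g: "stem_rep g J z B"
    and kg: "\<And>q. q \<in> \<Lambda> \<Longrightarrow> k q = sphere_poly z0 m q * g q"
  shows "stem k J z = cq_cplx (quad z0 z ^ m) * B"
proof -
  have "stem_rep (\<lambda>q. sphere_poly z0 m q * g q) J z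
      (cq_cplx (quad z0 z ^ m) * B)"
    by (intro stem_rep_cplx_mult sphere_poly_power_slice_pt g)
  then have "stem_rep k J z (cq_cplx (quad z0 z ^ m) * B)"
    by (rule stem_rep_cong_on[OF _ slice_domain_open[OF \<Lambda>] J(2)]) (simp add: kg)
  then show ?thesis by (rule stem_eqI[OF J(1)])
qed

context sphere_component
begin

text \<open>With \<open>m\<close> maximal, a zero stem of the quotient at \<open>z0\<close> would
  make the quotient vanish on the whole sphere inside \<open>W\<close> and allow one more
  division.\<close>

lemma sphere_part:
  assumes h: "slice_regular_on \<Omega> h" and nz: "\<exists>q\<in>\<Omega>. h q \<noteq> 0" and y: "Im z0 \<noteq> 0"
  obtains m g where "slice_regular_on W g"
    "\<And>q. q \<in> W \<Longrightarrow> h q = star W (sphere_poly z0 m) g q" "stem g I z0 \<noteq> 0"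
proof -
  define D where "D m \<longleftrightarrow> (\<exists>g. slice_regular_on W g \<and>
      (\<forall>q\<in>W. h q = star W (sphere_poly z0 m) g q))" for m
  have h': "slice_regular_on W h" using h W(3) by (rule slice_regular_on_subset)
  have "stem_rep (sphere_poly z0 0) J z 1" for J z
    using stem_rep_sphere_poly[of z0 0 J z] by (simp add: cq_cplx_arith)
  then have D0: "D 0" unfolding D_def using h' star_one_eq[OF h'] by blast
  \<comment> \<open>A spherical factor has the square of \<open>quad z0 z\<close> as its norm,
    whence the exponent \<open>2 * m\<close>.\<close>
  have "cq_nrm (cq_cplx (quad z0 z ^ m)) = quad z0 z ^ (2 * m)" for z m
    by (simp add: cq_nrm_cplx power_mult[symmetric] mult.commute)
  moreover from star_factor_bound[OF h nz] obtain M where M: "\<And>\<Lambda> P g A k. slice_domain \<Lambda> \<and>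
      C \<subseteq> \<Lambda> \<and> slice_regular_on \<Lambda> g \<and> (\<forall>q\<in>\<Lambda>. h q = star \<Lambda> P g q) \<and>
      (\<forall>z. stem_rep P I z (A z) \<and> cq_nrm (A z) = quad z0 z ^ k) \<Longrightarrow> k \<le> M" by blast
  ultimately have "2 * m \<le> M" if "D m" for m
    using that M[of W _ "sphere_poly z0 m" "\<lambda>z. cq_cplx (quad z0 z ^ m)" "2 * m"]
      W(1,2) stem_rep_sphere_poly unfolding D_def by blast
  then have bd: "m \<le> M" if "D m" for m using that by fastforce
  obtain m where m: "D m" "\<not> D (Suc m)" using ex_greatest_nat[of D M] D0 bd by blast
  then obtain g where g: "slice_regular_on W g"
    and hg: "\<And>q. q \<in> W \<Longrightarrow> h q = star W (sphere_poly z0 m) g q"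
    unfolding D_def by blast
  have "stem g I z0 \<noteq> 0"
  proof
    assume g0: "stem g I z0 = 0"
    have "g (slice_pt J z0) = 0" if "J \<in> \<S>" "slice_pt J z0 \<in> W" for J
      using stem_eval[OF W(1) g that] const[OF W(1,2) g that(1) only[OF that]] g0
      by (simp add: cq_eval_arith)
    from slice_regular_divide_sphere[OF slice_domain_open[OF W(1)] g y this]
    obtain g' where g': "slice_regular_on W g'"
      and gg': "\<And>q. q \<in> W \<Longrightarrow> g q = sphere_poly z0 1 q * g' q" by blast
    have "h q = star W (sphere_poly z0 (Suc m)) g' q" if "q \<in> W" for q
    proof (rule star_eqI[OF W(1) g' h' stem_rep_sphere_poly _ that])
      fix J z assume J: "J \<in> \<S>" "slice_pt J z \<in> W"
      have "stem h J z = cq_cplx (quad z0 z ^ m) * stem g J z"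
        by (rule stem_eq_mult[OF W(1) g J(1) hg stem_rep_sphere_poly J(2)])
      moreover have "stem g J z = cq_cplx (quad z0 z ^ 1) * stem g' J z"
        by (rule stem_sphere_poly_mult[OF W(1) J stem_rep_stem[OF W(1) g' J] gg'])
      ultimately show "stem h J z = cq_cplx (quad z0 z ^ Suc m) * stem g' J z"
        by (simp add: power_Suc2 cq_cplx_arith mult.assoc del: power_Suc)
    qed
    with g' m(2) show False unfolding D_def by blast
  qed
  with g hg show ?thesis using that by blast
qed

text \<open>If \<open>k > m\<close>, cancelling \<open>quad z0 z ^ m\<close> exhibits the stem of
  \<open>g\<close> as a multiple of a positive power of \<open>quad z0\<close>, which vanishes at
  \<open>z0\<close>.\<close>

lemma divides_near_sphere_iff:
  assumes h: "slice_regular_on \<Omega> h" and g: "slice_regular_on W g"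
    and hg: "\<And>q. q \<in> W \<Longrightarrow> h q = star W (sphere_poly z0 m) g q"
    and nz: "stem g I z0 \<noteq> 0"
  shows "divides_near \<Omega> C (sphere_poly z0 k) h \<longleftrightarrow> k \<le> m"
proof
  have "divides_near \<Omega> C (sphere_poly z0 m) h"
    unfolding divides_near_def using W g hg by blast
  then show "k \<le> m \<Longrightarrow> divides_near \<Omega> C (sphere_poly z0 k) h"
    using divides_near_sphere_mono h by blast
next
  assume "divides_near \<Omega> C (sphere_poly z0 k) h"
  then obtain \<Lambda> g' where \<Lambda>: "slice_domain \<Lambda>" "C \<subseteq> \<Lambda>" and g': "slice_regular_on \<Lambda> g'"
    and hg': "\<And>q. q \<in> \<Lambda> \<Longrightarrow> h q = star \<Lambda> (sphere_poly z0 k) g' q"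
    unfolding divides_near_def by blast
  show "k \<le> m"
  proof (rule ccontr)
    assume "\<not> k \<le> m"
    \<comment> \<open>The two factorizations live on \<open>W\<close> and on some \<Lambda>; their
      stems are compared on the common part of the slice.\<close>
    define V where "V = slice_dom \<Lambda> I \<inter> slice_dom W I"
    have V: "open V" "z0 \<in> V" using mem \<Lambda> mem_W W(1)
      by (auto simp: V_def intro!: open_Int open_slice_dom_\<Lambda>)
    have "stem g I cq_hol_on V"
      by (rule cq_hol_on_subset[OF stem_holomorphic[OF W(1) g I]]) (auto simp: V_def)
    moreover have "stem g' I cq_hol_on V"
      by (rule cq_hol_on_subset[OF stem_holomorphic[OF \<Lambda>(1) g' I]]) (auto simp: V_def)
    then have "(\<lambda>z. cq_cplx (quad z0 z ^ (k - m)) * stem g' I z) cq_hol_on V"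
      by (intro cq_hol_mult cq_hol_cplx holomorphic_intros quad_holomorphic)
    moreover have "cq_cplx (quad z0 z ^ m) * stem g I z = cq_cplx (quad z0 z ^ m) *
        (cq_cplx (quad z0 z ^ (k - m)) * stem g' I z)" if z: "z \<in> V" for z
    proof -
      have "cq_cplx (quad z0 z ^ m) * stem g I z = stem h I z"
        using stem_eq_mult[OF W(1) g I hg stem_rep_sphere_poly, of z] z by (simp add: V_def)
      also have "\<dots> = cq_cplx (quad z0 z ^ k) * stem g' I z"
        using stem_eq_mult[OF \<Lambda>(1) g' I hg' stem_rep_sphere_poly, of z] z by (simp add: V_def)
      also have "quad z0 z ^ k = quad z0 z ^ m * quad z0 z ^ (k - m)"
        using \<open>\<not> k \<le> m\<close> by (simp flip: power_add)
      finally show ?thesis by (simp add: cq_cplx_arith mult.assoc)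
    qed
    ultimately have "stem g I z0 = cq_cplx (quad z0 z0 ^ (k - m)) * stem g' I z0"
      using cq_hol_cancel[OF _ _ V] by blast
    then show False using nz \<open>\<not> k \<le> m\<close> by (simp add: cq_cplx_arith zero_power)
  qed
qed

lemma stem_star_linear:
  assumes g: "slice_regular_on \<Lambda> g" and \<Lambda>: "slice_domain \<Lambda>"
    and g1: "\<And>q. q \<in> \<Lambda> \<Longrightarrow> g1 q = star_linear \<Lambda> ps g q"
    and J: "J \<in> \<S>" "slice_pt J z \<in> \<Lambda>"
  shows "stem g1 J z = cq_prod ps z * stem g J z"
proof -
  have op: "open \<Lambda>" using \<Lambda> by (rule slice_domain_open)
  have "stem_rep (star_linear \<Lambda> ps g) J z (cq_prod ps z * stem g J z)"
    by (intro stem_rep_star_linear op J stem_rep_stem[OF \<Lambda> g])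
  then have "stem_rep g1 J z (cq_prod ps z * stem g J z)"
    by (rule stem_rep_cong_on[OF _ op J(2)]) (simp add: g1)
  then show ?thesis by (rule stem_eqI[OF J(1)])
qed

text \<open>With the number of linear factors maximal, a zero at \<open>z0\<close> of the norm of
  the last quotient would give a unit \<open>K\<close> with zero evaluation, hence one more factor
  at the end of the list.\<close>

lemma linear_part:
  assumes g1: "slice_regular_on W g1"
    and bound: "\<forall>k V r. open V \<and> z0 \<in> V \<and> r holomorphic_on V \<and> V \<subseteq> slice_dom W I \<and>
        (\<forall>z\<in>V. cq_nrm (stem g1 I z) = quad z0 z ^ k * r z) \<longrightarrow> k \<le> M"
  obtains ps g where "set ps \<subseteq> qsphere (Re z0) (Im z0)" "slice_regular_on W g"
    "\<And>q. q \<in> W \<Longrightarrow> g1 q = star_linear W ps g q"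
    "cq_nrm (stem g I z0) \<noteq> 0"
proof -
  define D where "D n \<longleftrightarrow> (\<exists>ps g. length ps = n \<and> set ps \<subseteq> qsphere (Re z0) (Im z0) \<and>
      slice_regular_on W g \<and> (\<forall>q\<in>W. g1 q = star_linear W ps g q))" for n
  have D0: "D 0" unfolding D_def using g1 by (intro exI[of _ "[]"] exI[of _ g1]) auto
  have bd: "n \<le> M" if D: "D n" for n
  proof -
    from D obtain ps g where ps: "length ps = n" "set ps \<subseteq> qsphere (Re z0) (Im z0)"
      and g: "slice_regular_on W g"
      and g1g: "\<And>q. q \<in> W \<Longrightarrow> g1 q = star_linear W ps g q"
      unfolding D_def by blast
    show ?thesis
    proof (rule bound[rule_format], intro conjI ballI)
      show "open (slice_dom W I)" "z0 \<in> slice_dom W I"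
        using W(1) mem_W by (simp_all add: open_slice_dom_\<Lambda>)
      show "(\<lambda>z. cq_nrm (stem g I z)) holomorphic_on slice_dom W I"
        by (intro cq_nrm_holomorphic stem_holomorphic W g I)
      fix z assume "z \<in> slice_dom W I"
      then show "cq_nrm (stem g1 I z) = quad z0 z ^ n * cq_nrm (stem g I z)"
        using stem_star_linear[OF g W(1) g1g I] cq_nrm_prod[OF ps(2)] ps(1) by (simp add: cq_nrm_mult)
    qed simp
  qed
  obtain n where n: "D n" "\<not> D (Suc n)" using ex_greatest_nat[of D M] D0 bd by blast
  then obtain ps g where ps: "length ps = n" "set ps \<subseteq> qsphere (Re z0) (Im z0)"
    and g: "slice_regular_on W g"
    and g1g: "\<And>q. q \<in> W \<Longrightarrow> g1 q = star_linear W ps g q"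
    unfolding D_def by blast
  have "cq_nrm (stem g I z0) \<noteq> 0"
  proof
    assume "cq_nrm (stem g I z0) = 0"
    then obtain K where K: "K \<in> \<S>" "cq_eval K (stem g I z0) = 0"
      by (auto simp: cq_nrm_eq_0_iff)
    from divide_linear_near[OF g this] obtain g' where g': "slice_regular_on W g'"
      and gg': "\<And>q. q \<in> W \<Longrightarrow> g q = star W (\<lambda>q. q - slice_pt K z0) g' q" by blast
    define ps' where "ps' = ps @ [slice_pt K z0]"
    have "g1 q = star_linear W ps' g' q" if "q \<in> W" for q
    proof -
      obtain J z where J: "J \<in> \<S>" "q = slice_pt J z" by (rule slice_pt_cover)
      have z: "slice_pt J z \<in> W" using that J by simp
      have "stem g1 J z = cq_prod ps z * stem g J z"
        by (rule stem_star_linear[OF g W(1) g1g J(1) z])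
      also have "stem g J z = cq_linear (slice_pt K z0) z * stem g' J z"
        by (rule stem_eq_mult[OF W(1) g' J(1) gg' stem_rep_linear z])
      finally have "stem g1 J z = cq_prod ps' z * stem g' J z"
        by (simp add: ps'_def cq_prod_snoc mult.assoc)
      moreover have "star_linear W ps' g' q = cq_eval J (cq_prod ps' z * stem g' J z)"
        unfolding J(2)
        by (rule stem_rep_eval[OF J(1) stem_rep_star_linear[OF slice_domain_open[OF W(1)] z
            stem_rep_stem[OF W(1) g' J(1) z]]])
      ultimately show ?thesis using stem_eval[OF W(1) g1 J(1) z] J(2) by simp
    qed
    moreover have "length ps' = Suc n" "set ps' \<subseteq> qsphere (Re z0) (Im z0)"
      using ps K(1) by (auto simp: ps'_def qsphere_Re_Im)
    ultimately show False using n(2) g' unfolding D_def by blast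
  qed
  then show ?thesis using ps(2) g g1g that by blast
qed

text \<open>Evaluates the definite descriptions in the multiplicities and passes to stems near
  \<open>z0\<close>: \<open>G1\<close> is the stem after removal of the spherical factors,
  \<open>G\<close> after removal of the linear factors too.\<close>

lemma sphere_multiplicities:
  assumes h: "slice_regular_on \<Omega> h" and nz: "\<exists>q\<in>\<Omega>. h q \<noteq> 0" and y: "Im z0 > 0"
  obtains m ps G1 G U where "open U" "z0 \<in> U" "G1 cq_hol_on U" "G cq_hol_on U"
    "\<And>z. z \<in> U \<Longrightarrow> stem h I z = cq_cplx (quad z0 z ^ m) * G1 z"
    "\<And>z. z \<in> U \<Longrightarrow> G1 z = cq_prod ps z * G z"
    "G1 z0 \<noteq> 0" "cq_nrm (G z0) \<noteq> 0" "set ps \<subseteq> qsphere (Re z0) (Im z0)"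
    "spherical_multiplicity \<Omega> h (Re z0) (Im z0) C = 2 * m"
    "\<And>p. isolated_multiplicity \<Omega> h (Re z0) (Im z0) C p = (if ps \<noteq> [] \<and> hd ps = p then length ps else 0)"
proof -
  have y': "Im z0 \<noteq> 0" using y by simp
  obtain m g1 where g1: "slice_regular_on W g1"
    and hg1: "\<And>q. q \<in> W \<Longrightarrow> h q = star W (sphere_poly z0 m) g1 q"
    and nz1: "stem g1 I z0 \<noteq> 0"
    using sphere_part[OF h nz y'] by blast
  have stem_h: "stem h I z = cq_cplx (quad z0 z ^ m) * stem g1 I z" if "z \<in> slice_dom W I" for z
    using stem_eq_mult[OF W(1) g1 I hg1 stem_rep_sphere_poly] that by simp
  obtain M where M: "\<And>k V r. open V \<and> z0 \<in> V \<and> r holomorphic_on V \<and>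
      (\<forall>z\<in>V. cq_nrm (stem h I z) = quad z0 z ^ k * r z) \<Longrightarrow> k \<le> M"
    using order_bound[OF h nz] by blast
  have bd: "\<forall>k V r. open V \<and> z0 \<in> V \<and> r holomorphic_on V \<and> V \<subseteq> slice_dom W I \<and>
      (\<forall>z\<in>V. cq_nrm (stem g1 I z) = quad z0 z ^ k * r z) \<longrightarrow> k \<le> M"
  proof (intro allI impI, elim conjE)
    fix k V r
    assume V: "open V" "z0 \<in> V" "r holomorphic_on V" "V \<subseteq> slice_dom W I"
      and eq: "\<forall>z\<in>V. cq_nrm (stem g1 I z) = quad z0 z ^ k * r z"
    \<comment> \<open>The norm of the stem of \<open>h\<close> has the extra factor
      \<open>quad z0 z ^ (2 * m)\<close>, so the bound for \<open>h\<close> also bounds the linear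
      factors of \<open>g1\<close>.\<close>
    have "cq_nrm (stem h I z) = quad z0 z ^ (2 * m + k) * r z" if "z \<in> V" for z
      using stem_h[of z] bspec[OF eq that] V(4) that
      by (auto simp: cq_nrm_cplx_mult power_add power_mult[symmetric] mult.commute)
    then have "2 * m + k \<le> M" using V by (intro M[of V r]) simp
    then show "k \<le> M" by simp
  qed
  obtain ps g where ps: "set ps \<subseteq> qsphere (Re z0) (Im z0)"
    and g: "slice_regular_on W g"
    and g1g: "\<And>q. q \<in> W \<Longrightarrow> g1 q = star_linear W ps g q"
    and nrm: "cq_nrm (stem g I z0) \<noteq> 0"
    by (rule linear_part[OF g1 bd]) (rule that; assumption)
  have stem_g1: "stem g1 I z = cq_prod ps z * stem g I z" if "z \<in> slice_dom W I" for z
    using stem_star_linear[OF g W(1) g1g I] that by simp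
  have div: "divides_near \<Omega> C (sphere_poly z0 k) h \<longleftrightarrow> k \<le> m" for k
    by (rule divides_near_sphere_iff[OF h g1 _ nz1]) (rule hg1)
  have ex: "sphere_factorization \<Omega> h (Re z0) (Im z0) C m ps"
    unfolding sphere_factorization_def div
  proof (intro conjI allI impI)
    show "ps ! i \<noteq> q_cnj (ps ! Suc i)" if "Suc i < length ps" for i
    proof
      assume "ps ! i = q_cnj (ps ! Suc i)"
      then have "cq_prod ps z0 = 0" using cq_prod_conj_pair[OF ps that] by blast
      then show False using stem_g1[of z0] nz1 mem_W by simp
    qed
    have "normal_fun W g (slice_pt I z0) \<noteq> 0"
      using normal_fun_eq_0_iff[OF I stem_rep_stem[OF W(1) g I mem_W] slice_domain_open[OF W(1)] mem_W] nrm
      by simp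
    then have "\<exists>q\<in>C. normal_fun W g q \<noteq> 0" using mem by blast
    moreover have "\<forall>q\<in>W. h q = sphere_poly z0 m q *
         star_linear W ps g q"
      using hg1 g1g star_slice_preserving[OF W(1) g1 _ sphere_poly_power_slice_pt] by simp
    ultimately show "\<exists>\<Lambda> g. slice_domain \<Lambda> \<and> C \<subseteq> \<Lambda> \<and> \<Lambda> \<subseteq> \<Omega> \<and> slice_regular_on \<Lambda> g \<and>
        (\<exists>q\<in>C. normal_fun \<Lambda> g q \<noteq> 0) \<and>
        (\<forall>q\<in>\<Lambda>. h q = sphere_poly z0 m q *
           star_linear \<Lambda> ps g q)"
      using W g by blast
  qed (use ps in auto)
  have uniq: "m' = m \<and> ps' = ps" if fac: "sphere_factorization \<Omega> h (Re z0) (Im z0) C m' ps'" for m' ps'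
  proof -
    have "m' \<le> m" "\<not> Suc m' \<le> m" using fac unfolding sphere_factorization_def div by blast+
    then have m': "m' = m" by simp
    from fac[unfolded sphere_factorization_def m'] obtain \<Lambda> g' q where
      ps': "set ps' \<subseteq> qsphere (Re z0) (Im z0)" and
      \<Lambda>: "slice_domain \<Lambda>" "C \<subseteq> \<Lambda>" and g': "slice_regular_on \<Lambda> g'"
      and q: "q \<in> C" "normal_fun \<Lambda> g' q \<noteq> 0"
      and hg': "\<And>q. q \<in> \<Lambda> \<Longrightarrow> h q = sphere_poly z0 m q *
             star_linear \<Lambda> ps' g' q" by blast
    have opL: "open \<Lambda>" using \<Lambda>(1) by (rule slice_domain_open)
    obtain J where J: "J \<in> \<S>" "q = slice_pt J z0"
      using q(1) sub_sphere by (auto simp: qsphere_Re_Im)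
    then have JL: "slice_pt J z0 \<in> \<Lambda>" using q(1) \<Lambda>(2) by blast
    \<comment> \<open>The normal function is known to be nonzero only at some point \<open>q\<close>
      of \<open>C\<close>; \<open>const\<close> carries this over to the point with unit
      \<open>I\<close>.\<close>
    have "cq_nrm (stem g' J z0) \<noteq> 0"
      using normal_fun_eq_0_iff[OF J(1) stem_rep_stem[OF \<Lambda>(1) g' J(1) JL] opL JL] q(2) J(2) by simp
    then have nrm': "cq_nrm (stem g' I z0) \<noteq> 0"
      using const[OF \<Lambda> g' J(1)] J(2) q(1) by simp
    have stem_h': "stem h I z = cq_cplx (quad z0 z ^ m) * (cq_prod ps' z * stem g' I z)"
      if "slice_pt I z \<in> \<Lambda>" for z
      by (rule stem_sphere_poly_mult[OF \<Lambda>(1) I that stem_rep_star_linear[OF opL that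
            stem_rep_stem[OF \<Lambda>(1) g' I that]] hg'])
    define V where "V = slice_dom \<Lambda> I \<inter> slice_dom W I"
    have V: "open V" "z0 \<in> V" using mem \<Lambda> mem_W W(1)
      by (auto simp: V_def intro!: open_Int open_slice_dom_\<Lambda>)
    have hol: "stem g I cq_hol_on V" "stem g' I cq_hol_on V"
      by (rule cq_hol_on_subset[OF stem_holomorphic[OF W(1) g I]]
          cq_hol_on_subset[OF stem_holomorphic[OF \<Lambda>(1) g' I]]; auto simp: V_def)+
    have "cq_cplx (quad z0 z ^ m) * (cq_prod ps z * stem g I z)
        = cq_cplx (quad z0 z ^ m) * (cq_prod ps' z * stem g' I z)" if z: "z \<in> V" for z
      using stem_h[of z] stem_g1[of z] stem_h'[of z] z by (simp add: V_def)
    from cq_hol_cancel[OF _ _ V(1) _ this]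
    have all: "cq_prod ps z * stem g I z = cq_prod ps' z * stem g' I z" if "z \<in> V" for z
      using that by (simp add: cq_hol_mult cq_prod_holomorphic hol)
    have "ps = ps'"
      using linear_factors_unique[OF ps ps' V hol(1) nrm hol(2) nrm' all] stem_g1[of z0] nz1 mem_W
      by simp
    with m' show ?thesis by simp
  qed
  have "(THE m. \<exists>ps. sphere_factorization \<Omega> h (Re z0) (Im z0) C m ps) = m"
    using ex uniq by blast
  then have 1: "spherical_multiplicity \<Omega> h (Re z0) (Im z0) C = 2 * m"
    by (simp add: spherical_multiplicity_def)
  have "(THE ps. \<exists>m. sphere_factorization \<Omega> h (Re z0) (Im z0) C m ps) = ps"
    using ex uniq by blast
  then have 2: "isolated_multiplicity \<Omega> h (Re z0) (Im z0) C p = (if ps \<noteq> [] \<and> hd ps = p then length ps else 0)" for p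
    by (simp add: isolated_multiplicity_def)
  show ?thesis
    by (rule that[of "slice_dom W I" "stem g1 I" "stem g I" m ps])
      (use W(1) mem_W stem_holomorphic[OF W(1) _ I] g g1 stem_h stem_g1 nz1 nrm ps 1 2 in
        \<open>auto simp: open_slice_dom_\<Lambda>\<close>)
qed

text \<open>In terms of \<open>h = (q - p) * X\<close>, with \<open>X = b + \<i>c\<close> at \<open>p\<close>, the Cullen derivative of \<open>h\<close> at \<open>p\<close> is
  \<open>b + Ic\<close> and the spherical derivative is \<open>b - Ic\<close>.\<close>

lemma multiplicities_iff:
  assumes h: "slice_regular_on \<Omega> h" and nz: "\<exists>q\<in>\<Omega>. h q \<noteq> 0" and y: "Im z0 > 0"
    and h0: "h (slice_pt I z0) = 0"
  defines "d \<equiv> cullen_derivative h (slice_pt I z0)"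
    and "s \<equiv> cq_Im (stem h I z0) /\<^sub>R Im z0"
  shows "spherical_multiplicity \<Omega> h (Re z0) (Im z0) C \<ge> 2 \<longleftrightarrow> s = 0"
    and "spherical_multiplicity \<Omega> h (Re z0) (Im z0) C
        + isolated_multiplicity \<Omega> h (Re z0) (Im z0) C (slice_pt I z0) \<ge> 2
      \<longleftrightarrow> s = 0 \<or> d \<bullet> s = 0 \<and> d \<bullet> (I * s) = 0"
proof -
  obtain m ps G1 G U where U: "open U" "z0 \<in> U" and hol: "G1 cq_hol_on U" "G cq_hol_on U"
    and H: "\<And>z. z \<in> U \<Longrightarrow> stem h I z = cq_cplx (quad z0 z ^ m) * G1 z"
    and G1: "\<And>z. z \<in> U \<Longrightarrow> G1 z = cq_prod ps z * G z"
    and nz1: "G1 z0 \<noteq> 0" and nrm: "cq_nrm (G z0) \<noteq> 0" and ps: "set ps \<subseteq> qsphere (Re z0) (Im z0)"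
    and sm: "spherical_multiplicity \<Omega> h (Re z0) (Im z0) C = 2 * m"
    and im: "\<And>p. isolated_multiplicity \<Omega> h (Re z0) (Im z0) C p = (if ps \<noteq> [] \<and> hd ps = p then length ps else 0)"
    by (rule sphere_multiplicities[OF h nz y]) (rule that; assumption)
  have ev: "cq_eval I (stem h I z0) = 0" using stem_eval[OF slice_domain_\<Omega> h I mem_\<Omega>] h0 by simp
  \<comment> \<open>As \<open>h\<close> vanishes at the point, the real part of the stem is -I times
    its imaginary part, and both vanish together.\<close>
  have s0: "s = 0 \<longleftrightarrow> stem h I z0 = 0"
    using ev y by (auto simp: s_def cquat_eq_iff_Re_Im cq_eval_def)
  have m0: "stem h I z0 = 0 \<longleftrightarrow> m \<noteq> 0"
    using H[OF U(2)] nz1 by (cases m) (auto simp: cq_cplx_arith)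
  show "spherical_multiplicity \<Omega> h (Re z0) (Im z0) C \<ge> 2 \<longleftrightarrow> s = 0"
    unfolding sm s0 m0 by auto
  show "spherical_multiplicity \<Omega> h (Re z0) (Im z0) C
        + isolated_multiplicity \<Omega> h (Re z0) (Im z0) C (slice_pt I z0) \<ge> 2
      \<longleftrightarrow> s = 0 \<or> d \<bullet> s = 0 \<and> d \<bullet> (I * s) = 0"
  proof (cases "m = 0")
    case False
    then show ?thesis using sm s0 m0 by auto
  next
    case True
    have HG: "stem h I z = cq_prod ps z * G z" if "z \<in> U" for z
      using H[OF that] G1[OF that] True by (simp add: cq_cplx_arith)
    have Hnz: "stem h I z0 \<noteq> 0" using m0 True by simp
    have "cq_nrm (stem h I z0) = 0" using ev I cq_nrm_eq_0_iff by blast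
    then have "ps \<noteq> []" using HG[OF U(2)] nrm by auto
    then obtain a qs where pseq: "ps = a # qs" by (cases ps) auto
    with ps obtain K where K: "K \<in> \<S>" "a = slice_pt K z0" by (auto simp: qsphere_Re_Im)
    have "cq_eval K (stem h I z0) = 0"
      using HG[OF U(2)] by (simp add: pseq K(2) mult.assoc cq_eval_linear_mult[OF K(1)])
    \<comment> \<open>A nonzero stem is annihilated by at most one evaluation. So the first root in
      the list is the point itself, and the isolated multiplicity is the length of the list.\<close>
    then have "K = I" using ev Hnz cq_eval_eq_imp_eq[of K "stem h I z0" 0 I] by (auto simp: cq_eval_arith)
    define X where "X z = cq_prod qs z * G z" for z
    have X: "X cq_hol_on U"
      unfolding X_def[abs_def] by (intro cq_hol_mult cq_prod_holomorphic hol)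
    have HX: "stem h I z = cq_linear (slice_pt I z0) z * X z" if "z \<in> U" for z
      using HG[OF that] by (simp add: pseq X_def K(2) \<open>K = I\<close> mult.assoc)
    have qs: "set qs \<subseteq> qsphere (Re z0) (Im z0)" using ps pseq by simp
    have "cq_nrm (X z0) = quad z0 z0 ^ length qs * cq_nrm (G z0)"
      by (simp add: X_def cq_nrm_mult cq_nrm_prod[OF qs])
    \<comment> \<open>The norm of the quotient by the first factor vanishes at \<open>z0\<close>
      exactly if a second factor remains.\<close>
    then have nX: "cq_nrm (X z0) = 0 \<longleftrightarrow> qs \<noteq> []" using nrm by simp
    have d: "d = cq_Re (X z0) + I * cq_Im (X z0)"
      unfolding d_def
      using cullen_derivative_factor[OF slice_domain_\<Omega> h I mem_\<Omega> U X HX] by (simp add: cq_eval_def)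
    have lin: "cq_Re (cq_linear (slice_pt I z0) z0) = - (Im z0 *\<^sub>R I)"
      "cq_Im (cq_linear (slice_pt I z0) z0) = Im z0 *\<^sub>R 1"
      using I by (simp_all add: cq_linear_def quat_eq_iff imag_units_iff)
    have s: "s = cq_Re (X z0) - I * cq_Im (X z0)"
      using y by (simp add: s_def HX[OF U(2)] cq_Re_Im_mult lin scaleR_right_diff_distrib)
    have u: "q_re I = 0" using I by (simp add: imag_units_iff)
    have "norm (I * cq_Im (X z0)) = norm (cq_Im (X z0))"
      by (simp add: norm_mult norm_imag_units[OF I])
    then have ds: "d \<bullet> s = (norm (cq_Re (X z0)))\<^sup>2 - (norm (cq_Im (X z0)))\<^sup>2"
      unfolding d s power2_norm_eq_inner power_mult_distrib
      by (simp add: inner_add_left inner_add_right inner_diff_left inner_diff_right inner_commute norm_eq)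
    have Is: "I * s = I * cq_Re (X z0) + cq_Im (X z0)"
      using imag_units_mult_self[OF I] by (simp add: s right_diff_distrib mult.assoc[symmetric])
    have "(I * b) \<bullet> (I * c) = b \<bullet> c" for b c
      by (simp add: inner_quat_mult_left norm_imag_units[OF I])
    moreover have "b \<bullet> (I * b) = 0" for b using u by (simp add: inner_quat_def algebra_simps)
    ultimately have dIs: "d \<bullet> (I * s) = 2 * (cq_Re (X z0) \<bullet> cq_Im (X z0))"
      unfolding d Is by (simp add: inner_add_left inner_add_right inner_commute)
    \<comment> \<open>The two inner products are the real and the imaginary part of the norm of
      \<open>X z0\<close>.\<close>
    have "cq_nrm (X z0) = 0 \<longleftrightarrow> d \<bullet> s = 0 \<and> d \<bullet> (I * s) = 0"
      unfolding cq_nrm_eq_Complex ds dIs by (simp add: complex_eq_iff)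
    moreover have "s \<noteq> 0" using s0 Hnz by simp
    ultimately show ?thesis
      unfolding sm im using True nX K(2) \<open>K = I\<close> by (cases qs) (auto simp: pseq)
  qed
qed

end

section \<open>The real differential\<close>

text \<open>At a real point all slices meet, so continuity on each slice is not enough. Near such a
  point one function \<open>G\<close> represents \<open>g\<close> for all units, which gives an
  estimate uniform in the unit.\<close>

lemma slice_regular_continuous_real:
  assumes g: "slice_regular_on \<Omega> g" and \<Omega>: "open \<Omega>" and x: "of_real x \<in> \<Omega>"
  shows "isCont g (of_real x)"
proof -
  obtain r where r: "r > 0" "ball (of_real x) r \<subseteq> \<Omega>" using \<Omega> x by (meson open_contains_ball)
  define V where "V = ball (complex_of_real x) r"
  \<comment> \<open>\<open>slice_pt J\<close> is an isometry, so a ball around a real point is the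
    union of the images of one disc.\<close>
  have dist: "dist (of_real x) (slice_pt J z) = dist (of_real x) z" if "J \<in> \<S>" for J z
    using norm_slice_pt[OF that, of "of_real x - z"] by (simp add: slice_pt_diff dist_norm)
  have units: "Quat 0 1 0 0 \<in> \<S>" "Quat 0 0 1 0 \<in> \<S>"
    by (simp_all add: imag_units_iff)
  have "\<exists>G. G cq_hol_on V \<and> (\<forall>J\<in>\<S>. \<forall>z\<in>V. g (slice_pt J z) = cq_eval J (G z))"
  proof (rule slice_representation[OF g \<Omega>, where r = x and ?I1.0 = "Quat 0 1 0 0" and ?I2.0 = "Quat 0 0 1 0"])
    show "slice_pt J z \<in> \<Omega>" if "J \<in> \<S>" "z \<in> V" for J z
      using that r(2) dist[of J z] by (auto simp: V_def subset_iff)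
  qed (use units r(1) in \<open>auto simp: V_def\<close>)
  then obtain G where G: "G cq_hol_on V"
    and gG: "\<And>J z. J \<in> \<S> \<Longrightarrow> z \<in> V \<Longrightarrow> g (slice_pt J z) = cq_eval J (G z)" by blast
  have x_V: "of_real x \<in> V" using r(1) by (simp add: V_def)
  define E where "E z = norm (cq_Re (G z) - cq_Re (G (of_real x))) + norm (cq_Im (G z) - cq_Im (G (of_real x)))" for z
  have "continuous_on V E"
    unfolding E_def by (intro continuous_intros cq_hol_continuous G)
  then have "isCont E (of_real x)" using x_V by (simp add: V_def continuous_on_eq_continuous_at)
  moreover have "E (of_real x) = 0" by (simp add: E_def)
  ultimately have E: "(E \<longlongrightarrow> 0) (nhds (of_real x))"
    by (metis continuous_at_imp_continuous_at_within isCont_def tendsto_at_iff_tendsto_nhds)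
  have bound: "dist (g (slice_pt J z)) (g (of_real x)) \<le> E z" if "J \<in> \<S>" "z \<in> V" for J z
  proof -
    have "g (of_real x) = cq_eval J (G (of_real x))" using gG[OF that(1) x_V] by simp
    then have "dist (g (slice_pt J z)) (g (of_real x)) = norm (cq_eval J (G z - G (of_real x)))"
      using gG[OF that] by (simp add: dist_norm cq_eval_arith)
    also have "\<dots> \<le> norm (cq_Re (G z - G (of_real x))) + norm (J * cq_Im (G z - G (of_real x)))"
      unfolding cq_eval_def by (rule norm_triangle_ineq)
    also have "\<dots> = E z" by (simp add: E_def norm_mult norm_imag_units[OF that(1)])
    finally show ?thesis .
  qed
  show ?thesis
    unfolding continuous_at_eps_delta
  proof (intro allI impI)
    fix e :: real assume "e > 0"
    then have "\<forall>\<^sub>F z in nhds (of_real x). dist (E z) 0 < e" using E by (rule tendstoD[rotated])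
    then obtain d where d: "d > 0" "\<And>z. dist z (of_real x) < d \<Longrightarrow> E z < e"
      unfolding eventually_nhds_metric by force
    show "\<exists>d>0. \<forall>q. dist q (of_real x) < d \<longrightarrow> dist (g q) (g (of_real x)) < e"
    proof (intro exI[of _ "min d r"] conjI allI impI)
      fix q :: quat assume q: "dist q (of_real x) < min d r"
      obtain J z where J: "J \<in> \<S>" "q = slice_pt J z" by (rule slice_pt_cover)
      then have "dist z (of_real x) < min d r" using q dist[of J z] by (simp add: dist_commute)
      then show "dist (g q) (g (of_real x)) < e"
        using bound[OF J(1), of z] d(2)[of z] J(2) by (simp add: V_def dist_commute)
    qed (use d r in simp)
  qed
qed

text \<open>The remainder is \<open>(q - p) * (g q - g p)\<close>, which is small compared to
  \<open>q - p\<close> by continuity of \<open>g\<close> at \<open>p\<close>.\<close>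

lemma has_derivative_linear_factor:
  fixes f g :: "quat \<Rightarrow> quat"
  assumes eq: "\<forall>\<^sub>F q in nhds p. f q = f p + (q - p) * g q" and g: "isCont g p"
  shows "(f has_derivative (\<lambda>v. v * g p)) (at p)"
  unfolding has_derivative_iff_norm
proof
  show "bounded_linear (\<lambda>v. v * g p)" by (rule bounded_linear_mult_left)
  have "((\<lambda>q. norm (g q - g p)) \<longlongrightarrow> norm (g p - g p)) (at p)"
    using g unfolding isCont_def by (intro tendsto_intros)
  then have "((\<lambda>q. norm (g q - g p)) \<longlongrightarrow> 0) (at p)" by simp
  moreover have "\<forall>\<^sub>F q in at p. norm (g q - g p) = norm (f q - f p - (q - p) * g p) / norm (q - p)"
  proof -
    have "\<forall>\<^sub>F q in at p. f q = f p + (q - p) * g q"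
      using eq by (simp add: eventually_at_filter eventually_mono)
    moreover have "\<forall>\<^sub>F q in at p. q \<noteq> p" by (simp add: eventually_at_filter)
    ultimately show ?thesis
    proof eventually_elim
      case (elim q)
      then have "f q - f p - (q - p) * g p = (q - p) * (g q - g p)" by (simp add: right_diff_distrib)
      then show ?case using elim(2) by (simp add: norm_mult)
    qed
  qed
  ultimately show "((\<lambda>q. norm (f q - f p - (q - p) * g p) / norm (q - p)) \<longlongrightarrow> 0) (at p)"
    by (rule Lim_transform_eventually)
qed

text \<open>Off the real axis \<open>JJ q\<close> and \<open>zz q\<close> are differentiable in
  \<open>q\<close>, and near \<open>p\<close> the function \<open>f\<close> is
  \<open>cq_Re (G (zz q)) + JJ q * cq_Im (G (zz q))\<close>.\<close>

lemma slice_regular_differentiable_nonreal: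
  assumes \<Omega>: "slice_domain \<Omega>" and f: "slice_regular_on \<Omega> f" and I: "I \<in> \<S>"
    and z0: "slice_pt I z0 \<in> \<Omega>" "Im z0 > 0"
  shows "f differentiable (at (slice_pt I z0))"
proof -
  define p where "p = slice_pt I z0"
  obtain V d G where V: "open V" "z0 \<in> V" "d > 0" and G: "G cq_hol_on V"
    and fG: "\<And>J z. J \<in> \<S> \<Longrightarrow> dist J I < d \<Longrightarrow> z \<in> V \<Longrightarrow> f (slice_pt J z) = cq_eval J (G z)"
    using stem_exists_near[OF \<Omega> f I z0(1)] by blast
  define zz where "zz q = of_real (q_re q) + \<i> * of_real (norm (q_im q))" for q
  define JJ where "JJ q = inverse (norm (q_im q)) *\<^sub>R q_im q" for q
  have np: "norm (q_im p) = Im z0" "q_im p = Im z0 *\<^sub>R I"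
    using z0(2) by (simp_all add: p_def slice_pt_q_im[OF I] of_real_def norm_imag_units[OF I])
  have "q_re p = Re z0" unfolding p_def by (rule slice_pt_q_re[OF I])
  then have zp: "zz p = z0" by (simp add: zz_def np(1) complex_eq_iff)
  have Jp: "JJ p = I" using z0(2) by (simp add: JJ_def np(2) norm_imag_units[OF I])
  have p0: "q_im p \<noteq> 0" using np(1) z0(2) by auto
  have im: "q_im differentiable (at p)"
    unfolding q_im_def[abs_def] of_real_def
    by (intro differentiableI) (auto intro!: derivative_eq_intros)
  have N: "(\<lambda>q. norm (q_im q)) differentiable (at p)"
    using differentiable_compose[OF differentiable_norm_at[OF p0] im] by simp
  have dz: "zz differentiable (at p)"
    unfolding zz_def[abs_def] of_real_def
    by (intro differentiable_add differentiable_mult differentiable_scaleR differentiable_const N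
        bounded_linear_imp_differentiable[OF bounded_linear_quat_sel(1)])
  have dJ: "JJ differentiable (at p)"
    unfolding JJ_def[abs_def] using p0 by (intro derivative_intros N im) auto
  have "(\<lambda>z. cq_Re (G z)) differentiable (at (zz p))" "(\<lambda>z. cq_Im (G z)) differentiable (at (zz p))"
    using cq_hol_has_derivative[OF G V(1,2)] zp by (auto simp: differentiable_def)
  then have dG: "(\<lambda>q. cq_Re (G (zz q))) differentiable (at p)" "(\<lambda>q. cq_Im (G (zz q))) differentiable (at p)"
    by (auto intro: differentiable_compose[where g = zz, OF _ dz])
  have D: "(\<lambda>q. cq_Re (G (zz q)) + JJ q * cq_Im (G (zz q))) differentiable (at p)"
    by (intro differentiable_add differentiable_mult dG dJ)
  have rep: "q = slice_pt (JJ q) (zz q)" "JJ q \<in> \<S>" if "q_im q \<noteq> 0" for q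
    using slice_pt_normalize[OF that] by (simp_all add: JJ_def zz_def Complex_eq)
  have cont: "(JJ \<longlongrightarrow> I) (nhds p)" "(zz \<longlongrightarrow> z0) (nhds p)" "(q_im \<longlongrightarrow> q_im p) (nhds p)"
    using dJ dz im differentiable_imp_continuous_within[of _ p UNIV] Jp zp
    by (metis continuous_within tendsto_at_iff_tendsto_nhds)+
  have "\<forall>\<^sub>F q in nhds p. dist (JJ q) I < d" using cont(1) V(3) by (rule tendstoD)
  moreover have "\<forall>\<^sub>F q in nhds p. zz q \<in> V" using cont(2) V(1,2) by (rule topological_tendstoD)
  moreover have "\<forall>\<^sub>F q in nhds p. q_im q \<noteq> 0" using cont(3) p0 by (rule tendsto_imp_eventually_ne)
  ultimately have ev: "\<forall>\<^sub>F q in nhds p. cq_Re (G (zz q)) + JJ q * cq_Im (G (zz q)) = f q"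
  proof eventually_elim
    case (elim q)
    have "f q = cq_eval (JJ q) (G (zz q))" using fG[OF rep(2)] rep(1) elim by metis
    then show ?case by (simp add: cq_eval_def)
  qed
  obtain D' where "((\<lambda>q. cq_Re (G (zz q)) + JJ q * cq_Im (G (zz q))) has_derivative D') (at p)"
    using D unfolding differentiable_def by blast
  then have "(f has_derivative D') (at p)"
    by (rule has_derivative_transform_eventually)
      (use ev eventually_nhds_x_imp_x[OF ev] in \<open>auto simp: eventually_at_filter elim: eventually_mono\<close>)
  then show ?thesis unfolding p_def differentiable_def by blast
qed

text \<open>Within the slice the differential is that of the restriction of \<open>f\<close>. A
  direction orthogonal to the slice is tangent to the sphere through the point, on which
  \<open>f\<close> is locally affine in the unit.\<close>

lemma differential_nonreal:
  assumes \<Omega>: "slice_domain \<Omega>" and f: "slice_regular_on \<Omega> f" and I: "I \<in> \<S>"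
    and z0: "slice_pt I z0 \<in> \<Omega>" "Im z0 > 0"
    and D: "(f has_derivative D) (at (slice_pt I z0))"
  shows "D (slice_pt I w) = slice_pt I w * cullen_derivative f (slice_pt I z0)"
    and "v \<bullet> 1 = 0 \<Longrightarrow> v \<bullet> I = 0 \<Longrightarrow> D v = v * (cq_Im (stem f I z0) /\<^sub>R Im z0)"
proof -
  interpret D: bounded_linear D using D by (rule has_derivative_bounded_linear)
  define d where "d = cullen_derivative f (slice_pt I z0)"
  have "(slice_pt I has_derivative slice_pt I) (at z0)"
    unfolding slice_pt_def[abs_def] of_real_def by (auto intro!: derivative_eq_intros)
  from has_derivative_compose[OF this D]
  have "((\<lambda>z. f (slice_pt I z)) has_derivative (\<lambda>w. D (slice_pt I w))) (at z0)" .
  moreover have "((\<lambda>z. f (slice_pt I z)) has_derivative (\<lambda>w. slice_pt I w * d)) (at z0)"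
    using slice_regular_on_has_derivative[OF f slice_domain_open[OF \<Omega>] I z0(1)]
      cullen_derivative_eq[OF f slice_domain_open[OF \<Omega>] I z0(1)] by (simp add: d_def)
  ultimately have "(\<lambda>w. D (slice_pt I w)) = (\<lambda>w. slice_pt I w * d)" by (rule has_derivative_unique)
  then show "D (slice_pt I w) = slice_pt I w * cullen_derivative f (slice_pt I z0)"
    unfolding d_def by meson
  define A where "A = stem f I z0"
  show "D v = v * (cq_Im (stem f I z0) /\<^sub>R Im z0)" if v: "v \<bullet> 1 = 0" "v \<bullet> I = 0" for v
  proof (cases "v = 0")
    case True
    then show ?thesis by (simp add: D.zero)
  next
    case False
    define u where "u = v /\<^sub>R norm v"
    have u: "norm u = 1" "u \<bullet> I = 0" "q_re u = 0" "v = norm v *\<^sub>R u"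
      using False v(2) by (simp_all add: u_def)
        (use v(1) in \<open>simp add: inner_quat_def\<close>)
    \<comment> \<open>The great circle of units through \<open>I\<close> with velocity
      \<open>u\<close>; the point \<open>slice_pt (\<gamma> t) z0\<close> moves with initial
      velocity \<open>Im z0\<close> times \<open>u\<close>.\<close>
    define \<gamma> where "\<gamma> t = cos t *\<^sub>R I + sin t *\<^sub>R u" for t
    have unit: "\<gamma> t \<in> \<S>" for t
    proof -
      have "(norm (\<gamma> t))\<^sup>2 = (cos t)\<^sup>2 * (norm I)\<^sup>2 + (sin t)\<^sup>2 * (norm u)\<^sup>2"
        unfolding power2_norm_eq_inner \<gamma>_def
        by (simp add: inner_add_left inner_add_right inner_commute[of I u] u(2) power2_eq_square)
      then have "(norm (\<gamma> t))\<^sup>2 = 1" by (simp add: u(1) norm_imag_units[OF I])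
      moreover have "q_re (\<gamma> t) = 0" using u(3) I by (simp add: \<gamma>_def imag_units_iff)
      ultimately show ?thesis unfolding norm_quat_square imag_units_iff by simp
    qed
    have d\<gamma>: "(\<gamma> has_derivative (\<lambda>h. h *\<^sub>R u)) (at 0)"
      unfolding \<gamma>_def[abs_def] by (auto intro!: derivative_eq_intros)
    have "((\<lambda>t. slice_pt (\<gamma> t) z0) has_derivative (\<lambda>h. of_real (Im z0) * (h *\<^sub>R u))) (at 0)"
      unfolding slice_pt_def by (auto intro!: derivative_eq_intros d\<gamma>)
    from has_derivative_compose[OF this, of f D] D
    have 1: "((\<lambda>t. f (slice_pt (\<gamma> t) z0)) has_derivative (\<lambda>h. D (of_real (Im z0) * (h *\<^sub>R u)))) (at 0)"
      by (simp add: \<gamma>_def)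
    obtain e where e: "e > 0" "\<And>J. J \<in> \<S> \<Longrightarrow> dist J I < e \<Longrightarrow> f (slice_pt J z0) = cq_eval J A"
      using stem_rep_stem[OF \<Omega> f I z0(1)] unfolding stem_rep_def A_def by blast
    have "(\<gamma> \<longlongrightarrow> I) (nhds 0)"
    proof -
      have "\<gamma> 0 = I" by (simp add: \<gamma>_def)
      then show ?thesis
        using has_derivative_continuous[OF d\<gamma>] by (metis isCont_def tendsto_at_iff_tendsto_nhds)
    qed
    then have "\<forall>\<^sub>F t in nhds 0. dist (\<gamma> t) I < e" using e(1) by (rule tendstoD)
    then have ev: "\<forall>\<^sub>F t in nhds 0. cq_eval (\<gamma> t) A = f (slice_pt (\<gamma> t) z0)"
      by eventually_elim (use e(2) unit in simp)
    have "((\<lambda>t. cq_eval (\<gamma> t) A) has_derivative (\<lambda>h. (h *\<^sub>R u) * cq_Im A)) (at 0)"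
      unfolding cq_eval_def by (auto intro!: derivative_eq_intros d\<gamma>)
    then have 2: "((\<lambda>t. f (slice_pt (\<gamma> t) z0)) has_derivative (\<lambda>h. (h *\<^sub>R u) * cq_Im A)) (at 0)"
      by (rule has_derivative_transform_eventually)
        (use ev eventually_nhds_x_imp_x[OF ev] in \<open>auto simp: eventually_at_filter elim: eventually_mono\<close>)
    have "D (of_real (Im z0) * (1 *\<^sub>R u)) = (1 *\<^sub>R u) * cq_Im A"
      using has_derivative_unique[OF 1 2] by meson
    then have "Im z0 *\<^sub>R D u = u * cq_Im A" by (simp add: of_real_def D.scaleR)
    then have "D u = inverse (Im z0) *\<^sub>R (u * cq_Im A)"
      using z0(2) by (metis less_irrefl scaleR_one scaleR_scaleR left_inverse)
    then have "D u = u * (cq_Im A /\<^sub>R Im z0)" by simp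
    then have "D (norm v *\<^sub>R u) = (norm v *\<^sub>R u) * (cq_Im A /\<^sub>R Im z0)" by (simp add: D.scaleR)
    then show ?thesis using u(4) by (simp add: A_def)
  qed
qed

text \<open>\<open>v \<mapsto> v\<^sub>1 d + v\<^sub>2 s\<close>, with \<open>v\<^sub>1\<close> and \<open>v\<^sub>2\<close> the components of \<open>v\<close> in \<open>\<real> + I\<real>\<close> and in its orthogonal
  complement, has a kernel iff \<open>d s\<^sup>-\<^sup>1\<close> lies in this complement or \<open>s = 0\<close>.\<close>

lemma bij_slice_decomposed_linear_iff:
  assumes I: "I \<in> \<S>" and D: "linear D"
    and D1: "\<And>w. D (slice_pt I w) = slice_pt I w * d"
    and D2: "\<And>v. v \<bullet> 1 = 0 \<Longrightarrow> v \<bullet> I = 0 \<Longrightarrow> D v = v * s"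
  shows "\<not> bij D \<longleftrightarrow> s = 0 \<or> d \<bullet> s = 0 \<and> d \<bullet> (I * s) = 0"
proof -
  have I0: "q_re I = 0" "I \<bullet> I = 1" "1 \<bullet> I = 0" "I \<bullet> 1 = 0"
    using I norm_imag_units[OF I] by (simp_all add: imag_units_iff norm_eq_1 inner_quat_def)
  have bij: "bij D \<longleftrightarrow> (\<forall>v. D v = 0 \<longrightarrow> v = 0)"
  proof
    assume "bij D"
    then show "\<forall>v. D v = 0 \<longrightarrow> v = 0"
      using linear_0[OF D] by (metis bij_pointE)
  next
    assume "\<forall>v. D v = 0 \<longrightarrow> v = 0"
    then have "inj D" using linear_injective_0[OF D] by blast
    then show "bij D" using linear_injective_imp_surjective[OF D] by (simp add: bij_def)
  qed
  have split: "\<exists>w v2. v = slice_pt I w + v2 \<and> v2 \<bullet> 1 = 0 \<and> v2 \<bullet> I = 0" for v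
  proof (intro exI conjI)
    show "v = slice_pt I (Complex (v \<bullet> 1) (v \<bullet> I)) + (v - slice_pt I (Complex (v \<bullet> 1) (v \<bullet> I)))" by simp
    show "(v - slice_pt I (Complex (v \<bullet> 1) (v \<bullet> I))) \<bullet> 1 = 0" "(v - slice_pt I (Complex (v \<bullet> 1) (v \<bullet> I))) \<bullet> I = 0"
      using I0 by (simp_all add: slice_pt_def of_real_def inner_diff_left inner_add_left norm_eq_1[symmetric])
  qed
  have ann: "(v * s) \<bullet> s = 0" "(v * s) \<bullet> (I * s) = 0" if "v \<bullet> 1 = 0" "v \<bullet> I = 0" for v
    using that inner_quat_mult_right[of v s 1] inner_quat_mult_right[of v s I] by simp_all
  have Id: "(I * d) \<bullet> s = - (d \<bullet> (I * s))" "(I * d) \<bullet> (I * s) = d \<bullet> s"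
    using I0(1) by (simp_all add: inner_quat_mult_left norm_imag_units[OF I])
      (simp add: inner_quat_def algebra_simps)
  show ?thesis
  proof (cases "s = 0")
    case True
    obtain v where v: "v * I \<noteq> I * v" using imag_units_not_central[OF I] by blast
    \<comment> \<open>A commutator with \<open>I\<close> is orthogonal to 1 and to \<open>I\<close>,
      so a nonzero one lies in the kernel when \<open>s = 0\<close>.\<close>
    define w where "w = v * I - I * v"
    have "w \<bullet> 1 = 0" "w \<bullet> I = 0" using I0(1) by (simp_all add: w_def inner_quat_def algebra_simps)
    then have "D w = 0" using D2 True by simp
    then show ?thesis using bij v True by (auto simp: w_def)
  next
    case False
    have "d \<bullet> s = 0 \<and> d \<bullet> (I * s) = 0" if nb: "\<not> bij D"
    proof -
      obtain v where v: "D v = 0" "v \<noteq> 0" using nb bij by blast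
      obtain w v2 where w: "v = slice_pt I w + v2" "v2 \<bullet> 1 = 0" "v2 \<bullet> I = 0" using split by blast
      have "D v = slice_pt I w * d + v2 * s" using w D1 D2 by (simp add: linear_add[OF D])
      then have e: "slice_pt I w * d = - (v2 * s)" using v(1) by (simp add: eq_neg_iff_add_eq_0)
      define P Q where "P = d \<bullet> s" and "Q = d \<bullet> (I * s)"
      have pt: "slice_pt I w * d = Re w *\<^sub>R d + Im w *\<^sub>R (I * d)"
        by (simp add: slice_pt_def of_real_def distrib_right)
      have "(slice_pt I w * d) \<bullet> s = 0" "(slice_pt I w * d) \<bullet> (I * s) = 0"
        unfolding e using ann[OF w(2,3)] by simp_all
      \<comment> \<open>In complex form the two equations read w(P + \<i>Q) = 0.\<close>
      then have 1: "Re w * P - Im w * Q = 0" "Re w * Q + Im w * P = 0"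
        unfolding pt by (simp_all add: inner_add_left Id P_def Q_def)
      have "w \<noteq> 0"
      proof
        assume "w = 0"
        then have "v2 * s = 0" using e by (simp add: slice_pt_def)
        then show False using \<open>s \<noteq> 0\<close> v(2) w(1) \<open>w = 0\<close> by (simp add: slice_pt_def)
      qed
      then have "(Re w)\<^sup>2 + (Im w)\<^sup>2 \<noteq> 0" by (simp add: sum_power2_eq_zero_iff complex_eq_iff)
      moreover have "((Re w)\<^sup>2 + (Im w)\<^sup>2) * P = 0" "((Re w)\<^sup>2 + (Im w)\<^sup>2) * Q = 0"
        using 1 by algebra+
      ultimately have "P = 0" "Q = 0" unfolding mult_eq_0_iff by blast+
      then show ?thesis by (simp add: P_def Q_def)
    qed
    moreover have "\<not> bij D" if PQ: "d \<bullet> s = 0" "d \<bullet> (I * s) = 0"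
    proof -
      \<comment> \<open>Chosen so that \<open>1 + v2\<close> is sent to
        \<open>d + v2 * s = 0\<close>.\<close>
      define v2 where "v2 = - (d * inverse s)"
      have v2s: "v2 * s = - d" using False by (simp add: v2_def mult.assoc)
      have "(norm s)\<^sup>2 * (v2 \<bullet> 1) = 0" "(norm s)\<^sup>2 * (v2 \<bullet> I) = 0"
        using inner_quat_mult_right[of v2 s 1] inner_quat_mult_right[of v2 s I] PQ v2s by simp_all
      then have v2: "v2 \<bullet> 1 = 0" "v2 \<bullet> I = 0" using False by simp_all
      have "D (slice_pt I 1 + v2) = 0"
        using D1[of 1] D2[OF v2] v2s by (simp add: linear_add[OF D]) (simp add: slice_pt_def)
      moreover have "(slice_pt I 1 + v2) \<bullet> 1 = 1"
        using v2(1) by (simp add: inner_add_left slice_pt_def norm_eq_1[symmetric])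
      then have "slice_pt I 1 + v2 \<noteq> 0" by auto
      ultimately show ?thesis using bij by blast
    qed
    ultimately show ?thesis using False by blast
  qed
qed

section \<open>A slice domain meeting the sphere in a single component\<close>

text \<open>The stem is locally constant in the unit, hence constant along the connected set
  \<open>C\<close>.\<close>

lemma stem_const_on_connected:
  assumes \<Lambda>: "slice_domain \<Lambda>" and g: "slice_regular_on \<Lambda> g" and y: "Im z0 > 0"
    and C: "connected C" "C \<subseteq> \<Lambda>" "C \<subseteq> qsphere (Re z0) (Im z0)"
    and I: "I \<in> \<S>" "slice_pt I z0 \<in> C" and J: "J \<in> \<S>" "slice_pt J z0 \<in> C"
  shows "stem g J z0 = stem g I z0"
proof -
  define N where "N q = (q - of_real (Re z0)) /\<^sub>R Im z0" for q :: quat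
  have N: "N (slice_pt J z0) = J" for J using y by (simp add: N_def slice_pt_def of_real_def)
  have "stem g (N (slice_pt J z0)) z0 = stem g (N (slice_pt I z0)) z0"
  proof (rule connected_local_const[where f = "\<lambda>q. stem g (N q) z0", OF C(1) J(2) I(2)], intro ballI)
    fix q assume q: "q \<in> C"
    then obtain K where K: "K \<in> \<S>" "q = slice_pt K z0" using C(3) by (auto simp: qsphere_Re_Im)
    have "slice_pt K z0 \<in> \<Lambda>" using q K C(2) by blast
    from stem_rep_near[OF stem_rep_stem[OF \<Lambda> g K(1) this]]
    obtain e where e: "e > 0" "\<And>L. L \<in> \<S> \<Longrightarrow> dist L K < e \<Longrightarrow> stem_rep g L z0 (stem g K z0)"
      by blast
    have "continuous_on UNIV N" unfolding N_def[abs_def] by (intro continuous_intros)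
    then have "(N \<longlongrightarrow> N q) (at q within C)"
      by (meson UNIV_I continuous_on_def subset_UNIV tendsto_within_subset)
    then have "\<forall>\<^sub>F q' in at q within C. dist (N q') K < e"
      using e(1) K(2) by (auto simp: N dest: tendstoD)
    moreover have "\<forall>\<^sub>F q' in at q within C. q' \<in> C" by (simp add: eventually_at_filter)
    ultimately show "\<forall>\<^sub>F q' in at q within C. stem g (N q) z0 = stem g (N q') z0"
    proof eventually_elim
      case (elim q')
      then obtain L where L: "L \<in> \<S>" "q' = slice_pt L z0" using C(3) by (auto simp: qsphere_Re_Im)
      with elim e(2) have "stem_rep g L z0 (stem g K z0)" by (simp add: N)
      then show ?case using L K stem_eqI by (simp add: N)
    qed
  qed
  then show ?thesis by (simp add: N)
qed

text \<open>Off the sphere this holds because the sphere is closed. At a point of \<open>C\<close>,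
  the radial projection \<open>r\<close> maps a small ball to a connected subset of the sphere
  inside \<Omega>, so the points of the ball that lie on the sphere stay in
  \<open>C\<close>.\<close>

lemma open_Diff_other_components:
  assumes \<Omega>: "open \<Omega>" and y: "y > 0"
    and C: "C = connected_component_set (qsphere x y \<inter> \<Omega>) p" 
  shows "open (\<Omega> - (qsphere x y - C))"
proof -
  define r where "r q = of_real x + of_real y * (q_im q /\<^sub>R norm (q_im q))" for q
  have cr: "continuous_on {q. q_im q \<noteq> 0} r"
    unfolding r_def[abs_def] q_im_def of_real_def by (intro continuous_intros) auto
  have cim: "continuous_on UNIV q_im" unfolding q_im_def[abs_def] of_real_def by (intro continuous_intros)
  then have "open (q_im -` (- {0}))" by (intro open_vimage) auto
  then have op0: "open {q. q_im q \<noteq> 0}" by (simp add: vimage_def Compl_eq)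
  have rS: "r q \<in> qsphere x y" if "q_im q \<noteq> 0" for q
    unfolding r_def qsphere_def using slice_pt_normalize(1)[OF that] by blast
  have S: "q_im q \<noteq> 0 \<and> r q = q" if q: "q \<in> qsphere x y" for q
  proof -
    from q obtain J where J: "J \<in> \<S>" "q = slice_pt J (Complex x y)" by (auto simp: qsphere_eq)
    have im: "q_im q = y *\<^sub>R J" "norm (q_im q) = y"
      using y by (simp_all add: J(2) slice_pt_q_im[OF J(1)] slice_pt_norm_q_im[OF J(1)] of_real_def norm_imag_units[OF J(1)])
    then show ?thesis using y imag_units_nonzero[OF J(1)]
      by (simp add: r_def J(2)) (simp add: slice_pt_def)
  qed
  have CT: "C \<subseteq> qsphere x y \<inter> \<Omega>" unfolding C by (rule connected_component_subset)
  have closed: "closed (qsphere x y)"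
  proof -
    have "qsphere x y = {q. q_re q = x} \<inter> {q. norm (q_im q) = y}"
    proof (intro equalityI subsetI)
      fix q assume "q \<in> qsphere x y"
      then obtain J where J: "J \<in> \<S>" "q = slice_pt J (Complex x y)" by (auto simp: qsphere_eq)
      show "q \<in> {q. q_re q = x} \<inter> {q. norm (q_im q) = y}"
        using y slice_pt_q_re[OF J(1)] slice_pt_norm_q_im[OF J(1)] J(2) by (simp del: slice_pt_sel)
    next
      fix q assume q: "q \<in> {q. q_re q = x} \<inter> {q. norm (q_im q) = y}"
      then have n: "q_im q \<noteq> 0" using y by auto
      have "r q = of_real x + q_im q" using q y by (simp add: r_def of_real_def)
      also have "\<dots> = q" using q by (simp add: q_im_def)
      finally show "q \<in> qsphere x y" using rS[OF n] by simp
    qed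
    moreover have "closed {q. q_re q = x}" "closed {q. norm (q_im q) = y}"
      by (intro closed_Collect_eq continuous_intros cim)+
    ultimately show ?thesis by (simp add: closed_Int)
  qed
  show ?thesis
    unfolding open_contains_ball
  proof
    fix q assume q: "q \<in> \<Omega> - (qsphere x y - C)"
    show "\<exists>e>0. ball q e \<subseteq> \<Omega> - (qsphere x y - C)"
    proof (cases "q \<in> qsphere x y")
      case False
      have "open (\<Omega> - qsphere x y)" using \<Omega> closed by (rule open_Diff)
      then obtain e where "e > 0" "ball q e \<subseteq> \<Omega> - qsphere x y"
        using False q open_contains_ball by blast
      then show ?thesis by blast
    next
      case True
      then have qC: "q \<in> C" using q by blast
      have "open {q'\<in>{q. q_im q \<noteq> 0}. r q' \<in> \<Omega>}"
        using continuous_open_preimage[OF cr op0 \<Omega>] by (simp add: vimage_def Int_def)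
      moreover have "q \<in> {q'\<in>{q. q_im q \<noteq> 0}. r q' \<in> \<Omega>}" using S[OF True] q by simp
      ultimately obtain e1 where e1: "e1 > 0" "ball q e1 \<subseteq> {q'\<in>{q. q_im q \<noteq> 0}. r q' \<in> \<Omega>}"
        using open_contains_ball by blast
      obtain e2 where e2: "e2 > 0" "ball q e2 \<subseteq> \<Omega>" using \<Omega> q open_contains_ball by blast
      have "connected (r ` ball q e1)"
        by (rule connected_continuous_image[OF continuous_on_subset[OF cr]]) (use e1 in auto)
      moreover have "r ` ball q e1 \<subseteq> qsphere x y \<inter> \<Omega>" using e1(2) rS by auto
      moreover have "q \<in> r ` ball q e1" using S[OF True] e1(1) by (intro image_eqI[of _ _ q]) auto
      ultimately have "r ` ball q e1 \<subseteq> connected_component_set (qsphere x y \<inter> \<Omega>) q"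
        by (intro connected_component_maximal)
      also have "\<dots> = C" using qC connected_component_eq[of q "qsphere x y \<inter> \<Omega>" p] C by simp
      finally have rC: "r ` ball q e1 \<subseteq> C" .
      have "ball q (min e1 e2) \<subseteq> \<Omega> - (qsphere x y - C)"
      proof
        fix q' assume q': "q' \<in> ball q (min e1 e2)"
        have "q' \<in> C" if "q' \<in> qsphere x y" using S[OF that] rC q' by force
        then show "q' \<in> \<Omega> - (qsphere x y - C)" using q' e2 by auto
      qed
      then show ?thesis using e1(1) e2(1) by (intro exI[of _ "min e1 e2"]) auto
    qed
  qed
qed

text \<open>Each slice loses at most two points, which does not disconnect an open connected subset
  of a plane, and the slices still share a real point because the sphere avoids the real
  axis.\<close>

lemma slice_domain_Diff_other_components:
  assumes \<Omega>: "slice_domain \<Omega>" and y: "y > 0"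
    and C: "C = connected_component_set (qsphere x y \<inter> \<Omega>) p"
  shows "slice_domain (\<Omega> - (qsphere x y - C))"
proof -
  define \<Lambda> where "\<Lambda> = \<Omega> - (qsphere x y - C)"
  define z0 where "z0 = Complex x y"
  have op: "open \<Lambda>"
    unfolding \<Lambda>_def by (rule open_Diff_other_components[OF slice_domain_open[OF \<Omega>] y C])
  have zz: "z = z0 \<or> z = cnj z0" if "J \<in> \<S>" "slice_pt J z \<in> qsphere x y" for J z
  proof -
    from that(2) obtain K where K: "K \<in> \<S>" "slice_pt J z = slice_pt K z0"
      by (auto simp: qsphere_eq z0_def)
    then show ?thesis
      using slice_pt_q_re[OF that(1), of z] slice_pt_q_re[OF K(1), of z0]
        slice_pt_norm_q_im[OF that(1), of z] slice_pt_norm_q_im[OF K(1), of z0] y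
      by (auto simp: complex_eq_iff z0_def abs_if split: if_splits)
  qed
  have reals: "of_real r \<in> \<Lambda>" if "of_real r \<in> \<Omega>" for r
  proof -
    have "Quat 0 1 0 0 \<in> \<S>" by (simp add: imag_units_iff)
    from zz[OF this, of "of_real r"] have "of_real r \<notin> qsphere x y"
      using y by (auto simp: z0_def complex_eq_iff)
    with that show ?thesis by (simp add: \<Lambda>_def)
  qed
  obtain r where "of_real r \<in> \<Omega>" using slice_domain_real_point[OF \<Omega>] by blast
  then have r: "of_real r \<in> \<Lambda>" by (rule reals)
  have sl: "slice J = range (slice_pt J)" for J
    by (auto simp: slice_def slice_pt_def image_iff) (metis complex.sel)
  have con: "connected (\<Lambda> \<inter> slice J)" if J: "J \<in> \<S>" for J
  proof -
    define F where "F = {z. (z = z0 \<or> z = cnj z0) \<and> slice_pt J z \<notin> \<Lambda>}"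
    have "finite F" by (rule finite_subset[of _ "{z0, cnj z0}"]) (auto simp: F_def)
    have "slice_dom \<Lambda> J = slice_dom \<Omega> J - F"
      by (auto simp: \<Lambda>_def F_def dest: zz[OF J])
    moreover have "connected (slice_dom \<Omega> J - F)"
      using \<open>finite F\<close> connected_slice_dom[OF \<Omega> J] open_slice_dom[OF slice_domain_open[OF \<Omega>]]
      by (intro connected_open_diff_countable) (auto simp: countable_finite)
    moreover have "\<Lambda> \<inter> slice J = slice_pt J ` slice_dom \<Lambda> J" by (auto simp: sl)
    ultimately show ?thesis
      by (simp add: connected_continuous_image continuous_on_slice_pt continuous_on_const continuous_on_id)
  qed
  have rJ: "of_real r \<in> \<Lambda> \<inter> slice J" for J
    using r by (auto simp: sl intro!: image_eqI[of _ _ "of_real r"])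
  have "\<Lambda> = \<Union>((\<lambda>J. \<Lambda> \<inter> slice J) ` \<S>)"
    using slice_pt_cover by (auto simp: sl) (metis rangeI)
  moreover have "connected (\<Union>((\<lambda>J. \<Lambda> \<inter> slice J) ` \<S>))"
  proof (rule connected_Union)
    show "\<Inter>((\<lambda>J. \<Lambda> \<inter> slice J) ` \<S>) \<noteq> {}" using rJ by blast
  qed (use con in auto)
  ultimately have "connected \<Lambda>" by simp
  moreover have "openin (top_of_set (slice J)) (\<Lambda> \<inter> slice J)" for J
    using op by (metis Int_commute openin_open_Int)
  ultimately show ?thesis
    unfolding \<Lambda>_def[symmetric] slice_domain_def using op con r rJ by (auto simp: Reals_def)
qed

section \<open>Subtraction of the value at the point, and conclusion\<close>

lemma slice_regular_on_diff_const:
  assumes "slice_domain \<Omega>" "slice_regular_on \<Omega> f"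
  shows "slice_regular_on \<Omega> (\<lambda>q. f q - c)"
proof (rule slice_regular_onI)
  show "open \<Omega>" using assms(1) by (rule slice_domain_open)
  fix I assume I: "I \<in> \<S>"
  have "(\<lambda>z. stem f I z - cq_quat c) cq_hol_on slice_dom \<Omega> I"
    by (intro cq_hol_diff stem_holomorphic assms I cq_hol_const)
  moreover have "f (slice_pt I z) - c = cq_eval I (stem f I z - cq_quat c)" if "slice_pt I z \<in> \<Omega>" for z
    using stem_eval[OF assms I that] by (simp add: cq_eval_arith)
  ultimately show "\<exists>G. G cq_hol_on slice_dom \<Omega> I \<and>
      (\<forall>z. slice_pt I z \<in> \<Omega> \<longrightarrow> f (slice_pt I z) - c = cq_eval I (G z))" by blast
qed

lemma cullen_derivative_diff_const: "cullen_derivative (\<lambda>q. f q - c) = cullen_derivative f"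
proof -
  have "((\<lambda>t. g t - c) has_vector_derivative v) F \<longleftrightarrow> (g has_vector_derivative v) F"
    for g :: "real \<Rightarrow> quat" and v F
    using has_vector_derivative_diff_const[of g c v F] by simp
  then show ?thesis
    unfolding cullen_derivative_def[abs_def] slice_dx_def slice_dy_def vector_derivative_def by simp
qed

theorem theorem8p8:
  fixes \<Omega> :: "quat set" and f h :: "quat \<Rightarrow> quat" and p :: quat
  assumes "slice_domain \<Omega>"
    and "slice_regular_on \<Omega> f"
    and "\<not> f constant_on \<Omega>"
    and "p \<in> \<Omega>"
    and "h = (\<lambda>q. f q - f p)"
  shows "(p \<in> \<real> \<longrightarrow>
            (\<not> bij (frechet_derivative f (at p)) \<longleftrightarrow> cullen_derivative f p = 0) \<and>
            (cullen_derivative f p = 0 \<longleftrightarrow> classical_multiplicity \<Omega> h {p} p \<ge> 2))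
       \<and> (\<forall>x y I C.
            y > 0 \<and> I \<in> imag_units \<and> p = of_real x + of_real y * I \<and>
            C = connected_component_set (qsphere x y \<inter> \<Omega>) p \<longrightarrow>
              (\<not> bij (frechet_derivative f (at p)) \<longleftrightarrow>
                 spherical_multiplicity \<Omega> h x y C + isolated_multiplicity \<Omega> h x y C p \<ge> 2) \<and>
              (spherical_derivative \<Omega> f p = 0 \<longleftrightarrow> spherical_multiplicity \<Omega> h x y C \<ge> 2) \<and>
              (cullen_derivative f p = 0 \<longleftrightarrow> classical_multiplicity \<Omega> h C p \<ge> 2))"
proof -
  note \<Omega> = assms(1) and f = assms(2)
  have op: "open \<Omega>" using \<Omega> by (rule slice_domain_open)
  have h: "slice_regular_on \<Omega> h" unfolding assms(5) by (rule slice_regular_on_diff_const[OF \<Omega> f])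
  have nz: "\<exists>q\<in>\<Omega>. h q \<noteq> 0" using assms(3) unfolding constant_on_def assms(5) by auto
  have hp: "h p = 0" by (simp add: assms(5))
  have cull: "cullen_derivative h = cullen_derivative f"
    unfolding assms(5) by (rule cullen_derivative_diff_const)
  have real: "(\<not> bij (frechet_derivative f (at p)) \<longleftrightarrow> cullen_derivative f p = 0) \<and>
            (cullen_derivative f p = 0 \<longleftrightarrow> classical_multiplicity \<Omega> h {p} p \<ge> 2)" if "p \<in> \<real>"
  proof -
    from that obtain x where x: "p = of_real x" by (elim Reals_cases)
    define I where "I = Quat 0 1 0 0"
    have I: "I \<in> imag_units" by (simp add: I_def imag_units_iff)
    have pI: "slice_pt J (of_real x) = p" for J by (simp add: x)
    \<comment> \<open>At a real point the sphere is the point itself, so \<Omega> can serve as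
      \<open>W\<close>, and all stems there are determined by the value.\<close>
    interpret sphere_component \<Omega> "{p}" \<Omega> I "of_real x"
    proof
      show "{p} \<subseteq> qsphere (Re (of_real x)) (Im (of_real x))"
        unfolding qsphere_Re_Im pI using I by auto
      show "stem g J (of_real x) = stem g I (of_real x)" if "J \<in> imag_units" for g J
        using that I by (simp add: stem_of_real)
    qed (use \<Omega> I assms(4) in \<open>auto simp: x\<close>)
    have cm: "classical_multiplicity \<Omega> h {p} p \<ge> 2 \<longleftrightarrow> cullen_derivative h p = 0"
      using classical_multiplicity_ge_2_iff[OF h nz] hp by (simp add: x)
    obtain g where g: "slice_regular_on \<Omega> g" and hg: "\<And>q. q \<in> \<Omega> \<Longrightarrow> h q = (q - p) * g q"
      using slice_regular_divide_linear_real[OF \<Omega> h, of x] hp by (auto simp: x)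
    have cg: "cullen_derivative h p = g p"
    proof -
      have "stem h I z = cq_linear p z * stem g I z" if "slice_pt I z \<in> \<Omega>" for z
      proof (rule stem_eq_mult[OF \<Omega> g I _ stem_rep_linear that])
        show "h q = star \<Omega> (\<lambda>q. q - p) g q" if "q \<in> \<Omega>" for q
          using star_linear_real[OF \<Omega> g that, of x] hg[OF that] by (simp add: x)
      qed
      then have "cullen_derivative h (slice_pt I (of_real x)) = cq_eval I (stem g I (of_real x))"
        using assms(4) open_slice_dom[OF op] stem_holomorphic[OF \<Omega> g I]
        by (intro cullen_derivative_factor[OF \<Omega> h I, where U = "slice_dom \<Omega> I"]) (auto simp: x)
      also have "\<dots> = g p" using stem_eval[OF \<Omega> g I, of "of_real x"] assms(4) by (simp add: x)
      finally show ?thesis by (simp add: x)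
    qed
    \<comment> \<open>As \<open>p\<close> is real, the star product with \<open>q - p\<close> is
      pointwise. So the real differential is right multiplication by \<open>g p\<close>, which is
      the Cullen derivative.\<close>
    have "\<forall>\<^sub>F q in nhds p. f q = f p + (q - p) * g q"
      using op assms(4) hg unfolding eventually_nhds assms(5) by (intro exI[of _ \<Omega>]) (auto simp: algebra_simps)
    moreover have "isCont g p"
      using slice_regular_continuous_real[OF g op] assms(4) by (simp add: x)
    ultimately have "(f has_derivative (\<lambda>v. v * g p)) (at p)" by (rule has_derivative_linear_factor)
    then have "frechet_derivative f (at p) = (\<lambda>v. v * g p)" by (metis frechet_derivative_at)
    moreover have "\<not> bij (\<lambda>v. v * g p) \<longleftrightarrow> g p = 0"
    proof
      show "g p = 0" if "\<not> bij (\<lambda>v. v * g p)"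
      proof (rule ccontr)
        assume "g p \<noteq> 0"
        then have "bij (\<lambda>v. v * g p)"
          by (intro o_bij[of "\<lambda>v. v * inverse (g p)"]) (auto simp: fun_eq_iff mult.assoc)
        with that show False ..
      qed
      show "\<not> bij (\<lambda>v. v * g p)" if "g p = 0"
      proof
        assume "bij (\<lambda>v. v * g p)"
        then have "(0 :: quat) = 1" using that by (auto dest!: bij_is_inj injD[of _ 0 1])
        then show False by simp
      qed
    qed
    ultimately show ?thesis using cm cg cull by simp
  qed
  have nonreal: "(\<not> bij (frechet_derivative f (at p)) \<longleftrightarrow>
                 spherical_multiplicity \<Omega> h x y C + isolated_multiplicity \<Omega> h x y C p \<ge> 2) \<and>
              (spherical_derivative \<Omega> f p = 0 \<longleftrightarrow> spherical_multiplicity \<Omega> h x y C \<ge> 2) \<and>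
              (cullen_derivative f p = 0 \<longleftrightarrow> classical_multiplicity \<Omega> h C p \<ge> 2)"
    if y: "y > 0" and I: "I \<in> imag_units" and p: "p = of_real x + of_real y * I"
      and C: "C = connected_component_set (qsphere x y \<inter> \<Omega>) p" for x y I C
  proof -
    define z0 where "z0 = Complex x y"
    have z0: "Re z0 = x" "Im z0 = y" by (simp_all add: z0_def)
    have pz: "slice_pt I z0 = p" by (simp add: z0_def p slice_pt_Complex)
    \<comment> \<open>Takes the role of \<open>W\<close>: the sphere is kept only along
      \<open>C\<close>.\<close>
    define \<Lambda> where "\<Lambda> = \<Omega> - (qsphere x y - C)"
    have "p \<in> qsphere x y \<inter> \<Omega>" using assms(4) I by (auto simp: p qsphere_def)
    then have pC: "p \<in> C" by (simp add: C)
    have C_sub: "C \<subseteq> qsphere x y \<inter> \<Omega>" unfolding C by (rule connected_component_subset)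
    have C_con: "connected C" unfolding C by (rule connected_connected_component)
    interpret sphere_component \<Omega> C \<Lambda> I z0
    proof
      show "slice_domain \<Lambda>"
        unfolding \<Lambda>_def by (rule slice_domain_Diff_other_components[OF \<Omega> y C])
      show "slice_pt J z0 \<in> C" if "J \<in> imag_units" "slice_pt J z0 \<in> \<Lambda>" for J
      proof -
        have "slice_pt J z0 \<in> qsphere x y" using that(1) by (auto simp: qsphere_eq z0_def)
        then show ?thesis using that(2) by (auto simp: \<Lambda>_def)
      qed
      show "stem g J z0 = stem g I z0" if "slice_domain \<Lambda>" "C \<subseteq> \<Lambda>" "slice_regular_on \<Lambda> g"
        "J \<in> imag_units" "slice_pt J z0 \<in> C" for \<Lambda> g J
        using stem_const_on_connected[OF that(1,3) _ C_con that(2) _ I _ that(4,5)] C_sub pC y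
        by (auto simp: z0 pz)
    qed (use \<Omega> I C_sub pC in \<open>auto simp: \<Lambda>_def pz z0\<close>)
    define s where "s = cq_Im (stem f I z0) /\<^sub>R y"
    have y': "Im z0 > 0" using y by (simp add: z0)
    have pz\<Omega>: "slice_pt I z0 \<in> \<Omega>" using assms(4) by (simp add: pz)
    \<comment> \<open>Subtracting a constant changes only the real part of the stem, so
      \<open>f\<close> and \<open>h\<close> share the spherical derivative.\<close>
    have "stem h I z0 = stem f I z0 - cq_quat (f p)"
      unfolding assms(5)
      by (intro stem_eqI I stem_rep_diff_const stem_rep_stem[OF \<Omega> f I pz\<Omega>])
    then have s_h: "cq_Im (stem h I z0) /\<^sub>R Im z0 = s" by (simp add: s_def z0)
    have "spherical_derivative \<Omega> f p = s"
      using spherical_value_derivative_eq(2)[OF I stem_rep_stem[OF \<Omega> f I pz\<Omega>] op pz\<Omega>] y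
      by (simp add: s_def z0 pz)
    obtain D where D: "(f has_derivative D) (at (slice_pt I z0))"
      using slice_regular_differentiable_nonreal[OF \<Omega> f I pz\<Omega> y'] unfolding differentiable_def by blast
    have "\<not> bij D \<longleftrightarrow> s = 0 \<or> cullen_derivative f p \<bullet> s = 0 \<and> cullen_derivative f p \<bullet> (I * s) = 0"
    proof (rule bij_slice_decomposed_linear_iff[OF I])
      show "linear D" using D by (rule has_derivative_linear)
      show "D (slice_pt I w) = slice_pt I w * cullen_derivative f p" for w
        using differential_nonreal(1)[OF \<Omega> f I pz\<Omega> y' D] by (simp add: pz)
      show "D v = v * s" if "v \<bullet> 1 = 0" "v \<bullet> I = 0" for v
        using differential_nonreal(2)[OF \<Omega> f I pz\<Omega> y' D that] by (simp add: s_def z0)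
    qed
    moreover have "frechet_derivative f (at p) = D" using D frechet_derivative_at by (metis pz)
    moreover note \<open>spherical_derivative \<Omega> f p = s\<close>
    moreover have "h (slice_pt I z0) = 0" by (simp add: pz hp)
    note mult = multiplicities_iff[OF h nz y' this] classical_multiplicity_ge_2_iff[OF h nz this]
    ultimately show ?thesis
      using mult[unfolded s_h, unfolded z0 pz cull] by (simp only:)
  qed
  from real nonreal show ?thesis by blast
qed

end
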